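(* Let $n\ge 2$ be an integer. The following two assertions are equivalent. (a) (The answer to the Busemann–Petty problem in $\mathbb{H}^n_{\mathbb{C}}$ is affirmative.) Whenever $K$ and $L$ are $R_\theta$-invariant convex bodies in $\mathbb{R}^{2n}$ contained in the unit ball such that $\mathrm{HVol}_{2n-2}(K\cap H_\xi)\le \mathrm{HVol}_{2n-2}(L\cap H_\xi)$ for every $\xi\in S^{2n-1}$, one has $\mathrm{HVol}_{2n}(K)\le \mathrm{HVol}_{2n}(L)$. (b) For every $R_\theta$-invariant convex body $K$ in $\mathbb{R}^{2n}$ contained in the unit ball, the distribution $$\frac{\|x\|_K^{-2}}{1-\left(\frac{|x|}{\|x\|_K}\right)^2}$$ on $\mathbb{R}^{2n}$ is positive definite.
   Context: Identify $\mathbb{C}^n$ with $\mathbb{R}^{2n}$ via $(\xi_{11}+i\xi_{12},\dots,\xi_{n1}+i\xi_{n2})\mapsto(\xi_{11},\xi_{12},\dots,\xi_{n1},\xi_{n2})$. $|\cdot|$ is the Euclidean norm and $S^{2n-1}$ the unit sphere of $\mathbb{R}^{2n}$. For $\xi\in S^{2n-1}$, $H_\xi=\{z\in\mathbb{C}^n:\sum_{k=1}^n z_k\overline{\xi_k}=0\}$, viewed as a $(2n-2)$-dimensional real subspace of $\mathbb{R}^{2n}$. A convex body is a compact convex set having the origin as an interior point. Its Minkowski functional is $\|x\|_K=\min\{a\ge 0: x\in aK\}$. A body $K$ in $\mathbb{R}^{2n}$ is $R_\theta$-invariant if for every $\theta\in[0,2\pi]$ and every $\xi\in\mathbb{R}^{2n}$,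 $\|\xi\|_K=\|(R_\theta(\xi_{11},\xi_{12}),\dots,R_\theta(\xi_{n1},\xi_{n2}))\|_K$, where $R_\theta$ is the counterclockwise rotation of $\mathbb{R}^2$ by the angle $\theta$ about the origin. "Unit ball" means the open Euclidean unit ball $\{|x|<1\}$ of $\mathbb{R}^{2n}$, which is the ball model of $\mathbb{H}^n_{\mathbb{C}}$ with the Bergman metric normalized to have constant holomorphic sectional curvature $-1$. The hyperbolic volumes are $$\mathrm{HVol}_{2n}(K)=8^n\int_K\frac{dx}{(1-|x|^2)^{n+1}},\qquad \mathrm{HVol}_{2n-2}(K\cap H_\xi)=8^{n-1}\int_{K\cap H_\xi}\frac{dx}{(1-|x|^2)^{n}},$$ where $dx$ is Lebesgue measure on $\mathbb{R}^{2n}$ and on $H_\xi$ respectively. The displayed function in (b) is a locally integrable function on $\mathbb{R}^{2n}$, homogeneous of degree $-2$, and is regarded as a tempered distribution. A distribution $f$ is positive definite if $\langle f,\varphi*\overline{\varphi}(-x)\rangle\ge 0$ for every Schwartz test function $\varphi$; equivalently, its Fourier transform satisfies $\langle\hat f,\varphi\rangle\ge 0$ for every non-negative test function $\varphi$. *)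

theory Defs
  imports "HOL-Analysis.Analysis"
begin

text \<open>
  Real \<open>2n\<close>-space is \<^typ>\<open>complex ^ 'n\<close> with \<open>n = CARD('n)\<close>. Its norm is the Euclidean norm of
  the \<open>2n\<close> real coordinates, and \<^const>\<open>lborel\<close> on this type is \<open>2n\<close>-dimensional Lebesgue measure.
\<close>

definition complex_hyperplane :: "complex ^ 'n::finite \<Rightarrow> (complex ^ 'n) set" where
  "complex_hyperplane \<xi> = {z. (\<Sum>k\<in>UNIV. z $ k * cnj (\<xi> $ k)) = 0}"

definition convex_body :: "'a::euclidean_space set \<Rightarrow> bool" where
  "convex_body K \<longleftrightarrow> compact K \<and> convex K \<and> 0 \<in> interior K"

text \<open>The minimum exists whenever \<open>K\<close> is a convex body.\<close>

definition minkowski_functional :: "'a::real_vector set \<Rightarrow> 'a \<Rightarrow> real" where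
  "minkowski_functional K x = (LEAST a. 0 \<le> a \<and> x \<in> (*\<^sub>R) a ` K)"

text \<open>Multiplication by \<open>cis \<theta>\<close> is the counterclockwise rotation of the plane by the angle \<open>\<theta>\<close>.\<close>

definition rotate_coords :: "real \<Rightarrow> complex ^ 'n::finite \<Rightarrow> complex ^ 'n" where
  "rotate_coords \<theta> \<xi> = (\<chi> k. cis \<theta> * \<xi> $ k)"

definition rotation_invariant :: "(complex ^ 'n::finite) set \<Rightarrow> bool" where
  "rotation_invariant K \<longleftrightarrow>
     (\<forall>\<theta>\<in>{0..2 * pi}. \<forall>\<xi>. minkowski_functional K \<xi> = minkowski_functional K (rotate_coords \<theta> \<xi>))"

text \<open>
  Lebesgue measure on a linear subspace \<open>V\<close>, as a measure on the ambient space concentrated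
  on \<open>V\<close>: the image of product Lebesgue measure under the coordinates of an orthonormal basis
  of \<open>V\<close>. By rotation invariance of Lebesgue measure the choice of basis is immaterial. \<^const>\<open>lborel\<close>
  itself is the case \<open>V = UNIV\<close> with the standard basis.
\<close>

definition lborel_subspace :: "'a::euclidean_space set \<Rightarrow> 'a measure" where
  "lborel_subspace V =
     (let B = (SOME B. pairwise orthogonal B \<and> (\<forall>b\<in>B. norm b = 1) \<and> span B = V)
      in distr (\<Pi>\<^sub>M b\<in>B. lborel) borel (\<lambda>f. \<Sum>b\<in>B. f b *\<^sub>R b))"

definition HVol :: "(complex ^ 'n::finite) set \<Rightarrow> real" where
  "HVol K = 8 ^ CARD('n) * (LINT x:K|lborel. 1 / (1 - (norm x)\<^sup>2) ^ (CARD('n) + 1))"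

definition HVol_section :: "(complex ^ 'n::finite) set \<Rightarrow> complex ^ 'n \<Rightarrow> real" where
  "HVol_section K \<xi> = 8 ^ (CARD('n) - 1) *
     (LINT x:K \<inter> complex_hyperplane \<xi>|lborel_subspace (complex_hyperplane \<xi>).
        1 / (1 - (norm x)\<^sup>2) ^ CARD('n))"

text \<open>Iterated directional derivatives; the head of the list is the last derivative taken.\<close>

primrec iterated_deriv :: "'a list \<Rightarrow> ('a::euclidean_space \<Rightarrow> complex) \<Rightarrow> 'a \<Rightarrow> complex" where
  "iterated_deriv [] f = f"
| "iterated_deriv (b # bs) f = (\<lambda>x. frechet_derivative (iterated_deriv bs f) (at x) b)"

definition schwartz_function :: "('a::euclidean_space \<Rightarrow> complex) \<Rightarrow> bool" where
  "schwartz_function f \<longleftrightarrow>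
     (\<forall>bs\<in>lists Basis. (\<forall>x. iterated_deriv bs f differentiable (at x)) \<and>
        (\<forall>m::nat. bounded (range (\<lambda>x. norm x ^ m *\<^sub>R iterated_deriv bs f x))))"

definition convolution ::
  "('a::euclidean_space \<Rightarrow> complex) \<Rightarrow> ('a \<Rightarrow> complex) \<Rightarrow> 'a \<Rightarrow> complex" where
  "convolution f g x = (LINT y|lborel. f y * g (x - y))"

definition regular_distribution ::
  "('a::euclidean_space \<Rightarrow> real) \<Rightarrow> ('a \<Rightarrow> complex) \<Rightarrow> complex" where
  "regular_distribution f \<phi> = (LINT x|lborel. of_real (f x) * \<phi> x)"

text \<open>
  Membership in \<open>\<real>\<^sub>\<ge>\<^sub>0\<close> asserts that the complex value of the pairing is real and nonnegative.
\<close>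

definition positive_definite_distribution ::
  "(('a::euclidean_space \<Rightarrow> complex) \<Rightarrow> complex) \<Rightarrow> bool" where
  "positive_definite_distribution T \<longleftrightarrow>
     (\<forall>\<phi>. schwartz_function \<phi> \<longrightarrow> T (convolution \<phi> (\<lambda>x. cnj (\<phi> (- x)))) \<in> \<real>\<^sub>\<ge>\<^sub>0)"

end

theory Submission
  imports Defs
begin

text \<open>
  The two assertions are compared dimension by dimension: for \<open>n = 2\<close> both hold, and for \<open>n \<ge> 3\<close>
  both fail.

  The useful coordinate is \<open>t = \<rho>\<^sup>2 / (1 - \<rho>\<^sup>2)\<close>, where \<open>\<rho>\<close> is the radial function of the body:
  integrating the hyperbolic weights along a ray gives a multiple of \<open>t ^ (n - 1)\<close> for sections and of
  \<open>t ^ n\<close> for the full volume. With \<open>N\<close> the Minkowski functional, the function in the second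
  assertion is simply \<open>1 / (N\<^sup>2 - |x|\<^sup>2)\<close>; on the unit sphere it equals \<open>t\<close>.

  For \<open>n = 2\<close> a complex hyperplane is a complex line, which an \<open>R\<^sub>\<theta>\<close>-invariant body meets
  in a disc, so the inequality between sections says \<open>K \<subseteq> L\<close>
  (\<open>Busemann_Petty_complex_dimension_two\<close>). On the other hand, an \<open>R\<^sub>\<theta>\<close>-invariant nonnegative function of
  degree \<open>-2\<close> on \<open>\<complex>\<^sup>2\<close> is a superposition of Lebesgue measures on complex lines
  (\<open>complex_line_averaging\<close>), and the integral of an autocorrelation over a line is nonnegative
  (\<open>autocorrelation_line_integral_nonneg\<close>); so positive definiteness follows.

  For \<open>n \<ge> 3\<close> write \<open>z'\<close> for the part of \<open>z\<close> orthogonal to the first coordinate. The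
  cylinder \<open>|z\<^sub>1|\<^sup>2 \<le> 2c, |z'|\<^sup>2 \<le> c\<close> with \<open>c < 1/3\<close> lies in the unit ball, and its edge approaches the
  sphere as \<open>e = 1 - 3c\<close> tends to \<open>0\<close>. Near the edge \<open>t\<close> behaves like the reciprocal of \<open>e\<close> plus the
  distance to the edge. Hence the volume of the cylinder grows like \<open>e ^ -(n - 1)\<close>, whereas all its
  sections are at most of order \<open>e ^ -(n - 2)\<close>. A centred ball whose sections have that size has
  \<open>t ^ (n - 1)\<close> of order \<open>e ^ -(n - 2)\<close>, thus a volume of order \<open>e\<close> to the power \<open>-n (n - 2) / (n - 1)\<close>.
  As \<open>n (n - 2) < (n - 1)\<^sup>2\<close>, the cylinder has the larger volume for small \<open>e\<close>
  (\<open>Busemann_Petty_counterexample\<close>).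

  The kernel \<open>1 / (N\<^sup>2 - |x|\<^sup>2)\<close> of the same cylinder concentrates, as \<open>c\<close> tends to \<open>1/3\<close>, on the cone
  \<open>2 |z'|\<^sup>2 = |z\<^sub>1|\<^sup>2\<close>, with a total mass that diverges logarithmically. The autocorrelation of
  \<open>z\<^sub>1 exp (- 2 |z|\<^sup>2)\<close> is a positive multiple of \<open>(1 - |z\<^sub>1|\<^sup>2) exp (- |z|\<^sup>2)\<close>. Integrating it along the rays
  of constant ratio \<open>s = |z'|\<^sup>2 / |z\<^sub>1|\<^sup>2\<close> produces the sign of \<open>2 + s - n\<close>, which is negative on the cone
  when \<open>n \<ge> 3\<close>. The pairing is therefore negative for \<open>c\<close> close to \<open>1/3\<close>
  (\<open>cylinder_not_positive_definite\<close>).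

  All the integrals are computed in one way: Lebesgue measure on a subspace is the same for every
  orthonormal basis (\<open>coord_measure_unique\<close>), and in a basis through a complex line the
  integral of a function of \<open>|z\<^sub>1|\<^sup>2\<close> and \<open>|z'|\<^sup>2\<close> is an iterated integral over two half-lines
  (\<open>nn_integral_complex_line_split\<close>).
\<close>

section \<open>Lebesgue measure on subspaces\<close>

definition orthonormal_set :: "'a::euclidean_space set \<Rightarrow> bool" where
  "orthonormal_set B \<longleftrightarrow> pairwise orthogonal B \<and> (\<forall>b\<in>B. norm b = 1)"

text \<open>
  The measure in the definition of \<^const>\<open>lborel_subspace\<close> with the basis as a parameter.
\<close>

definition coord_measure :: "'a::euclidean_space set \<Rightarrow> 'a measure" where
  "coord_measure B = distr (\<Pi>\<^sub>M b\<in>B. lborel) borel (\<lambda>f. \<Sum>b\<in>B. f b *\<^sub>R b)"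

lemma orthonormal_set_finite: "orthonormal_set B \<Longrightarrow> finite B"
  unfolding orthonormal_set_def
  by (metis independent_imp_finite norm_zero pairwise_orthogonal_independent zero_neq_one)

lemma orthonormal_set_card: "orthonormal_set B \<Longrightarrow> card B = dim (span B)"
  unfolding orthonormal_set_def
  by (metis dim_eq_card_independent dim_span norm_zero pairwise_orthogonal_independent zero_neq_one)

lemma norm_orthonormal_sum:
  assumes "orthonormal_set B"
  shows "(norm (\<Sum>b\<in>B. f b *\<^sub>R b))\<^sup>2 = (\<Sum>b\<in>B. (f b)\<^sup>2)"
proof -
  have fin: "finite B" by (rule orthonormal_set_finite[OF assms])
  have "(norm (\<Sum>b\<in>B. f b *\<^sub>R b))\<^sup>2 = (\<Sum>b\<in>B. (norm (f b *\<^sub>R b))\<^sup>2)"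
    by (rule norm_sum_Pythagorean[OF fin])
       (use assms in \<open>auto simp: orthonormal_set_def pairwise_def orthogonal_def\<close>)
  also have "\<dots> = (\<Sum>b\<in>B. (f b)\<^sup>2)"
    using assms by (intro sum.cong) (auto simp: orthonormal_set_def power_mult_distrib)
  finally show ?thesis .
qed

interpretation lborel_PiM: product_sigma_finite "\<lambda>_. lborel :: real measure"
  by standard

lemma measurable_coord_sum [measurable]:
  fixes B :: "'a::euclidean_space set"
  assumes "finite B"
  shows "(\<lambda>f. \<Sum>b\<in>B. f b *\<^sub>R b) \<in> (\<Pi>\<^sub>M b\<in>B. lborel) \<rightarrow>\<^sub>M borel"
  using assms by measurable

lemma sets_coord_measure [measurable_cong, simp]: "sets (coord_measure B) = sets borel"
  by (simp add: coord_measure_def)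

lemma space_coord_measure [simp]: "space (coord_measure B) = UNIV"
  by (simp add: coord_measure_def)

lemma nn_integral_coord_measure:
  assumes "finite B" "F \<in> borel_measurable borel"
  shows "(\<integral>\<^sup>+x. F x \<partial>coord_measure B) = (\<integral>\<^sup>+f. F (\<Sum>b\<in>B. f b *\<^sub>R b) \<partial>(\<Pi>\<^sub>M b\<in>B. lborel))"
  unfolding coord_measure_def by (rule nn_integral_distr) (use assms in auto)

lemma AE_coord_measure_span:
  fixes B :: "'a::euclidean_space set"
  assumes "finite B"
  shows "AE x in coord_measure B. x \<in> span B"
proof -
  have "(\<Sum>b\<in>B. f b *\<^sub>R b) \<in> span B" for f
    by (intro span_sum span_scale span_base)
  then show ?thesis
    unfolding coord_measure_def using assms
    by (subst AE_distr_iff) simp_all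
qed

lemma emeasure_coord_measure_cball:
  assumes B: "orthonormal_set B" and r: "r > 0"
  shows "emeasure (coord_measure B) (cball 0 r) = ennreal (unit_ball_vol (card B) * r ^ card B)"
proof -
  have fin: "finite B" by (rule orthonormal_set_finite[OF B])
  have nrm: "norm (\<Sum>b\<in>B. f b *\<^sub>R b) = sqrt (\<Sum>b\<in>B. (f b)\<^sup>2)" for f
    using norm_orthonormal_sum[OF B, of f] by (metis real_sqrt_abs abs_norm_cancel)
  have "emeasure (coord_measure B) (cball 0 r) =
     emeasure (\<Pi>\<^sub>M b\<in>B. lborel)
       ((\<lambda>f. \<Sum>b\<in>B. f b *\<^sub>R b) -` cball 0 r \<inter> space (\<Pi>\<^sub>M b\<in>B. lborel))"
    unfolding coord_measure_def by (rule emeasure_distr) (use fin in auto)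
  also have "(\<lambda>f. \<Sum>b\<in>B. f b *\<^sub>R b) -` cball 0 r \<inter> space (\<Pi>\<^sub>M b\<in>B. lborel) =
       {f. sqrt (\<Sum>i\<in>B. (f i)\<^sup>2) \<le> r} \<inter> space (Pi\<^sub>M B (\<lambda>_. lborel))"
    by (auto simp: nrm)
  also have "emeasure (\<Pi>\<^sub>M b\<in>B. lborel) \<dots> = ennreal (unit_ball_vol (card B) * r ^ card B)"
    by (rule emeasure_cball_aux[OF fin r])
  finally show ?thesis .
qed

text \<open>
  Closed balls exhaust the space.
\<close>

lemma sigma_finite_of_finite_cball:
  fixes \<mu> :: "'a::euclidean_space measure"
  assumes "sets \<mu> = sets borel" "\<And>r. r > 0 \<Longrightarrow> emeasure \<mu> (cball 0 r) < \<infinity>"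
  shows "sigma_finite_measure \<mu>"
proof
  show "\<exists>A. countable A \<and> A \<subseteq> sets \<mu> \<and> \<Union> A = space \<mu> \<and> (\<forall>a\<in>A. emeasure \<mu> a \<noteq> \<infinity>)"
  proof (intro exI conjI)
    let ?A = "range (\<lambda>n. cball (0::'a) (real (Suc n)))"
    show "countable ?A" by simp
    show "?A \<subseteq> sets \<mu>" by (simp add: assms(1) image_subset_iff)
    have "\<exists>n. norm x \<le> real (Suc n)" for x :: 'a
    proof -
      obtain n :: nat where "norm x \<le> real n" using real_arch_simple by blast
      then show ?thesis by (intro exI[of _ n]) simp
    qed
    moreover have "space \<mu> = UNIV" using sets_eq_imp_space_eq[OF assms(1)] by simp
    ultimately show "\<Union> ?A = space \<mu>" by (simp add: set_eq_iff)
    have "emeasure \<mu> (cball 0 (real (Suc n))) \<noteq> \<infinity>" for n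
      using assms(2)[of "real (Suc n)"] by simp
    then show "\<forall>a\<in>?A. emeasure \<mu> a \<noteq> \<infinity>" by blast
  qed
qed

lemma sigma_finite_coord_measure:
  assumes "orthonormal_set B"
  shows "sigma_finite_measure (coord_measure B)"
  by (rule sigma_finite_of_finite_cball) (auto simp: emeasure_coord_measure_cball[OF assms])

text \<open>
  A product measure is determined by its values on boxes, and a translate of a box is a box with
  sides of the same lengths.
\<close>

lemma PiM_lborel_translate:
  fixes B :: "'a set" and c :: "'a \<Rightarrow> real"
  assumes "finite B"
  shows "distr (\<Pi>\<^sub>M b\<in>B. lborel) (\<Pi>\<^sub>M b\<in>B. lborel) (\<lambda>f. \<lambda>b\<in>B. c b + f b) = (\<Pi>\<^sub>M b\<in>B. lborel)"
proof (rule lborel_PiM.PiM_eqI[OF assms])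
  fix A :: "'a \<Rightarrow> real set" assume A: "\<And>i. i \<in> B \<Longrightarrow> A i \<in> sets lborel"
  let ?T = "\<lambda>f. \<lambda>b\<in>B. c b + f b"
  have T: "?T \<in> (\<Pi>\<^sub>M b\<in>B. lborel) \<rightarrow>\<^sub>M (\<Pi>\<^sub>M b\<in>B. lborel)" by measurable
  have "emeasure (distr (\<Pi>\<^sub>M b\<in>B. lborel) (\<Pi>\<^sub>M b\<in>B. lborel) ?T) (Pi\<^sub>E B A) =
     emeasure (\<Pi>\<^sub>M b\<in>B. lborel) (?T -` Pi\<^sub>E B A \<inter> space (\<Pi>\<^sub>M b\<in>B. lborel))"
    by (rule emeasure_distr[OF T]) (use A assms in \<open>auto intro!: sets_PiM_I_finite\<close>)
  also have "?T -` Pi\<^sub>E B A \<inter> space (\<Pi>\<^sub>M b\<in>B. lborel) = Pi\<^sub>E B (\<lambda>b. (+) (c b) -` A b)"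
    by (auto simp: space_PiM PiE_def Pi_def extensional_def)
  also have "emeasure (\<Pi>\<^sub>M b\<in>B. lborel) \<dots> = (\<Prod>b\<in>B. emeasure lborel ((+) (c b) -` A b))"
  proof (rule lborel_PiM.emeasure_PiM[OF assms])
    fix i assume "i \<in> B"
    have "(+) (c i) \<in> borel \<rightarrow>\<^sub>M (borel::real measure)" by measurable
    from measurable_sets[OF this, of "A i"] show "(+) (c i) -` A i \<in> sets lborel"
      using A[OF \<open>i \<in> B\<close>] by simp
  qed
  also have "\<dots> = (\<Prod>b\<in>B. emeasure lborel (A b))"
  proof (rule prod.cong)
    fix b assume "b \<in> B"
    have "emeasure lborel (A b) = emeasure (distr lborel borel ((+) (c b))) (A b)"
      by (simp add: lborel_distr_plus)
    also have "\<dots> = emeasure lborel ((+) (c b) -` A b)"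
      using A[OF \<open>b \<in> B\<close>] by (subst emeasure_distr) auto
    finally show "emeasure lborel ((+) (c b) -` A b) = emeasure lborel (A b)" ..
  qed simp
  finally show "emeasure (distr (\<Pi>\<^sub>M b\<in>B. lborel) (\<Pi>\<^sub>M b\<in>B. lborel) ?T) (Pi\<^sub>E B A) =
      (\<Prod>b\<in>B. emeasure lborel (A b))" .
qed simp

lemma coord_measure_translate:
  assumes B: "orthonormal_set B" and v: "v \<in> span B"
  shows "distr (coord_measure B) borel ((+) v) = coord_measure B"
proof -
  have fin: "finite B" by (rule orthonormal_set_finite[OF B])
  obtain c where c: "v = (\<Sum>b\<in>B. c b *\<^sub>R b)"
    using v by (auto simp: span_finite[OF fin])
  let ?P = "\<Pi>\<^sub>M b\<in>B. (lborel::real measure)"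
  let ?T = "\<lambda>f. \<lambda>b\<in>B. c b + f b"
  let ?S = "\<lambda>f. \<Sum>b\<in>B. f b *\<^sub>R b"
  have T: "?T \<in> ?P \<rightarrow>\<^sub>M ?P" by measurable
  have "coord_measure B = distr (distr ?P ?P ?T) borel ?S"
    by (simp add: PiM_lborel_translate[OF fin] coord_measure_def)
  also have "\<dots> = distr ?P borel (?S \<circ> ?T)"
    by (rule distr_distr) (use fin T in auto)
  also have "?S \<circ> ?T = (+) v \<circ> ?S"
    by (auto simp: fun_eq_iff c sum.distrib[symmetric] scaleR_add_left intro!: sum.cong)
  also have "distr ?P borel ((+) v \<circ> ?S) = distr (distr ?P borel ?S) borel ((+) v)"
    by (rule distr_distr[symmetric]) (use fin in auto)
  finally show ?thesis by (simp add: coord_measure_def)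
qed

text \<open>
  Haar uniqueness by Fubini. Let \<open>B\<close> be the unit ball, which is symmetric. The integral of
  \<open>1\<^sub>B y * 1\<^sub>A (x + y)\<close> against \<open>\<mu> \<Otimes> \<nu>\<close> equals \<open>\<nu> B * \<mu> A\<close> by invariance of \<open>\<mu>\<close>, and equals \<open>\<mu> B * \<nu> A\<close> by
  invariance of both; dividing by the common mass of \<open>B\<close> gives \<open>\<mu> A = \<nu> A\<close>.
\<close>

lemma translation_invariant_measure_unique:
  fixes \<mu> \<nu> :: "'a::euclidean_space measure"
  assumes sets: "sets \<mu> = sets borel" "sets \<nu> = sets borel"
    and sf: "sigma_finite_measure \<mu>" "sigma_finite_measure \<nu>"
    and ae: "AE x in \<mu>. x \<in> V" "AE x in \<nu>. x \<in> V"
    and tr: "\<And>v. v \<in> V \<Longrightarrow> distr \<mu> borel ((+) v) = \<mu>" "\<And>v. v \<in> V \<Longrightarrow> distr \<nu> borel ((+) v) = \<nu>"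
    and ball: "emeasure \<mu> (cball 0 1) = emeasure \<nu> (cball 0 1)"
       "emeasure \<mu> (cball 0 1) \<noteq> 0" "emeasure \<mu> (cball 0 1) \<noteq> \<infinity>"
    and neg: "\<And>v. v \<in> V \<Longrightarrow> - v \<in> V"
  shows "\<mu> = \<nu>"
proof (rule measure_eqI)
  show "sets \<mu> = sets \<nu>" using sets by simp
  fix A assume "A \<in> sets \<mu>"
  then have A[measurable]: "A \<in> sets borel" using sets by simp
  note sets[measurable_cong]
  interpret P: pair_sigma_finite \<nu> \<mu> using sf by (intro pair_sigma_finite.intro)
  let ?B = "cball (0::'a) 1"
  have [simp, measurable]: "?B \<in> sets borel" by (simp add: borel_closed)
  have [measurable]: "(\<lambda>p. indicator A (fst p + snd p) :: ennreal) \<in> borel_measurable (\<nu> \<Otimes>\<^sub>M \<mu>)"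
    by (rule measurable_compose[of "\<lambda>p. fst p + snd p" _ borel]) (auto intro: borel_measurable_indicator)
  have m1: "nn_integral \<mu> f = (\<integral>\<^sup>+x. f (v + x) \<partial>\<mu>)"
    if [measurable]: "f \<in> borel_measurable borel" and v: "v \<in> V" for f v
  proof -
    have "nn_integral \<mu> f = nn_integral (distr \<mu> borel ((+) v)) f" using tr(1)[OF v] by simp
    also have "\<dots> = (\<integral>\<^sup>+x. f (v + x) \<partial>\<mu>)" by (rule nn_integral_distr) auto
    finally show ?thesis .
  qed
  have m2: "nn_integral \<nu> f = (\<integral>\<^sup>+x. f (v + x) \<partial>\<nu>)"
    if [measurable]: "f \<in> borel_measurable borel" and v: "v \<in> V" for f v
  proof -
    have "nn_integral \<nu> f = nn_integral (distr \<nu> borel ((+) v)) f" using tr(2)[OF v] by simp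
    also have "\<dots> = (\<integral>\<^sup>+x. f (v + x) \<partial>\<nu>)" by (rule nn_integral_distr) auto
    finally show ?thesis .
  qed
  have "emeasure \<nu> ?B * emeasure \<mu> A = (\<integral>\<^sup>+y. indicator ?B y * emeasure \<mu> A \<partial>\<nu>)"
    by (subst nn_integral_multc) (auto simp: sets intro!: borel_measurable_indicator)
  also have "\<dots> = (\<integral>\<^sup>+y. (\<integral>\<^sup>+x. indicator ?B y * indicator A (y + x) \<partial>\<mu>) \<partial>\<nu>)"
  proof (rule nn_integral_cong_AE, use ae(2) in eventually_elim)
    fix y assume y: "y \<in> V"
    have "emeasure \<mu> A = (\<integral>\<^sup>+x. indicator A x \<partial>\<mu>)" by (simp add: sets)
    also have "\<dots> = (\<integral>\<^sup>+x. indicator A (y + x) \<partial>\<mu>)" by (rule m1[OF _ y]) simp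
    finally show "indicator ?B y * emeasure \<mu> A = (\<integral>\<^sup>+x. indicator ?B y * indicator A (y + x) \<partial>\<mu>)"
      by (simp add: nn_integral_cmult)
  qed
  also have "\<dots> = (\<integral>\<^sup>+x. (\<integral>\<^sup>+y. indicator ?B y * indicator A (y + x) \<partial>\<nu>) \<partial>\<mu>)"
    by (rule P.Fubini'[symmetric]) measurable
  also have "\<dots> = (\<integral>\<^sup>+x. (\<integral>\<^sup>+y. indicator ?B (y - x) * indicator A y \<partial>\<nu>) \<partial>\<mu>)"
  proof (rule nn_integral_cong_AE, use ae(1) in eventually_elim)
    fix x assume x: "x \<in> V"
    show "(\<integral>\<^sup>+y. indicator ?B y * indicator A (y + x) \<partial>\<nu>) =
          (\<integral>\<^sup>+y. indicator ?B (y - x) * indicator A y \<partial>\<nu>)"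
      by (subst m2[OF _ neg[OF x]]) auto
  qed
  also have "\<dots> = (\<integral>\<^sup>+y. (\<integral>\<^sup>+x. indicator ?B (y - x) * indicator A y \<partial>\<mu>) \<partial>\<nu>)"
    by (rule P.Fubini') measurable
  also have "\<dots> = (\<integral>\<^sup>+y. emeasure \<mu> ?B * indicator A y \<partial>\<nu>)"
  proof (rule nn_integral_cong_AE, use ae(2) in eventually_elim)
    fix y assume y: "y \<in> V"
    have "(\<integral>\<^sup>+x. indicator ?B (y - x) * indicator A y \<partial>\<mu>) =
      (\<integral>\<^sup>+x. indicator ?B (y - (y + x)) * indicator A y \<partial>\<mu>)"
      by (rule m1[OF _ y]) simp
    also have "\<dots> = (\<integral>\<^sup>+x. indicator ?B x * indicator A y \<partial>\<mu>)"
      by (intro nn_integral_cong) (auto simp: indicator_def)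
    also have "\<dots> = emeasure \<mu> ?B * indicator A y"
      by (subst nn_integral_multc) (auto simp: sets intro!: borel_measurable_indicator)
    finally show "(\<integral>\<^sup>+x. indicator ?B (y - x) * indicator A y \<partial>\<mu>) = emeasure \<mu> ?B * indicator A y" .
  qed
  also have "\<dots> = emeasure \<mu> ?B * emeasure \<nu> A"
    by (subst nn_integral_cmult_indicator) (auto simp: sets)
  finally show "emeasure \<mu> A = emeasure \<nu> A"
    using ball by (simp add: ennreal_mult_cancel_left)
qed

lemma unit_ball_vol_nontrivial:
  "ennreal (unit_ball_vol (real n)) \<noteq> 0" "ennreal (unit_ball_vol (real n)) \<noteq> \<infinity>"
  using unit_ball_vol_pos[of "real n"] by (simp_all add: ennreal_eq_0_iff not_le del: unit_ball_vol_pos)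

text \<open>
  A coordinate measure is translation invariant along its span, and its unit ball has the volume
  of a Euclidean ball; these two properties do not mention the basis.
\<close>

lemma coord_measure_unique:
  assumes B: "orthonormal_set B"
    and \<nu>: "sets \<nu> = sets borel" "sigma_finite_measure \<nu>" "AE x in \<nu>. x \<in> span B"
      "\<And>v. v \<in> span B \<Longrightarrow> distr \<nu> borel ((+) v) = \<nu>"
      "emeasure \<nu> (cball 0 1) = ennreal (unit_ball_vol (card B))"
  shows "\<nu> = coord_measure B"
proof (rule translation_invariant_measure_unique[where V = "span B"])
  note fin = orthonormal_set_finite[OF B]
  have b: "emeasure (coord_measure B) (cball 0 1) = ennreal (unit_ball_vol (card B))"
    using emeasure_coord_measure_cball[OF B, of 1] by simp
  show "emeasure \<nu> (cball 0 1) = emeasure (coord_measure B) (cball 0 1)" using b \<nu> by simp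
  show "emeasure \<nu> (cball 0 1) \<noteq> 0" "emeasure \<nu> (cball 0 1) \<noteq> \<infinity>"
    using \<nu>(5) unit_ball_vol_nontrivial by simp_all
qed (use \<nu> B AE_coord_measure_span[OF orthonormal_set_finite[OF B]] in
   \<open>auto simp: sigma_finite_coord_measure coord_measure_translate span_neg\<close>)

lemma coord_measure_cong:
  assumes "orthonormal_set B" "orthonormal_set C" "span B = span C"
  shows "coord_measure B = coord_measure C"
proof (rule coord_measure_unique[OF assms(2)])
  show "emeasure (coord_measure B) (cball 0 1) = ennreal (unit_ball_vol (card C))"
    using emeasure_coord_measure_cball[OF assms(1), of 1] assms
    by (simp add: orthonormal_set_card)
qed (use assms AE_coord_measure_span[OF orthonormal_set_finite[OF assms(1)]] in
   \<open>auto simp: sigma_finite_coord_measure coord_measure_translate\<close>)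

lemma orthonormal_set_exists:
  assumes "subspace V"
  obtains B where "orthonormal_set B" "span B = V"
  using orthonormal_basis_subspace[OF assms] unfolding orthonormal_set_def by metis

lemma lborel_subspace_eq:
  assumes "orthonormal_set B" "span B = V"
  shows "lborel_subspace V = coord_measure B"
proof -
  define C where "C = (SOME B. pairwise orthogonal B \<and> (\<forall>b\<in>B. norm b = 1) \<and> span B = V)"
  have "\<exists>B. pairwise orthogonal B \<and> (\<forall>b\<in>B. norm b = 1) \<and> span B = V"
    using assms by (auto simp: orthonormal_set_def)
  from someI_ex[OF this] have C: "orthonormal_set C" "span C = V"
    by (auto simp: C_def orthonormal_set_def)
  have "lborel_subspace V = coord_measure C"
    by (simp add: lborel_subspace_def C_def coord_measure_def Let_def)
  also have "\<dots> = coord_measure B" using assms C by (intro coord_measure_cong) auto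
  finally show ?thesis .
qed

lemma emeasure_lborel_cball_0_1:
  "emeasure lborel (cball (0::'a::euclidean_space) 1) = ennreal (unit_ball_vol DIM('a))"
  by (subst emeasure_cball) auto

lemma lborel_subspace_UNIV: "lborel_subspace UNIV = (lborel :: 'a::euclidean_space measure)"
proof -
  obtain B :: "'a set" where B: "orthonormal_set B" "span B = UNIV"
    using orthonormal_set_exists[OF subspace_UNIV] .
  have "lborel = coord_measure B"
    by (rule coord_measure_unique[OF B(1)])
       (use B orthonormal_set_card[OF B(1)] in
        \<open>auto simp: lborel_distr_plus emeasure_lborel_cball_0_1 sigma_finite_lborel\<close>)
  then show ?thesis using lborel_subspace_eq[OF B] by simp
qed

text \<open>
  A linear isometry conjugates translations to translations and fixes balls, so the uniqueness of
  translation-invariant measures applies.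
\<close>

lemma distr_lborel_linear_isometry:
  fixes T :: "'a::euclidean_space \<Rightarrow> 'a"
  assumes T: "linear T" "\<And>x. norm (T x) = norm x" and S: "\<And>x. T (S x) = x"
  shows "distr lborel borel T = lborel"
proof -
  have contT: "continuous_on UNIV T" using T(1) by (simp add: linear_continuous_on linear_conv_bounded_linear)
  then have [measurable]: "T \<in> borel_measurable borel" by (rule borel_measurable_continuous_onI)
  have pre: "T -` cball 0 r = cball 0 r" for r using T(2) by auto
  show ?thesis
  proof (rule translation_invariant_measure_unique[where V = UNIV])
    show "sigma_finite_measure (distr lborel borel T)"
    proof (rule sigma_finite_of_finite_cball)
      show "emeasure (distr lborel borel T) (cball 0 r) < \<infinity>" if "r > 0" for r
        using that by (subst emeasure_distr) (auto simp: pre emeasure_cball)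
    qed simp
    fix v :: 'a
    have "distr (distr lborel borel T) borel ((+) v) = distr lborel borel ((+) v \<circ> T)"
      by (rule distr_distr) auto
    also have "(+) v \<circ> T = T \<circ> (+) (S v)"
      using S T(1) by (auto simp: fun_eq_iff linear_add)
    also have "distr lborel borel (T \<circ> (+) (S v)) = distr (distr lborel borel ((+) (S v))) borel T"
      by (rule distr_distr[symmetric]) auto
    also have "\<dots> = distr lborel borel T" by (simp add: lborel_distr_plus)
    finally show "distr (distr lborel borel T) borel ((+) v) = distr lborel borel T" .
    have eq: "emeasure (distr lborel borel T) (cball 0 1) = emeasure lborel (cball (0::'a) 1)"
      by (subst emeasure_distr) (auto simp: pre)
    then show "emeasure (distr lborel borel T) (cball 0 1) = emeasure lborel (cball (0::'a) 1)" .
    show "emeasure (distr lborel borel T) (cball 0 1) \<noteq> 0" "emeasure (distr lborel borel T) (cball 0 1) \<noteq> \<infinity>"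
      unfolding eq emeasure_lborel_cball_0_1 using unit_ball_vol_nontrivial by simp_all
  qed (auto simp: lborel_distr_plus sigma_finite_lborel)
qed

text \<open>
  Fubini for an orthogonal decomposition.
\<close>

lemma nn_integral_coord_measure_Un:
  fixes F :: "'a::euclidean_space \<Rightarrow> ennreal"
  assumes "finite B" "finite C" "B \<inter> C = {}" and F[measurable]: "F \<in> borel_measurable borel"
  shows "(\<integral>\<^sup>+z. F z \<partial>coord_measure (B \<union> C)) =
         (\<integral>\<^sup>+x. \<integral>\<^sup>+y. F (x + y) \<partial>coord_measure C \<partial>coord_measure B)"
proof -
  let ?P = "\<lambda>B. \<Pi>\<^sub>M b\<in>B. (lborel::real measure)"
  let ?S = "\<lambda>B f. \<Sum>b\<in>B. f b *\<^sub>R b"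
  have fin: "finite (B \<union> C)" using assms by simp
  interpret PC: finite_product_sigma_finite "\<lambda>_. lborel::real measure" C by standard fact
  have "(\<integral>\<^sup>+z. F z \<partial>coord_measure (B \<union> C)) = (\<integral>\<^sup>+f. F (?S (B \<union> C) f) \<partial>?P (B \<union> C))"
    by (rule nn_integral_coord_measure[OF fin F])
  also have "\<dots> = (\<integral>\<^sup>+f. \<integral>\<^sup>+g. F (?S (B \<union> C) (merge B C (f, g))) \<partial>?P C \<partial>?P B)"
    by (rule lborel_PiM.product_nn_integral_fold) (use assms fin in auto)
  also have "\<dots> = (\<integral>\<^sup>+f. \<integral>\<^sup>+g. F (?S B f + ?S C g) \<partial>?P C \<partial>?P B)"
  proof (intro nn_integral_cong)
    fix f g
    have "?S (B \<union> C) (merge B C (f, g)) = ?S B (merge B C (f, g)) + ?S C (merge B C (f, g))"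
      by (rule sum.union_disjoint) (use assms in auto)
    also have "?S B (merge B C (f, g)) = ?S B f"
      by (intro sum.cong) (use assms in \<open>auto simp: merge_def\<close>)
    also have "?S C (merge B C (f, g)) = ?S C g"
      by (intro sum.cong) (use assms in \<open>auto simp: merge_def\<close>)
    finally show "F (?S (B \<union> C) (merge B C (f, g))) = F (?S B f + ?S C g)" by simp
  qed
  also have "\<dots> = (\<integral>\<^sup>+f. \<integral>\<^sup>+y. F (?S B f + y) \<partial>coord_measure C \<partial>?P B)"
    by (intro nn_integral_cong nn_integral_coord_measure[symmetric]) (use assms in auto)
  also have "\<dots> = (\<integral>\<^sup>+x. \<integral>\<^sup>+y. F (x + y) \<partial>coord_measure C \<partial>coord_measure B)"
  proof (rule nn_integral_coord_measure[symmetric, OF assms(1)])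
    have "(\<lambda>x. \<integral>\<^sup>+g. F (x + ?S C g) \<partial>?P C) \<in> borel_measurable borel"
      using assms(2) by measurable
    also have "(\<lambda>x. \<integral>\<^sup>+g. F (x + ?S C g) \<partial>?P C) = (\<lambda>x. \<integral>\<^sup>+y. F (x + y) \<partial>coord_measure C)"
      by (intro ext nn_integral_coord_measure[symmetric]) (use assms in auto)
    finally show "(\<lambda>x. \<integral>\<^sup>+y. F (x + y) \<partial>coord_measure C) \<in> borel_measurable borel" .
  qed
  finally show ?thesis .
qed

text \<open>
  The density of \<open>|x|\<^sup>2\<close> under Lebesgue measure in real dimension \<open>2 * k\<close>: the derivative of the ball
  volume \<open>\<pi> ^ k * v ^ k / k!\<close> with respect to the squared radius \<open>v\<close>. In even dimension the squared
  radius is the convenient variable because only integral powers occur.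
\<close>

definition radial_density :: "nat \<Rightarrow> real \<Rightarrow> real" where
  "radial_density k v = indicator {0..} v * (pi ^ k / fact (k - 1) * v ^ (k - 1))"

lemma borel_measurable_radial_density [measurable]: "radial_density k \<in> borel_measurable borel"
  unfolding radial_density_def by measurable

lemma nn_integral_radial_density:
  assumes k: "k \<ge> 1" and a: "a \<ge> 0"
  shows "(\<integral>\<^sup>+v. ennreal (radial_density k v) * indicator {..a} v \<partial>lborel) = ennreal (pi ^ k / fact k * a ^ k)"
proof -
  have "(\<integral>\<^sup>+v. ennreal (radial_density k v) * indicator {..a} v \<partial>lborel) =
    (\<integral>\<^sup>+v. ennreal (pi ^ k / fact (k - 1) * v ^ (k - 1)) * indicator {0..a} v \<partial>lborel)"
    by (intro nn_integral_cong) (auto simp: radial_density_def split: split_indicator)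
  also have "\<dots> = ennreal (pi ^ k / fact k * a ^ k - pi ^ k / fact k * 0 ^ k)"
  proof (rule nn_integral_FTC_Icc)
    fix x :: real assume x: "x \<in> {0..a}"
    then show "0 \<le> pi ^ k / fact (k - 1) * x ^ (k - 1)" by auto
    have "((\<lambda>v. pi ^ k / fact k * v ^ k) has_real_derivative pi ^ k / fact k * (real k * x ^ (k - 1))) (at x)"
      by (auto intro!: derivative_eq_intros)
    moreover have "pi ^ k / fact k * (real k * x ^ (k - 1)) = pi ^ k / fact (k - 1) * x ^ (k - 1)"
      using k fact_reduce[of k, where ?'a = real] by (simp add: field_simps)
    ultimately show "DERIV (\<lambda>v. pi ^ k / fact k * v ^ k) x :> pi ^ k / fact (k - 1) * x ^ (k - 1)" by simp
  qed (use a in auto)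
  finally show ?thesis using k by (simp add: power_0_left)
qed

lemma distr_norm_squared_coord_measure:
  assumes B: "orthonormal_set B" and card: "card B = 2 * k" "k \<ge> 1"
  shows "distr (coord_measure B) borel (\<lambda>x. (norm x)\<^sup>2) = density lborel (\<lambda>v. ennreal (radial_density k v))"
    (is "?M = ?N")
proof (rule measure_eqI_generator_eq[where E = "range (\<lambda>a::real. {..a})" and \<Omega> = UNIV and A = "\<lambda>n::nat. {..real n}"])
  show "Int_stable (range (\<lambda>a::real. {..a}))"
    by (auto simp: Int_stable_def)
  have bl: "(borel :: real measure) = sigma UNIV (range (\<lambda>a. {..a}))" by (rule borel_eq_atMost)
  show "sets ?M = sigma_sets UNIV (range (\<lambda>a::real. {..a}))"
    by (simp add: bl)
  show "sets ?N = sigma_sets UNIV (range (\<lambda>a::real. {..a}))"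
    by (simp add: bl)
  have vol: "unit_ball_vol (real (card B)) = pi ^ k / fact k"
    using unit_ball_vol_even[of k] card by simp
  have M: "emeasure ?M {..a} = ennreal (pi ^ k / fact k * a ^ k)" if "a > 0" for a
  proof -
    have pre: "(\<lambda>x. (norm x)\<^sup>2) -` {..a} = cball 0 (sqrt a)"
      by (auto simp: set_eq_iff) (metis abs_norm_cancel real_sqrt_abs real_sqrt_le_iff)+
    have "emeasure ?M {..a} = emeasure (coord_measure B) (cball 0 (sqrt a))"
      by (subst emeasure_distr) (auto simp: pre)
    also have "\<dots> = ennreal (pi ^ k / fact k * sqrt a ^ (2 * k))"
      using that by (subst emeasure_coord_measure_cball[OF B]) (auto simp: vol card(1)[symmetric])
    also have "sqrt a ^ (2 * k) = a ^ k" using that by (simp add: power_mult)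
    finally show ?thesis .
  qed
  have N: "emeasure ?N {..a} = ennreal (pi ^ k / fact k * a ^ k)" if "a \<ge> 0" for a
    by (subst emeasure_density) (use nn_integral_radial_density[OF card(2) that] in auto)
  fix X :: "real set" assume "X \<in> range (\<lambda>a::real. {..a})"
  then obtain a where X: "X = {..a}" by auto
  have M0: "emeasure ?M {..0} = 0"
  proof (rule ccontr)
    assume ne: "emeasure ?M {..0} \<noteq> 0"
    have le: "emeasure ?M {..0} \<le> ennreal (pi ^ k / fact k * a ^ k)" if "a > 0" for a
      using emeasure_mono[of "{..0}" "{..a}" ?M] M[OF that] that by auto
    have lim: "((\<lambda>a. ennreal (pi ^ k / fact k * a ^ k)) \<longlongrightarrow> ennreal (pi ^ k / fact k * 0 ^ k)) (at_right 0)"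
      by (intro tendsto_intros) 
    have "emeasure ?M {..0} \<le> ennreal (pi ^ k / fact k * 0 ^ k)"
      by (rule tendsto_lowerbound[OF lim])
         (use le in \<open>auto simp: eventually_at_right_field intro!: exI[of _ 1]\<close>)
    with ne card(2) show False by (simp add: power_0_left)
  qed
  show "emeasure ?M X = emeasure ?N X"
  proof (cases "a > 0")
    case True then show ?thesis using M N X by simp
  next
    case False
    then have "emeasure ?M X \<le> emeasure ?M {..0}" "emeasure ?N X \<le> emeasure ?N {..0}"
      by (auto intro!: emeasure_mono simp: X)
    moreover have "emeasure ?N {..0} = 0" using N[of 0] card(2) by (simp add: power_0_left)
    ultimately show ?thesis using M0 by simp
  qed
next
  fix i :: nat
  have "emeasure (distr (coord_measure B) borel (\<lambda>x. (norm x)\<^sup>2)) {..real i} \<le>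
     emeasure (coord_measure B) (cball 0 (real i + 1))"
  proof (subst emeasure_distr)
    show "emeasure (coord_measure B) ((\<lambda>x. (norm x)\<^sup>2) -` {..real i} \<inter> space (coord_measure B)) \<le>
        emeasure (coord_measure B) (cball 0 (real i + 1))"
    proof (rule emeasure_mono)
      show "(\<lambda>x. (norm x)\<^sup>2) -` {..real i} \<inter> space (coord_measure B) \<subseteq> cball 0 (real i + 1)"
      proof (clarsimp)
        fix x :: 'a assume "(norm x)\<^sup>2 \<le> real i"
        also have "\<dots> \<le> (real i + 1)\<^sup>2" by (simp add: power2_eq_square algebra_simps)
        finally show "norm x \<le> real i + 1" by (rule power2_le_imp_le) simp
      qed
    qed simp
  qed auto
  also have "\<dots> < \<infinity>" by (subst emeasure_coord_measure_cball[OF B]) auto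
  finally show "emeasure (distr (coord_measure B) borel (\<lambda>x. (norm x)\<^sup>2)) {..real i} \<noteq> \<infinity>" by simp
qed (auto intro: real_arch_simple)

lemma nn_integral_radial:
  assumes B: "orthonormal_set B" "card B = 2 * k" "k \<ge> 1" and F[measurable]: "F \<in> borel_measurable borel"
  shows "(\<integral>\<^sup>+x. F ((norm x)\<^sup>2) \<partial>coord_measure B) = (\<integral>\<^sup>+v. ennreal (radial_density k v) * F v \<partial>lborel)"
proof -
  have "(\<integral>\<^sup>+x. F ((norm x)\<^sup>2) \<partial>coord_measure B) = (\<integral>\<^sup>+v. F v \<partial>distr (coord_measure B) borel (\<lambda>x. (norm x)\<^sup>2))"
    by (rule nn_integral_distr[symmetric]) auto
  also have "\<dots> = (\<integral>\<^sup>+v. F v \<partial>density lborel (\<lambda>v. ennreal (radial_density k v)))"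
    by (simp only: distr_norm_squared_coord_measure[OF B(1-3)])
  also have "\<dots> = (\<integral>\<^sup>+v. ennreal (radial_density k v) * F v \<partial>lborel)"
    by (rule nn_integral_density) auto
  finally show ?thesis .
qed

section \<open>Complex lines and hyperplanes\<close>

text \<open>
  The Hermitian inner product, linear in the first argument.
\<close>

definition cdot :: "complex ^ 'n::finite \<Rightarrow> complex ^ 'n \<Rightarrow> complex" where
  "cdot z w = (\<Sum>k\<in>UNIV. z $ k * cnj (w $ k))"

lemma complex_hyperplane_cdot: "complex_hyperplane \<xi> = {z. cdot z \<xi> = 0}"
  by (simp add: complex_hyperplane_def cdot_def)

lemma cdot_add_left: "cdot (x + y) w = cdot x w + cdot y w"
  and cdot_diff_left: "cdot (x - y) w = cdot x w - cdot y w"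
  and cdot_smult_left: "cdot (c *s x) w = c * cdot x w"
  and cdot_smult_right: "cdot x (c *s w) = cnj c * cdot x w"
  and cdot_zero_left [simp]: "cdot 0 w = 0"
  by (simp_all add: cdot_def algebra_simps sum.distrib sum_subtractf sum_distrib_left)

lemma scaleR_eq_smult: "r *\<^sub>R (x :: complex ^ 'n::finite) = of_real r *s x"
  by (simp add: vec_eq_iff) (simp add: scaleR_conv_of_real)

lemma cdot_scaleR_left: "cdot (r *\<^sub>R x) w = of_real r * cdot x w"
  by (simp add: scaleR_eq_smult cdot_smult_left)

lemma cdot_commute: "cdot x y = cnj (cdot y x)"
  by (simp add: cdot_def mult.commute)

lemma Re_cdot: "Re (cdot x y) = x \<bullet> y"
  by (simp add: cdot_def inner_vec_def inner_complex_def)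

lemma cdot_self: "cdot x x = of_real ((norm x)\<^sup>2)"
proof -
  have "Im (cdot x x) = 0" by (simp add: cdot_def)
  moreover have "Re (cdot x x) = (norm x)\<^sup>2" by (simp add: Re_cdot power2_norm_eq_inner)
  ultimately show ?thesis by (simp add: complex_eq_iff)
qed

lemma norm_smult_vec: "norm (c *s (x :: complex ^ 'n::finite)) = cmod c * norm x"
  by (simp add: norm_vec_def norm_mult L2_set_right_distrib)

lemma continuous_on_cdot [continuous_intros]: "continuous_on S (\<lambda>z. cdot z w)"
  unfolding cdot_def by (intro continuous_intros)

lemma borel_measurable_cdot [measurable]: "(\<lambda>z. cdot z w) \<in> borel_measurable borel"
  by (intro borel_measurable_continuous_onI continuous_intros)

text \<open>
  Pythagoras for the projection along the complex line through \<open>\<eta>\<close>.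
\<close>

lemma norm_diff_projection:
  assumes "norm \<eta> = 1"
  shows "(norm (z - cdot z \<eta> *s \<eta>))\<^sup>2 = (norm z)\<^sup>2 - (cmod (cdot z \<eta>))\<^sup>2"
proof -
  have "complex_of_real ((norm (z - cdot z \<eta> *s \<eta>))\<^sup>2) = cdot (z - cdot z \<eta> *s \<eta>) (z - cdot z \<eta> *s \<eta>)"
    by (simp only: cdot_self)
  also have "\<dots> = cdot z (z - cdot z \<eta> *s \<eta>) - cdot z \<eta> * cdot \<eta> (z - cdot z \<eta> *s \<eta>)"
    by (simp add: cdot_diff_left cdot_smult_left)
  also have "cdot \<eta> (z - cdot z \<eta> *s \<eta>) = 0"
    by (subst cdot_commute) (simp add: cdot_diff_left cdot_smult_left cdot_self assms)
  also have "cdot z (z - cdot z \<eta> *s \<eta>) = cnj (cdot z z - cdot z \<eta> * cdot \<eta> z)"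
    by (subst cdot_commute) (simp add: cdot_diff_left cdot_smult_left)
  also have "\<dots> = of_real ((norm z)\<^sup>2 - (cmod (cdot z \<eta>))\<^sup>2)"
    by (subst (3) cdot_commute) (simp add: cdot_self complex_norm_square[symmetric] mult.commute)
  finally show ?thesis by (simp only: mult_zero_right diff_zero of_real_eq_iff)
qed

lemma cmod_cdot_le:
  assumes "norm \<eta> = 1"
  shows "(cmod (cdot z \<eta>))\<^sup>2 \<le> (norm z)\<^sup>2"
  using norm_diff_projection[OF assms, of z] zero_le_power2[of "norm (z - cdot z \<eta> *s \<eta>)"] by linarith

lemma subspace_complex_hyperplane: "subspace (complex_hyperplane \<xi>)"
  unfolding complex_hyperplane_cdot
  by (auto simp: subspace_def cdot_add_left cdot_scaleR_left)

lemma smult_complex_hyperplane: "z \<in> complex_hyperplane \<xi> \<Longrightarrow> c *s z \<in> complex_hyperplane \<xi>"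
  by (auto simp: complex_hyperplane_cdot cdot_smult_left)

definition complex_line_basis :: "complex ^ 'n::finite \<Rightarrow> (complex ^ 'n) set" where
  "complex_line_basis \<eta> = {\<eta>, \<i> *s \<eta>}"

lemma inner_complex_line_basis:
  assumes "norm \<eta> = 1"
  shows "\<eta> \<bullet> (\<i> *s \<eta>) = 0" "\<eta> \<noteq> \<i> *s \<eta>"
proof -
  show *: "\<eta> \<bullet> (\<i> *s \<eta>) = 0"
    unfolding Re_cdot[symmetric] by (simp add: cdot_smult_right cdot_self)
  show "\<eta> \<noteq> \<i> *s \<eta>" using * assms by (metis norm_zero inner_eq_zero_iff zero_neq_one)
qed

lemma orthonormal_complex_line_basis:
  assumes "norm \<eta> = 1"
  shows "orthonormal_set (complex_line_basis \<eta>)" "card (complex_line_basis \<eta>) = 2"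
  using inner_complex_line_basis[OF assms] assms
  by (auto simp: orthonormal_set_def complex_line_basis_def pairwise_insert orthogonal_def
       norm_smult_vec inner_commute)

lemma smult_in_span_line:
  "c *s \<eta> \<in> span (complex_line_basis \<eta>)"
proof -
  have "c *s \<eta> = Re c *\<^sub>R \<eta> + Im c *\<^sub>R (\<i> *s \<eta>)"
    by (simp add: vec_eq_iff complex_eq_iff)
  also have "\<dots> \<in> span (complex_line_basis \<eta>)"
    by (intro span_add span_scale span_base) (auto simp: complex_line_basis_def)
  finally show ?thesis .
qed

lemma span_line_cdot:
  assumes "norm \<eta> = 1" "x \<in> span (complex_line_basis \<eta>)"
  shows "x = cdot x \<eta> *s \<eta>"
  using assms(2)
proof (induction rule: span_induct_alt)
  case (step c x y)
  have "cdot x \<eta> *s \<eta> = x"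
    using step(1) by (auto simp: complex_line_basis_def cdot_smult_left cdot_self assms)
  then have "(of_real c * cdot x \<eta>) *s \<eta> = c *\<^sub>R x"
    by (simp add: scaleR_eq_smult flip: vector_smult_assoc)
  then show ?case using step(2)
    by (simp add: cdot_add_left cdot_scaleR_left vector_sadd_rdistrib)
qed simp

text \<open>
  A complex subspace has a real orthonormal basis that starts with \<open>\<eta>, \<i>\<eta>\<close>; the remaining vectors
  span the Hermitian complement of \<open>\<eta>\<close> in it.
\<close>

lemma orthonormal_basis_through_line:
  fixes V :: "(complex ^ 'n::finite) set"
  assumes V: "subspace V" "\<And>z. z \<in> V \<Longrightarrow> \<i> *s z \<in> V" and \<eta>: "\<eta> \<in> V" "norm \<eta> = 1"
    and dim: "dim V = 2 * k + 2"
  obtains C where "orthonormal_set C" "card C = 2 * k" "complex_line_basis \<eta> \<inter> C = {}"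
    "orthonormal_set (complex_line_basis \<eta> \<union> C)" "span (complex_line_basis \<eta> \<union> C) = V"
    "\<And>y. y \<in> span C \<Longrightarrow> cdot y \<eta> = 0"
proof -
  let ?B = "complex_line_basis \<eta>"
  define W where "W = {z \<in> V. cdot z \<eta> = 0}"
  have W: "subspace W" using V(1) by (auto simp: W_def subspace_def cdot_add_left cdot_scaleR_left)
  obtain C where C: "orthonormal_set C" "span C = W" using orthonormal_set_exists[OF W] .
  have B: "orthonormal_set ?B" "card ?B = 2" using orthonormal_complex_line_basis[OF \<eta>(2)] .
  have CW: "c \<in> W" if "c \<in> C" for c using that C(2) span_base by blast
  have BC: "b \<bullet> c = 0" if "b \<in> ?B" "c \<in> C" for b c
  proof -
    have "cdot c b = 0" using CW[OF that(2)] that(1)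
      by (auto simp: W_def complex_line_basis_def cdot_smult_right)
    then show ?thesis by (metis Re_cdot inner_commute zero_complex.simps(1))
  qed
  then have CB: "c \<bullet> b = 0" if "b \<in> ?B" "c \<in> C" for b c
    using that by (simp add: inner_commute)
  have un: "orthonormal_set (?B \<union> C)"
    unfolding orthonormal_set_def
  proof (intro conjI ballI pairwiseI)
    fix x y assume "x \<in> ?B \<union> C" "y \<in> ?B \<union> C" "x \<noteq> y"
    then show "orthogonal x y"
      using BC CB B(1) C(1) by (auto simp: orthonormal_set_def pairwise_def orthogonal_def)
  qed (use B C in \<open>auto simp: orthonormal_set_def\<close>)
  have disj: "?B \<inter> C = {}"
  proof (rule ccontr)
    assume "?B \<inter> C \<noteq> {}"
    then obtain b where "b \<in> ?B" "b \<in> C" by auto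
    with BC[of b b] B(1) show False by (auto simp: orthonormal_set_def)
  qed
  have sp: "span (?B \<union> C) = V"
  proof
    show "span (?B \<union> C) \<subseteq> V"
      by (rule span_minimal[OF _ V(1)]) (use V \<eta> CW in \<open>auto simp: complex_line_basis_def W_def\<close>)
    show "V \<subseteq> span (?B \<union> C)"
    proof
      fix z assume z: "z \<in> V"
      have l: "cdot z \<eta> *s \<eta> \<in> span (?B \<union> C)"
        using smult_in_span_line span_mono[of ?B "?B \<union> C"] by auto
      have "?B \<subseteq> V" using V(2) \<eta>(1) by (auto simp: complex_line_basis_def)
      then have "cdot z \<eta> *s \<eta> \<in> V" using smult_in_span_line span_minimal[OF _ V(1)] by blast
      then have "z - cdot z \<eta> *s \<eta> \<in> W"
        using z V(1) by (auto simp: W_def cdot_diff_left cdot_smult_left cdot_self \<eta> intro: subspace_diff)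
      then have "z - cdot z \<eta> *s \<eta> \<in> span (?B \<union> C)"
        using C(2) span_mono[of C "?B \<union> C"] by auto
      from span_add[OF this l] show "z \<in> span (?B \<union> C)" by simp
    qed
  qed
  have "card (?B \<union> C) = 2 * k + 2" using orthonormal_set_card[OF un] dim sp by simp
  then have "card C = 2 * k"
    using card_Un_disjoint[OF orthonormal_set_finite orthonormal_set_finite disj] B C by simp
  then show ?thesis using C un disj sp by (intro that[of C]) (auto simp: W_def)
qed

text \<open>
  The squared lengths of the components of \<open>z\<close> along and across a complex line are independent
  radial variables, with the densities of dimension \<open>2\<close> and \<open>2 * k\<close>. Every volume below is
  computed from this formula, in the full space or in a hyperplane.
\<close>

theorem nn_integral_complex_line_split:
  fixes V :: "(complex ^ 'n::finite) set"
  assumes V: "subspace V" "\<And>z. z \<in> V \<Longrightarrow> \<i> *s z \<in> V" and \<eta>: "\<eta> \<in> V" "norm \<eta> = 1"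
    and dim: "dim V = 2 * k + 2" and k: "k \<ge> 1"
    and F[measurable]: "case_prod F \<in> borel_measurable (borel \<Otimes>\<^sub>M borel)"
  shows "(\<integral>\<^sup>+z. F ((cmod (cdot z \<eta>))\<^sup>2) ((norm z)\<^sup>2 - (cmod (cdot z \<eta>))\<^sup>2) \<partial>lborel_subspace V) =
    (\<integral>\<^sup>+u. ennreal (radial_density 1 u) * (\<integral>\<^sup>+v. ennreal (radial_density k v) * F u v \<partial>lborel) \<partial>lborel)"
proof -
  let ?B = "complex_line_basis \<eta>"
  obtain C where C: "orthonormal_set C" "card C = 2 * k" "?B \<inter> C = {}"
    "orthonormal_set (?B \<union> C)" "span (?B \<union> C) = V" "\<And>y. y \<in> span C \<Longrightarrow> cdot y \<eta> = 0"
    using orthonormal_basis_through_line[OF V \<eta> dim] by metis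
  have B: "orthonormal_set ?B" "card ?B = 2" using orthonormal_complex_line_basis[OF \<eta>(2)] .
  have fin: "finite ?B" "finite C" using B(1) C(1) by (auto intro: orthonormal_set_finite)
  let ?G = "\<lambda>z. F ((cmod (cdot z \<eta>))\<^sup>2) ((norm z)\<^sup>2 - (cmod (cdot z \<eta>))\<^sup>2)"
  have "(\<integral>\<^sup>+z. ?G z \<partial>lborel_subspace V) = (\<integral>\<^sup>+z. ?G z \<partial>coord_measure (?B \<union> C))"
    by (simp only: lborel_subspace_eq[OF C(4,5)])
  also have "\<dots> = (\<integral>\<^sup>+x. \<integral>\<^sup>+y. ?G (x + y) \<partial>coord_measure C \<partial>coord_measure ?B)"
    by (rule nn_integral_coord_measure_Un[OF fin C(3)]) measurable
  also have "\<dots> = (\<integral>\<^sup>+x. \<integral>\<^sup>+y. F ((norm x)\<^sup>2) ((norm y)\<^sup>2) \<partial>coord_measure C \<partial>coord_measure ?B)"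
  proof (rule nn_integral_cong_AE, use AE_coord_measure_span[OF fin(1)] in eventually_elim,
         rule nn_integral_cong_AE, use AE_coord_measure_span[OF fin(2)] in eventually_elim)
    fix x y assume x: "x \<in> span ?B" and y: "y \<in> span C"
    note xe = span_line_cdot[OF \<eta>(2) x]
    have cx: "cdot (x + y) \<eta> = cdot x \<eta>" using C(6)[OF y] by (simp add: cdot_add_left)
    have nx: "(cmod (cdot x \<eta>))\<^sup>2 = (norm x)\<^sup>2"
      by (subst (2) xe) (simp add: norm_smult_vec \<eta>)
    have "y = (x + y) - cdot (x + y) \<eta> *s \<eta>" using xe cx by simp
    then have "(norm y)\<^sup>2 = (norm (x + y))\<^sup>2 - (cmod (cdot (x + y) \<eta>))\<^sup>2"
      using norm_diff_projection[OF \<eta>(2), of "x + y"] by simp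
    then show "?G (x + y) = F ((norm x)\<^sup>2) ((norm y)\<^sup>2)" using cx nx by simp
  qed
  also have "\<dots> = (\<integral>\<^sup>+x. (\<integral>\<^sup>+v. ennreal (radial_density k v) * F ((norm x)\<^sup>2) v \<partial>lborel) \<partial>coord_measure ?B)"
    by (intro nn_integral_cong nn_integral_radial[OF C(1,2) k]) measurable
  also have "\<dots> = (\<integral>\<^sup>+u. ennreal (radial_density 1 u) * (\<integral>\<^sup>+v. ennreal (radial_density k v) * F u v \<partial>lborel) \<partial>lborel)"
    by (rule nn_integral_radial[OF B(1)]) (use B(2) in auto)
  finally show ?thesis .
qed

lemma DIM_complex_vec: "DIM(complex ^ 'n::finite) = 2 * CARD('n)"
  by simp

corollary nn_integral_complex_line_split_lborel:
  fixes \<eta> :: "complex ^ 'n::finite"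
  assumes "norm \<eta> = 1" "CARD('n) = k + 1" "k \<ge> 1"
    and F: "case_prod F \<in> borel_measurable (borel \<Otimes>\<^sub>M borel)"
  shows "(\<integral>\<^sup>+z. F ((cmod (cdot z \<eta>))\<^sup>2) ((norm z)\<^sup>2 - (cmod (cdot z \<eta>))\<^sup>2) \<partial>lborel) =
    (\<integral>\<^sup>+u. ennreal (radial_density 1 u) * (\<integral>\<^sup>+v. ennreal (radial_density k v) * F u v \<partial>lborel) \<partial>lborel)"
  using nn_integral_complex_line_split[of UNIV \<eta> k F] assms by (simp add: lborel_subspace_UNIV dim_UNIV)

text \<open>
  The hyperplane is the real orthogonal complement of the complex line spanned by \<open>\<xi>\<close>.
\<close>

lemma dim_complex_hyperplane:
  fixes \<xi> :: "complex ^ 'n::finite"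
  assumes "\<xi> \<noteq> 0"
  shows "dim (complex_hyperplane \<xi>) + 2 = 2 * CARD('n)"
proof -
  define \<eta> where "\<eta> = (1 / norm \<xi>) *\<^sub>R \<xi>"
  have \<eta>: "norm \<eta> = 1" using assms by (simp add: \<eta>_def)
  let ?S = "span (complex_line_basis \<eta>)"
  have eq: "complex_hyperplane \<xi> = {y \<in> UNIV. \<forall>x \<in> ?S. orthogonal x y}"
  proof (intro set_eqI iffI)
    fix y assume "y \<in> complex_hyperplane \<xi>"
    then have y: "cdot y \<xi> = 0" by (simp add: complex_hyperplane_cdot)
    have "orthogonal x y" if "x \<in> ?S" for x
    proof -
      have "x = cdot x \<eta> *s \<eta>" by (rule span_line_cdot[OF \<eta> that])
      also have "\<dots> = (cdot x \<eta> * of_real (1 / norm \<xi>)) *s \<xi>"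
        by (simp add: \<eta>_def scaleR_eq_smult)
      finally have "cdot y x = 0" using y by (metis cdot_smult_right mult_zero_right)
      then show ?thesis by (metis Re_cdot inner_commute orthogonal_def zero_complex.simps(1))
    qed
    then show "y \<in> {y \<in> UNIV. \<forall>x \<in> ?S. orthogonal x y}" by simp
  next
    fix y assume "y \<in> {y \<in> UNIV. \<forall>x \<in> ?S. orthogonal x y}"
    then have o: "x \<bullet> y = 0" if "x \<in> ?S" for x using that by (simp add: orthogonal_def)
    have "\<xi> = of_real (norm \<xi>) *s \<eta>" using assms by (simp add: \<eta>_def scaleR_eq_smult)
    then have "c *s \<xi> \<in> ?S" for c by (metis smult_in_span_line vector_smult_assoc)
    then have "Re (cdot y (c *s \<xi>)) = 0" for c using o by (metis Re_cdot inner_commute)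
    from this[of 1] this[of \<i>] have "cdot y \<xi> = 0" by (simp add: cdot_smult_right complex_eq_iff)
    then show "y \<in> complex_hyperplane \<xi>" by (simp add: complex_hyperplane_cdot)
  qed
  have "dim ?S = 2"
    using orthonormal_set_card[OF orthonormal_complex_line_basis(1)[OF \<eta>]]
      orthonormal_complex_line_basis(2)[OF \<eta>] by simp
  then show ?thesis
    using dim_subspace_orthogonal_to_vectors[of ?S UNIV] by (simp add: eq dim_UNIV)
qed

lemma nn_integral_radial_subspace:
  fixes V :: "'a::euclidean_space set"
  assumes "subspace V" "dim V = 2 * k" "k \<ge> 1" "F \<in> borel_measurable borel"
  shows "(\<integral>\<^sup>+x. F ((norm x)\<^sup>2) \<partial>lborel_subspace V) = (\<integral>\<^sup>+v. ennreal (radial_density k v) * F v \<partial>lborel)"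
proof -
  obtain B where B: "orthonormal_set B" "span B = V" using orthonormal_set_exists[OF assms(1)] .
  show ?thesis unfolding lborel_subspace_eq[OF B]
    by (rule nn_integral_radial[OF B(1)]) (use orthonormal_set_card[OF B(1)] B(2) assms in auto)
qed

lemma AE_lborel_subspace:
  assumes "subspace V"
  shows "AE x in lborel_subspace V. x \<in> V"
proof -
  obtain B where B: "orthonormal_set B" "span B = V" using orthonormal_set_exists[OF assms(1)] .
  show ?thesis unfolding lborel_subspace_eq[OF B] using AE_coord_measure_span[OF orthonormal_set_finite[OF B(1)]] B(2) by simp
qed

lemma sets_lborel_subspace [measurable_cong, simp]: "sets (lborel_subspace V) = sets borel"
  by (simp add: lborel_subspace_def Let_def)

lemma space_lborel_subspace [simp]: "space (lborel_subspace V) = UNIV"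
  by (simp add: lborel_subspace_def Let_def)

section \<open>Convex bodies and their hyperbolic volumes\<close>

lemma convex_body_compact: "convex_body K \<Longrightarrow> compact K"
  and convex_body_convex: "convex_body K \<Longrightarrow> convex K"
  and convex_body_0: "convex_body K \<Longrightarrow> 0 \<in> K"
  and convex_body_borel: "convex_body K \<Longrightarrow> K \<in> sets borel"
  using interior_subset by (auto simp: convex_body_def borel_compact)

lemma convex_body_scale_mono:
  assumes K: "convex_body K" and "0 \<le> a" "a \<le> b" "x \<in> (*\<^sub>R) a ` K"
  shows "x \<in> (*\<^sub>R) b ` K"
proof (cases "b = 0")
  case False
  then have b: "b > 0" using assms by simp
  obtain k where k: "k \<in> K" "x = a *\<^sub>R k" using assms by auto
  have "(a / b) *\<^sub>R k + (1 - a / b) *\<^sub>R 0 \<in> K"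
    by (rule convexD[OF convex_body_convex[OF K] k(1) convex_body_0[OF K]]) (use assms b in auto)
  then have "(a / b) *\<^sub>R k \<in> K" by simp
  moreover have "x = b *\<^sub>R ((a / b) *\<^sub>R k)" using k b by simp
  ultimately show ?thesis by blast
qed (use assms in auto)

text \<open>
  For \<open>x \<noteq> 0\<close> the numbers \<open>s \<ge> 0\<close> with \<open>s x \<in> K\<close> form a compact set that contains a positive number;
  the reciprocal of its maximum is the least admissible factor.
\<close>

lemma minkowski_functional_attained:
  assumes K: "convex_body K"
  shows "0 \<le> minkowski_functional K x \<and> x \<in> (*\<^sub>R) (minkowski_functional K x) ` K"
    and "\<And>a. 0 \<le> a \<Longrightarrow> x \<in> (*\<^sub>R) a ` K \<Longrightarrow> minkowski_functional K x \<le> a"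
proof -
  have ex: "\<exists>a. (0 \<le> a \<and> x \<in> (*\<^sub>R) a ` K) \<and> (\<forall>b. 0 \<le> b \<and> x \<in> (*\<^sub>R) b ` K \<longrightarrow> a \<le> b)"
  proof (cases "x = 0")
    case True
    then show ?thesis using convex_body_0[OF K] by (intro exI[of _ 0]) auto
  next
    case False
    define S where "S = {s. 0 \<le> s \<and> s *\<^sub>R x \<in> K}"
    obtain M where M: "\<And>y. y \<in> K \<Longrightarrow> norm y \<le> M"
      using compact_imp_bounded[OF convex_body_compact[OF K]] by (auto simp: bounded_iff)
    have "closed S"
    proof -
      have "S = {0..} \<inter> (\<lambda>s. s *\<^sub>R x) -` K" by (auto simp: S_def)
      moreover have "closed ((\<lambda>s. s *\<^sub>R x) -` K)"
        by (rule closed_vimage) (auto intro!: continuous_intros compact_imp_closed convex_body_compact[OF K])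
      ultimately show ?thesis by auto
    qed
    moreover have "S \<subseteq> {0..M / norm x}"
      using M False by (auto simp: S_def field_simps) (metis M abs_of_nonneg norm_scaleR)
    then have "bounded S" using bounded_closed_interval bounded_subset by blast
    ultimately have "compact S" by (simp add: compact_eq_bounded_closed)
    obtain e where e: "e > 0" "ball 0 e \<subseteq> K"
      using K by (auto simp: convex_body_def mem_interior)
    define d where "d = e / (2 * norm x)"
    have d: "d > 0" using e False by (simp add: d_def)
    have "d *\<^sub>R x \<in> ball 0 e" using e False by (simp add: d_def)
    then have dS: "d \<in> S" using e d by (auto simp: S_def)
    then obtain s where s: "s \<in> S" "\<And>t. t \<in> S \<Longrightarrow> t \<le> s"
      using compact_attains_sup[OF \<open>compact S\<close>] by blast
    have sp: "s > 0" using s(2)[OF dS] d by simp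
    show ?thesis
    proof (intro exI[of _ "1 / s"] conjI allI impI)
      show "x \<in> (*\<^sub>R) (1 / s) ` K"
        using s sp by (intro image_eqI[of _ _ "s *\<^sub>R x"]) (auto simp: S_def)
      fix b assume b: "0 \<le> b \<and> x \<in> (*\<^sub>R) b ` K"
      then obtain k where k: "k \<in> K" "x = b *\<^sub>R k" by auto
      with False b have bp: "b > 0" by (cases "b = 0") auto
      have "(1 / b) *\<^sub>R x \<in> K" using k bp by simp
      then have "1 / b \<le> s" using s(2) bp by (simp add: S_def)
      then show "1 / s \<le> b" using bp sp by (simp add: field_simps)
    qed (use sp in simp)
  qed
  then obtain a where a: "0 \<le> a \<and> x \<in> (*\<^sub>R) a ` K" "\<And>b. 0 \<le> b \<and> x \<in> (*\<^sub>R) b ` K \<Longrightarrow> a \<le> b"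
    by blast
  have eq: "minkowski_functional K x = a"
    unfolding minkowski_functional_def using a by (intro Least_equality) auto
  show "0 \<le> minkowski_functional K x \<and> x \<in> (*\<^sub>R) (minkowski_functional K x) ` K"
    unfolding eq by (rule a(1))
  show "minkowski_functional K x \<le> b" if "0 \<le> b" "x \<in> (*\<^sub>R) b ` K" for b
    unfolding eq using a(2) that by blast
qed

lemma minkowski_functional_nonneg: "convex_body K \<Longrightarrow> 0 \<le> minkowski_functional K x"
  using minkowski_functional_attained(1) by blast

lemma minkowski_functional_le_iff:
  assumes K: "convex_body K" and a: "0 \<le> a"
  shows "minkowski_functional K x \<le> a \<longleftrightarrow> x \<in> (*\<^sub>R) a ` K"
  using minkowski_functional_attained[OF K, where x = x] a convex_body_scale_mono[OF K] by metis

lemma minkowski_functional_le_1: "convex_body K \<Longrightarrow> minkowski_functional K x \<le> 1 \<longleftrightarrow> x \<in> K"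
  using minkowski_functional_le_iff[of K 1 x] by simp

lemma minkowski_functional_scaleR:
  assumes K: "convex_body K" and c: "c > 0"
  shows "minkowski_functional K (c *\<^sub>R x) = c * minkowski_functional K x"
proof -
  have iff: "minkowski_functional K (c *\<^sub>R x) \<le> a \<longleftrightarrow> c * minkowski_functional K x \<le> a" if a: "0 \<le> a" for a
  proof -
    have "c *\<^sub>R x \<in> (*\<^sub>R) a ` K \<longleftrightarrow> x \<in> (*\<^sub>R) (a / c) ` K"
    proof
      assume "c *\<^sub>R x \<in> (*\<^sub>R) a ` K"
      then obtain k where "k \<in> K" "c *\<^sub>R x = a *\<^sub>R k" by auto
      then have "(1 / c) *\<^sub>R (c *\<^sub>R x) = (a / c) *\<^sub>R k" by simp
      then show "x \<in> (*\<^sub>R) (a / c) ` K" using c \<open>k \<in> K\<close> by auto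
    next
      assume "x \<in> (*\<^sub>R) (a / c) ` K"
      then show "c *\<^sub>R x \<in> (*\<^sub>R) a ` K" using c by (auto simp: image_iff)
    qed
    then show ?thesis
      using minkowski_functional_le_iff[OF K a, of "c *\<^sub>R x"] minkowski_functional_le_iff[OF K, of "a / c" x] a c
      by (simp add: pos_le_divide_eq mult.commute)
  qed
  show ?thesis
  proof (rule antisym)
    show "minkowski_functional K (c *\<^sub>R x) \<le> c * minkowski_functional K x"
      using iff[of "c * minkowski_functional K x"] minkowski_functional_nonneg[OF K, of x] c by simp
    show "c * minkowski_functional K x \<le> minkowski_functional K (c *\<^sub>R x)"
      using iff[of "minkowski_functional K (c *\<^sub>R x)"] minkowski_functional_nonneg[OF K] by simp
  qed
qed

lemma minkowski_functional_gt_norm: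
  assumes K: "convex_body K" "K \<subseteq> ball 0 1" and x: "x \<noteq> 0"
  shows "norm x < minkowski_functional K x"
proof -
  let ?a = "minkowski_functional K x"
  obtain k where k: "k \<in> K" "x = ?a *\<^sub>R k" "0 \<le> ?a"
    using minkowski_functional_attained(1)[OF K(1), of x] by auto
  have "?a \<noteq> 0" using k x by auto
  then have a: "?a > 0" using k by simp
  have "norm k < 1" using k K by auto
  then have "?a * norm k < ?a * 1" using a by (intro mult_strict_left_mono)
  moreover have "norm x = ?a * norm k" by (subst k(2)) (use a in simp)
  ultimately show ?thesis by simp
qed

lemma borel_measurable_minkowski_functional:
  assumes K: "convex_body K"
  shows "minkowski_functional K \<in> borel_measurable borel"
proof (rule borel_measurableI_le)
  fix a
  show "{x \<in> space borel. minkowski_functional K x \<le> a} \<in> sets borel"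
  proof (cases "a \<ge> 0")
    case True
    then have "{x \<in> space borel. minkowski_functional K x \<le> a} = (*\<^sub>R) a ` K"
      by (auto simp: minkowski_functional_le_iff[OF K])
    also have "\<dots> \<in> sets borel"
      using convex_body_compact[OF K] by (intro borel_closed compact_imp_closed compact_scaling)
    finally show ?thesis .
  next
    case False
    then have "{x \<in> space borel. minkowski_functional K x \<le> a} = {}"
      using minkowski_functional_nonneg[OF K] by (auto simp: not_le intro: less_le_trans)
    then show ?thesis by simp
  qed
qed

lemma rotate_coords_smult: "rotate_coords \<theta> x = cis \<theta> *s x"
  by (simp add: rotate_coords_def vec_eq_iff)

text \<open>
  Multiplication by a complex number is a rotation of the coordinates followed by a dilation.
\<close>

lemma minkowski_functional_smult:
  fixes x :: "complex ^ 'n::finite"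
  assumes K: "convex_body K" "rotation_invariant K" and c: "c \<noteq> 0"
  shows "minkowski_functional K (c *s x) = cmod c * minkowski_functional K x"
proof -
  define \<theta> where "\<theta> = Arg2pi c"
  have \<theta>: "\<theta> \<in> {0..2 * pi}" using Arg2pi[of c] by (auto simp: \<theta>_def)
  have ceq: "c = of_real (cmod c) * cis \<theta>" using Arg2pi[of c] by (simp add: \<theta>_def cis_conv_exp is_Arg_def)
  have "c *s x = cmod c *\<^sub>R rotate_coords \<theta> x"
    by (subst ceq) (simp add: scaleR_eq_smult rotate_coords_smult)
  then have "minkowski_functional K (c *s x) = cmod c * minkowski_functional K (rotate_coords \<theta> x)"
    using c by (simp add: minkowski_functional_scaleR[OF K(1)])
  also have "minkowski_functional K (rotate_coords \<theta> x) = minkowski_functional K x"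
    using K(2) \<theta> unfolding rotation_invariant_def by metis
  finally show ?thesis .
qed

lemma one_minus_norm_pos:
  fixes x :: "'a::real_normed_vector"
  assumes "x \<in> K" "K \<subseteq> ball 0 1"
  shows "0 < 1 - (norm x)\<^sup>2"
  using assms by (auto simp: power_less_one_iff subset_iff abs_square_less_1)

lemma set_lebesgue_integral_weight:
  fixes K :: "'a::euclidean_space set"
  assumes K[measurable]: "K \<in> sets borel" and sub: "K \<subseteq> ball 0 1" and M[measurable_cong]: "sets M = sets borel"
  shows "(LINT x:K|M. 1 / (1 - (norm x)\<^sup>2) ^ p) =
     enn2real (\<integral>\<^sup>+x\<in>K. ennreal (1 / (1 - (norm x)\<^sup>2) ^ p) \<partial>M)"
proof -
  have "(LINT x:K|M. 1 / (1 - (norm x)\<^sup>2) ^ p) =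
      enn2real (\<integral>\<^sup>+x. ennreal (indicator K x *\<^sub>R (1 / (1 - (norm x)\<^sup>2) ^ p)) \<partial>M)"
    unfolding set_lebesgue_integral_def
  proof (rule integral_eq_nn_integral)
    show "AE x in M. 0 \<le> indicator K x *\<^sub>R (1 / (1 - (norm x)\<^sup>2) ^ p)"
      using one_minus_norm_pos[OF _ sub] by (intro AE_I2) (auto split: split_indicator simp: less_imp_le)
  qed measurable
  also have "(\<integral>\<^sup>+x. ennreal (indicator K x *\<^sub>R (1 / (1 - (norm x)\<^sup>2) ^ p)) \<partial>M) =
     (\<integral>\<^sup>+x\<in>K. ennreal (1 / (1 - (norm x)\<^sup>2) ^ p) \<partial>M)"
    by (intro nn_integral_cong) (auto split: split_indicator)
  finally show ?thesis .
qed

lemma HVol_nn: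
  fixes K :: "(complex ^ 'n::finite) set"
  assumes "K \<in> sets borel" "K \<subseteq> ball 0 1"
  shows "HVol K = 8 ^ CARD('n) *
     enn2real (\<integral>\<^sup>+x\<in>K. ennreal (1 / (1 - (norm x)\<^sup>2) ^ (CARD('n) + 1)) \<partial>lborel)"
  unfolding HVol_def by (subst set_lebesgue_integral_weight[OF assms]) auto

lemma closed_complex_hyperplane: "closed (complex_hyperplane \<xi>)"
  by (rule closed_subspace[OF subspace_complex_hyperplane])

lemma HVol_section_nn:
  fixes K :: "(complex ^ 'n::finite) set"
  assumes "K \<in> sets borel" "K \<subseteq> ball 0 1"
  shows "HVol_section K \<xi> = 8 ^ (CARD('n) - 1) *
     enn2real (\<integral>\<^sup>+x\<in>K. ennreal (1 / (1 - (norm x)\<^sup>2) ^ CARD('n)) \<partial>lborel_subspace (complex_hyperplane \<xi>))"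
proof -
  let ?H = "complex_hyperplane \<xi>"
  have "K \<inter> ?H \<in> sets borel" using assms(1) borel_closed[OF closed_complex_hyperplane] by blast
  then have "HVol_section K \<xi> = 8 ^ (CARD('n) - 1) *
     enn2real (\<integral>\<^sup>+x\<in>K \<inter> ?H. ennreal (1 / (1 - (norm x)\<^sup>2) ^ CARD('n)) \<partial>lborel_subspace ?H)"
    unfolding HVol_section_def using assms(2) by (subst set_lebesgue_integral_weight) auto
  also have "(\<integral>\<^sup>+x\<in>K \<inter> ?H. ennreal (1 / (1 - (norm x)\<^sup>2) ^ CARD('n)) \<partial>lborel_subspace ?H) =
      (\<integral>\<^sup>+x\<in>K. ennreal (1 / (1 - (norm x)\<^sup>2) ^ CARD('n)) \<partial>lborel_subspace ?H)"
    by (intro nn_integral_cong_AE, use AE_lborel_subspace[OF subspace_complex_hyperplane] in eventually_elim)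
       (auto split: split_indicator)
  finally show ?thesis .
qed

text \<open>
  The antiderivative of \<open>v ^ (k - 1) / (1 - v) ^ (k + 1)\<close> is \<open>(v / (1 - v)) ^ k / k\<close>. The case \<open>k = n\<close> is the
  hyperbolic volume of a ball, the case \<open>k = n - 1\<close> that of its sections.
\<close>

lemma nn_integral_weight_cball:
  fixes V :: "'a::euclidean_space set"
  assumes V: "subspace V" "dim V = 2 * k" "k \<ge> 1" and R: "0 \<le> R" "R < 1"
  shows "(\<integral>\<^sup>+x\<in>cball 0 R. ennreal (1 / (1 - (norm x)\<^sup>2) ^ (k + 1)) \<partial>lborel_subspace V) =
     ennreal (pi ^ k / fact k * (R\<^sup>2 / (1 - R\<^sup>2)) ^ k)"
proof -
  let ?F = "\<lambda>v. ennreal (1 / (1 - v) ^ (k + 1)) * indicator {..R\<^sup>2} v"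
  have R2: "R\<^sup>2 < 1" using R by (simp add: power_less_one_iff)
  have "(\<integral>\<^sup>+x\<in>cball 0 R. ennreal (1 / (1 - (norm x)\<^sup>2) ^ (k + 1)) \<partial>lborel_subspace V) =
    (\<integral>\<^sup>+x. ?F ((norm x)\<^sup>2) \<partial>lborel_subspace V)"
    using R by (intro nn_integral_cong) (auto split: split_indicator simp: power2_le_iff_abs_le)
  also have "\<dots> = (\<integral>\<^sup>+v. ennreal (radial_density k v) * ?F v \<partial>lborel)"
    by (rule nn_integral_radial_subspace[OF V]) measurable
  also have "\<dots> = (\<integral>\<^sup>+v. ennreal (pi ^ k / fact (k - 1) * v ^ (k - 1) / (1 - v) ^ (k + 1)) * indicator {0..R\<^sup>2} v \<partial>lborel)"
    using R2 by (intro nn_integral_cong)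
      (auto simp: radial_density_def ennreal_mult[symmetric] split: split_indicator)
  also have "\<dots> = ennreal (pi ^ k / fact k * (R\<^sup>2 / (1 - R\<^sup>2)) ^ k - pi ^ k / fact k * (0 / (1 - 0)) ^ k)"
  proof (rule nn_integral_FTC_Icc)
    fix v assume v: "v \<in> {0..R\<^sup>2}"
    then have v1: "1 - v > 0" using R2 by auto
    show "0 \<le> pi ^ k / fact (k - 1) * v ^ (k - 1) / (1 - v) ^ (k + 1)" using v v1 by simp
    obtain j where j: "k = Suc j" using V(3) by (cases k) auto
    have "((\<lambda>v. pi ^ k / fact k * (v / (1 - v)) ^ k) has_real_derivative
        pi ^ k / fact k * (real k * (v / (1 - v)) ^ (k - 1) * (1 / (1 - v)\<^sup>2))) (at v)"
    proof -
      have "((\<lambda>v. v / (1 - v)) has_real_derivative (1 / (1 - v)\<^sup>2)) (at v)"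
        using v1 by (auto intro!: derivative_eq_intros simp: power2_eq_square field_simps)
      from DERIV_cmult[OF DERIV_power[OF this, of k], of "pi ^ k / fact k"] show ?thesis
        by (simp add: mult_ac)
    qed
    also have "pi ^ k / fact k * (real k * (v / (1 - v)) ^ (k - 1) * (1 / (1 - v)\<^sup>2)) =
        pi ^ k / fact (k - 1) * v ^ (k - 1) / (1 - v) ^ (k + 1)"
    proof -
      have 1: "(v / (1 - v)) ^ (k - 1) * (1 / (1 - v)\<^sup>2) = v ^ (k - 1) / (1 - v) ^ (k + 1)"
        by (simp add: j power_divide power_add power2_eq_square)
      have 2: "pi ^ k / fact k * (real k * z) = pi ^ k / fact (k - 1) * z" for z
        by (simp add: j divide_simps)
      show ?thesis unfolding mult.assoc 1 2 by simp
    qed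
    finally show "((\<lambda>v. pi ^ k / fact k * (v / (1 - v)) ^ k) has_real_derivative
        pi ^ k / fact (k - 1) * v ^ (k - 1) / (1 - v) ^ (k + 1)) (at v)" .
  qed auto
  finally show ?thesis using V(3) by (simp add: power_0_left)
qed

lemma HVol_cball:
  fixes R :: real
  assumes R: "0 \<le> R" "R < 1"
  shows "HVol (cball 0 R :: (complex ^ 'n::finite) set) = 8 ^ CARD('n) * (pi ^ CARD('n) / fact CARD('n) * (R\<^sup>2 / (1 - R\<^sup>2)) ^ CARD('n))"
proof -
  have "R\<^sup>2 < 1" using R by (simp add: power_less_one_iff)
  moreover have "CARD('n) \<ge> 1" by (simp add: Suc_le_eq)
  ultimately show ?thesis
    using nn_integral_weight_cball[of "UNIV :: (complex ^ 'n) set" "CARD('n)" R] R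
    by (subst HVol_nn) (auto simp: lborel_subspace_UNIV dim_UNIV)
qed

lemma HVol_section_cball:
  fixes \<xi> :: "complex ^ 'n::finite"
  assumes R: "0 \<le> R" "R < 1" and N: "CARD('n) \<ge> 2" and \<xi>: "\<xi> \<noteq> 0"
  shows "HVol_section (cball 0 R) \<xi> =
    8 ^ (CARD('n) - 1) * (pi ^ (CARD('n) - 1) / fact (CARD('n) - 1) * (R\<^sup>2 / (1 - R\<^sup>2)) ^ (CARD('n) - 1))"
proof -
  have R2: "R\<^sup>2 < 1" using R by (simp add: power_less_one_iff)
  have d: "dim (complex_hyperplane \<xi>) = 2 * (CARD('n) - 1)" using dim_complex_hyperplane[OF \<xi>] by simp
  have "(\<integral>\<^sup>+x\<in>cball 0 R. ennreal (1 / (1 - (norm x)\<^sup>2) ^ CARD('n)) \<partial>lborel_subspace (complex_hyperplane \<xi>)) =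
     ennreal (pi ^ (CARD('n) - 1) / fact (CARD('n) - 1) * (R\<^sup>2 / (1 - R\<^sup>2)) ^ (CARD('n) - 1))"
    using nn_integral_weight_cball[OF subspace_complex_hyperplane d _ R] N by simp
  then show ?thesis using R R2 by (subst HVol_section_nn) auto
qed

text \<open>
  Finiteness matters because the hyperbolic volumes are Bochner integrals, which are monotone only
  between integrable functions.
\<close>

lemma nn_integral_weight_finite:
  fixes V :: "'a::euclidean_space set"
  assumes V: "subspace V" and L: "L \<subseteq> cball 0 R" "R < 1"
  shows "(\<integral>\<^sup>+x\<in>L. ennreal (1 / (1 - (norm x)\<^sup>2) ^ p) \<partial>lborel_subspace V) < \<infinity>"
proof -
  obtain B where B: "orthonormal_set B" "span B = V" using orthonormal_set_exists[OF V] .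
  define r where "r = max R (1/2)"
  have r: "r > 0" "r < 1" "L \<subseteq> cball 0 r" using L by (auto simp: r_def)
  have r2: "r\<^sup>2 < 1" using r by (simp add: power_less_one_iff)
  have "(\<integral>\<^sup>+x\<in>L. ennreal (1 / (1 - (norm x)\<^sup>2) ^ p) \<partial>lborel_subspace V) \<le>
     (\<integral>\<^sup>+x. ennreal (1 / (1 - r\<^sup>2) ^ p) * indicator (cball 0 r) x \<partial>lborel_subspace V)"
  proof (intro nn_integral_mono)
    fix x
    show "ennreal (1 / (1 - (norm x)\<^sup>2) ^ p) * indicator L x \<le> ennreal (1 / (1 - r\<^sup>2) ^ p) * indicator (cball 0 r) x"
    proof (cases "x \<in> L")
      case True
      then have x: "norm x \<le> r" using r by auto
      then have "(norm x)\<^sup>2 \<le> r\<^sup>2" by (intro power_mono) auto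
      then have "1 / (1 - (norm x)\<^sup>2) ^ p \<le> 1 / (1 - r\<^sup>2) ^ p"
        using r2 by (intro divide_left_mono power_mono mult_pos_pos zero_less_power) auto
      then show ?thesis using True x by (auto intro: ennreal_leI)
    qed simp
  qed
  also have "\<dots> = ennreal (1 / (1 - r\<^sup>2) ^ p) * emeasure (coord_measure B) (cball 0 r)"
    by (subst nn_integral_cmult_indicator) (auto simp: lborel_subspace_eq[OF B] borel_closed)
  also have "\<dots> < \<infinity>"
    by (subst emeasure_coord_measure_cball[OF B(1) r(1)]) (simp add: ennreal_mult_less_top)
  finally show ?thesis .
qed

lemma HVol_mono:
  fixes K L :: "(complex ^ 'n::finite) set"
  assumes "K \<in> sets borel" "L \<in> sets borel" "K \<subseteq> L" "L \<subseteq> cball 0 R" "R < 1"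
  shows "HVol K \<le> HVol L"
proof -
  have "enn2real (\<integral>\<^sup>+x\<in>K. ennreal (1 / (1 - (norm x)\<^sup>2) ^ (CARD('n) + 1)) \<partial>lborel) \<le>
     enn2real (\<integral>\<^sup>+x\<in>L. ennreal (1 / (1 - (norm x)\<^sup>2) ^ (CARD('n) + 1)) \<partial>lborel)"
    using nn_integral_weight_finite[OF subspace_UNIV assms(4,5), where p = "CARD('n) + 1"] assms(3)
    by (intro enn2real_mono nn_integral_mono) (auto split: split_indicator simp: lborel_subspace_UNIV)
  then show ?thesis using assms by (subst (1 2) HVol_nn) auto
qed

lemma HVol_section_mono:
  fixes K L :: "(complex ^ 'n::finite) set"
  assumes "K \<in> sets borel" "L \<in> sets borel" "K \<inter> complex_hyperplane \<xi> \<subseteq> L"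
     "L \<subseteq> cball 0 R" "R < 1" "K \<subseteq> ball 0 1"
  shows "HVol_section K \<xi> \<le> HVol_section L \<xi>"
proof -
  let ?H = "complex_hyperplane \<xi>"
  have "enn2real (\<integral>\<^sup>+x\<in>K. ennreal (1 / (1 - (norm x)\<^sup>2) ^ CARD('n)) \<partial>lborel_subspace ?H) \<le>
     enn2real (\<integral>\<^sup>+x\<in>L. ennreal (1 / (1 - (norm x)\<^sup>2) ^ CARD('n)) \<partial>lborel_subspace ?H)"
    using nn_integral_weight_finite[OF subspace_complex_hyperplane assms(4,5), where p = "CARD('n)"] 
  proof (intro enn2real_mono nn_integral_mono_AE)
    show "AE x in lborel_subspace ?H. ennreal (1 / (1 - (norm x)\<^sup>2) ^ CARD('n)) * indicator K x
         \<le> ennreal (1 / (1 - (norm x)\<^sup>2) ^ CARD('n)) * indicator L x"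
      using AE_lborel_subspace[OF subspace_complex_hyperplane]
      by eventually_elim (use assms(3) in \<open>auto split: split_indicator\<close>)
  qed simp
  moreover have "L \<subseteq> ball 0 1" using assms(4,5) by auto
  ultimately show ?thesis using assms by (subst (1 2) HVol_section_nn) auto
qed

lemma compact_subset_ball:
  fixes K :: "'a::euclidean_space set"
  assumes "compact K" "K \<subseteq> ball 0 1"
  obtains R where "0 \<le> R" "R < 1" "K \<subseteq> cball 0 R"
proof (cases "K = {}")
  case False
  obtain x where x: "x \<in> K" "\<And>y. y \<in> K \<Longrightarrow> norm y \<le> norm x"
    using continuous_attains_sup[OF assms(1) False, of norm] by (auto intro: continuous_intros)
  then show ?thesis using that[of "norm x"] assms(2) by (auto simp: subset_iff)
qed (use that[of 0] in auto)

lemma ex_hyperplane_through: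
  fixes x :: "complex ^ 'n::finite"
  assumes N: "CARD('n) \<ge> 2" and x: "x \<noteq> 0"
  obtains \<xi> where "norm \<xi> = 1" "x \<in> complex_hyperplane \<xi>"
proof -
  have "dim (complex_hyperplane x) > 0" using dim_complex_hyperplane[OF x] N by simp
  then obtain y where y: "y \<in> complex_hyperplane x" "y \<noteq> 0"
    by (metis dim_eq_0 less_irrefl subsetI insertI1 singletonI)
  have "cdot x y = 0" using y(1) by (subst cdot_commute) (simp add: complex_hyperplane_cdot)
  then have "x \<in> complex_hyperplane ((1 / norm y) *\<^sub>R y)"
    by (simp add: complex_hyperplane_cdot scaleR_eq_smult cdot_smult_right)
  then show ?thesis using that[of "(1 / norm y) *\<^sub>R y"] y by simp
qed

text \<open>
  A point \<open>x\<close> of \<open>K - L\<close> lies on a hyperplane, which is the complex line of \<open>x\<close>. There \<open>K\<close> contains the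
  disc of radius \<open>|x|\<close>, and \<open>L\<close> is contained in a strictly smaller disc, contrary to the comparison of
  sections. So \<open>K \<subseteq> L\<close>.
\<close>

lemma Busemann_Petty_complex_dimension_two:
  fixes K L :: "(complex ^ 'n::finite) set"
  assumes N: "CARD('n) = 2"
    and K: "convex_body K" "rotation_invariant K" "K \<subseteq> ball 0 1"
    and L: "convex_body L" "rotation_invariant L" "L \<subseteq> ball 0 1"
    and le: "\<And>\<xi>. \<xi> \<in> sphere 0 1 \<Longrightarrow> HVol_section K \<xi> \<le> HVol_section L \<xi>"
  shows "HVol K \<le> HVol L"
proof -
  obtain RK where RK: "0 \<le> RK" "RK < 1" "K \<subseteq> cball 0 RK"
    using compact_subset_ball[OF convex_body_compact[OF K(1)] K(3)] .
  obtain RL where RL: "0 \<le> RL" "RL < 1" "L \<subseteq> cball 0 RL"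
    using compact_subset_ball[OF convex_body_compact[OF L(1)] L(3)] .
  have "K \<subseteq> L"
  proof (rule ccontr)
    assume "\<not> K \<subseteq> L"
    then obtain x where x: "x \<in> K" "x \<notin> L" by auto
    have x0: "x \<noteq> 0" using x convex_body_0[OF L(1)] by auto
    obtain \<xi> where \<xi>: "norm \<xi> = 1" "x \<in> complex_hyperplane \<xi>"
      using ex_hyperplane_through[OF _ x0] N by auto
    have \<xi>0: "\<xi> \<noteq> 0" using \<xi> by auto
    let ?H = "complex_hyperplane \<xi>"
    define \<eta> where "\<eta> = (1 / norm x) *\<^sub>R x"
    have \<eta>: "norm \<eta> = 1" "\<eta> \<in> ?H"
      using x0 subspace_scale[OF subspace_complex_hyperplane \<xi>(2)] by (auto simp: \<eta>_def)
    have sub: "complex_line_basis \<eta> \<subseteq> ?H"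
      using \<eta> smult_complex_hyperplane by (auto simp: complex_line_basis_def)
    have sp: "span (complex_line_basis \<eta>) = ?H"
    proof (rule subspace_dim_equal)
      show "span (complex_line_basis \<eta>) \<subseteq> ?H" by (rule span_minimal[OF sub subspace_complex_hyperplane])
      show "dim (span (complex_line_basis \<eta>)) \<ge> dim ?H"
        using dim_complex_hyperplane[OF \<xi>0] N orthonormal_set_card[OF orthonormal_complex_line_basis(1)[OF \<eta>(1)]]
          orthonormal_complex_line_basis(2)[OF \<eta>(1)] by simp
    qed (auto simp: subspace_complex_hyperplane)
    have line: "\<exists>c. y = c *s x" if "y \<in> ?H" for y
    proof -
      have "y = cdot y \<eta> *s \<eta>" using span_line_cdot[OF \<eta>(1)] sp that by blast
      then show ?thesis by (metis \<eta>_def scaleR_eq_smult vector_smult_assoc)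
    qed
    define m where "m = minkowski_functional L x"
    have m: "m > 1" using x(2) minkowski_functional_le_1[OF L(1), of x] by (simp add: m_def)
    define \<rho> where "\<rho> = norm x / m"
    have \<rho>: "0 \<le> \<rho>" "\<rho> < norm x" using m x0 by (auto simp: \<rho>_def field_simps)
    have x1: "norm x < 1" using x(1) K(3) by auto
    have 1: "cball 0 (norm x) \<inter> ?H \<subseteq> K"
    proof
      fix y assume y: "y \<in> cball 0 (norm x) \<inter> ?H"
      then obtain c where c: "y = c *s x" using line by blast
      have "cmod c \<le> 1" using y x0 by (simp add: c norm_smult_vec)
      show "y \<in> K"
      proof (cases "c = 0")
        case False
        have "minkowski_functional K x \<le> 1" using x(1) minkowski_functional_le_1[OF K(1)] by blast
        then have "cmod c * minkowski_functional K x \<le> 1"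
          using \<open>cmod c \<le> 1\<close> minkowski_functional_nonneg[OF K(1), of x] by (simp add: mult_le_one)
        then show ?thesis
          using minkowski_functional_smult[OF K(1,2) False, of x] minkowski_functional_le_1[OF K(1), of y] c by simp
      qed (use c convex_body_0[OF K(1)] in simp)
    qed
    have 2: "L \<inter> ?H \<subseteq> cball 0 \<rho>"
    proof
      fix y assume y: "y \<in> L \<inter> ?H"
      then obtain c where c: "y = c *s x" using line by blast
      show "y \<in> cball 0 \<rho>"
      proof (cases "c = 0")
        case False
        have "minkowski_functional L y \<le> 1" using y minkowski_functional_le_1[OF L(1)] by blast
        then have "cmod c * m \<le> 1" using minkowski_functional_smult[OF L(1,2) False, of x] by (simp add: c m_def)
        then have "cmod c \<le> 1 / m" using m by (simp add: field_simps)
        then have "cmod c * norm x \<le> 1 / m * norm x" by (intro mult_right_mono) auto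
        then show ?thesis by (simp add: c norm_smult_vec \<rho>_def)
      qed (use c \<rho> in simp)
    qed
    have "HVol_section (cball 0 (norm x)) \<xi> \<le> HVol_section K \<xi>"
      by (rule HVol_section_mono[OF _ convex_body_borel[OF K(1)] 1 RK(3,2)]) (use x1 in auto)
    also have "\<dots> \<le> HVol_section L \<xi>" using le \<xi>(1) by simp
    also have "\<dots> \<le> HVol_section (cball 0 \<rho>) \<xi>"
      by (rule HVol_section_mono[OF convex_body_borel[OF L(1)] _ 2 order_refl _ L(3)]) (use x1 \<rho> in auto)
    finally have "HVol_section (cball 0 (norm x)) \<xi> \<le> HVol_section (cball 0 \<rho>) \<xi>" .
    then have "(norm x)\<^sup>2 / (1 - (norm x)\<^sup>2) \<le> \<rho>\<^sup>2 / (1 - \<rho>\<^sup>2)"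
      using HVol_section_cball[of "norm x" \<xi>] HVol_section_cball[of \<rho> \<xi>] N \<xi>0 x1 \<rho>
      by (simp del: times_divide_eq_right)
    moreover have "\<rho>\<^sup>2 / (1 - \<rho>\<^sup>2) < (norm x)\<^sup>2 / (1 - (norm x)\<^sup>2)"
    proof -
      have "\<rho>\<^sup>2 < (norm x)\<^sup>2" using \<rho> by (intro power_strict_mono) auto
      moreover have "(norm x)\<^sup>2 < 1" using x1 by (simp add: power_less_one_iff)
      ultimately show ?thesis by (simp add: field_simps)
    qed
    ultimately show False by simp
  qed
  then show ?thesis
    by (rule HVol_mono[OF convex_body_borel[OF K(1)] convex_body_borel[OF L(1)] _ RL(3,2)])
qed

section \<open>Autocorrelations on complex lines\<close>

lemma nn_integral_inverse_square:
  fixes b :: real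
  assumes b: "b > 0"
  shows "(\<integral>\<^sup>+v. ennreal (1 / (1 + b * v)\<^sup>2) * indicator {0..} v \<partial>lborel) = ennreal (1 / b)"
proof -
  have "(\<integral>\<^sup>+v. ennreal (1 / (1 + b * v)\<^sup>2) * indicator {0..} v \<partial>lborel) =
      ennreal (0 - (- (1 / b) * inverse (1 + b * 0)))"
  proof (rule nn_integral_FTC_atLeast)
    fix v :: real assume v: "0 \<le> v"
    have p: "1 + b * v > 0" using v b by (intro add_pos_nonneg) auto
    have "((\<lambda>v. - (1 / b) * inverse (1 + b * v)) has_real_derivative
        - (1 / b) * (- (inverse (1 + b * v) * b * inverse (1 + b * v)))) (at v)"
      using p by (auto intro!: derivative_eq_intros)
    moreover have "- (1 / b) * (- (inverse (1 + b * v) * b * inverse (1 + b * v))) = 1 / (1 + b * v)\<^sup>2"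
      using b by (simp add: power2_eq_square divide_inverse)
    ultimately show "((\<lambda>v. - (1 / b) * inverse (1 + b * v)) has_real_derivative 1 / (1 + b * v)\<^sup>2) (at v)"
      by metis
  next
    have "filterlim (\<lambda>v. 1 + b * v) at_top at_top"
      using b by (intro filterlim_tendsto_add_at_top[OF tendsto_const]
        filterlim_tendsto_pos_mult_at_top[OF tendsto_const] filterlim_ident)
    from tendsto_mult[OF tendsto_const tendsto_inverse_0_at_top[OF this], of "- (1 / b)"]
    show "((\<lambda>v. - (1 / b) * inverse (1 + b * v)) \<longlongrightarrow> 0) at_top" by simp
  qed auto
  then show ?thesis by simp
qed

text \<open>
  In the variable \<open>v = |x|\<^sup>2\<close> the density \<open>v ^ (k - 1)\<close> is absorbed by \<open>k - 1\<close> of the factors \<open>1 + b v\<close>, which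
  leaves the integrable function \<open>(1 + b v) ^ -2\<close>.
\<close>

lemma nn_integral_decay_finite:
  fixes b :: real
  assumes D: "DIM('a::euclidean_space) = 2 * k" "k \<ge> 1" and b: "b > 0"
  shows "(\<integral>\<^sup>+x. ennreal (1 / (1 + b * (norm (x::'a))\<^sup>2) ^ (k + 1)) \<partial>lborel) < \<infinity>"
proof -
  let ?c = "pi ^ k / fact (k - 1) / b ^ (k - 1)"
  have "(\<integral>\<^sup>+x. ennreal (1 / (1 + b * (norm (x::'a))\<^sup>2) ^ (k + 1)) \<partial>lborel) =
    (\<integral>\<^sup>+v. ennreal (radial_density k v) * ennreal (1 / (1 + b * v) ^ (k + 1)) \<partial>lborel)"
    using nn_integral_radial_subspace[of "UNIV :: 'a set" k "\<lambda>v. ennreal (1 / (1 + b * v) ^ (k + 1))"] D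
    by (simp add: lborel_subspace_UNIV dim_UNIV)
  also have "\<dots> \<le> (\<integral>\<^sup>+v. ennreal ?c * (ennreal (1 / (1 + b * v)\<^sup>2) * indicator {0..} v) \<partial>lborel)"
  proof (rule nn_integral_mono)
    fix v :: real
    show "ennreal (radial_density k v) * ennreal (1 / (1 + b * v) ^ (k + 1)) \<le>
        ennreal ?c * (ennreal (1 / (1 + b * v)\<^sup>2) * indicator {0..} v)"
    proof (cases "v \<ge> 0")
      case True
      have p: "1 + b * v > 0" using True b by (intro add_pos_nonneg) auto
      have "(b * v) ^ (k - 1) \<le> (1 + b * v) ^ (k - 1)" using True b by (intro power_mono) auto
      then have "v ^ (k - 1) \<le> (1 + b * v) ^ (k - 1) / b ^ (k - 1)"
        using b by (simp add: power_mult_distrib field_simps)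
      then have "pi ^ k / fact (k - 1) * v ^ (k - 1) * (1 / (1 + b * v) ^ (k + 1)) \<le>
        pi ^ k / fact (k - 1) * ((1 + b * v) ^ (k - 1) / b ^ (k - 1)) * (1 / (1 + b * v) ^ (k + 1))"
        using p by (intro mult_right_mono mult_left_mono) auto
      also have "\<dots> = ?c * (1 / (1 + b * v)\<^sup>2)"
      proof -
        have "k + 1 = (k - 1) + 2" using D by simp
        then have "(1 + b * v) ^ (k + 1) = (1 + b * v) ^ (k - 1) * (1 + b * v)\<^sup>2"
          by (metis power_add)
        then show ?thesis using p b by simp
      qed
      finally show ?thesis using True b
        by (simp add: radial_density_def ennreal_mult[symmetric] ennreal_leI del: times_divide_eq_right)
    qed (simp add: radial_density_def)
  qed
  also have "\<dots> = ennreal ?c * ennreal (1 / b)"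
    by (subst nn_integral_cmult) (auto simp: nn_integral_inverse_square[OF b])
  also have "\<dots> < \<infinity>" by (simp add: ennreal_mult_less_top)
  finally show ?thesis .
qed

lemma schwartz_continuous:
  assumes "schwartz_function \<phi>"
  shows "continuous_on UNIV \<phi>"
proof -
  have "iterated_deriv [] \<phi> differentiable (at x)" for x
    using assms unfolding schwartz_function_def by (metis lists.Nil)
  then show ?thesis by (simp add: continuous_at_imp_continuous_on differentiable_imp_continuous_within)
qed

lemma schwartz_borel: "schwartz_function \<phi> \<Longrightarrow> \<phi> \<in> borel_measurable borel"
  by (intro borel_measurable_continuous_onI schwartz_continuous)

lemma schwartz_decay:
  fixes \<phi> :: "'a::euclidean_space \<Rightarrow> complex"
  assumes "schwartz_function \<phi>"
  obtains C where "C > 0" "\<And>x. cmod (\<phi> x) \<le> C / (1 + (norm x)\<^sup>2) ^ p"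
proof -
  have bd: "bounded (range (\<lambda>x. norm x ^ m *\<^sub>R \<phi> x))" for m :: nat
    using assms unfolding schwartz_function_def by (metis lists.Nil iterated_deriv.simps(1))
  obtain a where a: "\<And>x. norm (norm x ^ 0 *\<^sub>R \<phi> x) \<le> a"
    using bd[of 0] by (auto simp: bounded_iff)
  obtain b where b: "\<And>x. norm (norm x ^ (2 * p) *\<^sub>R \<phi> x) \<le> b"
    using bd[of "2 * p"] by (auto simp: bounded_iff)
  define C where "C = 2 ^ p * (\<bar>a\<bar> + \<bar>b\<bar> + 1)"
  show ?thesis
  proof (rule that)
    show "C > 0" by (simp add: C_def add_nonneg_pos)
    fix x :: 'a
    have "(1 + (norm x)\<^sup>2) ^ p \<le> 2 ^ p * (1 + norm x ^ (2 * p))"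
    proof (cases "norm x \<le> 1")
      case True
      then have "(norm x)\<^sup>2 \<le> 1" by (simp add: power_le_one)
      then have "(1 + (norm x)\<^sup>2) ^ p \<le> 2 ^ p" by (intro power_mono) auto
      also have "\<dots> \<le> 2 ^ p * (1 + norm x ^ (2 * p))" by simp
      finally show ?thesis .
    next
      case False
      then have "1 \<le> (norm x)\<^sup>2" by (simp add: one_le_power)
      then have "(1 + (norm x)\<^sup>2) ^ p \<le> (2 * (norm x)\<^sup>2) ^ p" by (intro power_mono) auto
      also have "\<dots> = 2 ^ p * norm x ^ (2 * p)" by (simp add: power_mult_distrib power_mult)
      also have "\<dots> \<le> 2 ^ p * (1 + norm x ^ (2 * p))" by simp
      finally show ?thesis .
    qed
    then have "cmod (\<phi> x) * (1 + (norm x)\<^sup>2) ^ p \<le> cmod (\<phi> x) * (2 ^ p * (1 + norm x ^ (2 * p)))"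
      by (intro mult_left_mono) auto
    also have "\<dots> = 2 ^ p * (norm (norm x ^ 0 *\<^sub>R \<phi> x) + norm (norm x ^ (2 * p) *\<^sub>R \<phi> x))"
      by (simp add: algebra_simps)
    also have "\<dots> \<le> C" unfolding C_def using a[of x] b[of x] by (intro mult_left_mono) auto
    finally show "cmod (\<phi> x) \<le> C / (1 + (norm x)\<^sup>2) ^ p"
      by (simp add: pos_le_divide_eq add_pos_nonneg)
  qed
qed

lemma schwartz_nn_integral_finite:
  fixes \<phi> :: "'a::euclidean_space \<Rightarrow> complex"
  assumes "schwartz_function \<phi>" "DIM('a) = 2 * k" "k \<ge> 1"
  shows "(\<integral>\<^sup>+x. ennreal (cmod (\<phi> x)) \<partial>lborel) < \<infinity>"
proof -
  obtain C where C: "C > 0" "\<And>x. cmod (\<phi> x) \<le> C / (1 + (norm x)\<^sup>2) ^ (k + 1)"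
    using schwartz_decay[OF assms(1)] by metis
  have "(\<integral>\<^sup>+x. ennreal (cmod (\<phi> x)) \<partial>lborel) \<le>
     (\<integral>\<^sup>+x. ennreal C * ennreal (1 / (1 + 1 * (norm (x::'a))\<^sup>2) ^ (k + 1)) \<partial>lborel)"
    using C by (intro nn_integral_mono) (auto simp: ennreal_mult[symmetric] intro!: ennreal_leI)
  also have "\<dots> = ennreal C * (\<integral>\<^sup>+x. ennreal (1 / (1 + 1 * (norm (x::'a))\<^sup>2) ^ (k + 1)) \<partial>lborel)"
    by (rule nn_integral_cmult) auto
  also have "\<dots> < \<infinity>" using nn_integral_decay_finite[OF assms(2,3), of 1] by (simp add: ennreal_mult_less_top)
  finally show ?thesis .
qed

lemma borel_measurable_smult [measurable (raw)]:
  fixes f :: "'b \<Rightarrow> complex" and g :: "'b \<Rightarrow> complex ^ 'n::finite"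
  assumes "f \<in> borel_measurable M" "g \<in> borel_measurable M"
  shows "(\<lambda>x. f x *s g x) \<in> borel_measurable M"
proof (rule borel_measurable_continuous_Pair[OF assms])
  show "continuous_on UNIV (\<lambda>x. fst x *s (snd x :: complex ^ 'n))"
    unfolding vector_scalar_mult_def by (intro continuous_intros)
qed

lemma borel_measurable_cnj [measurable (raw)]:
  "f \<in> borel_measurable M \<Longrightarrow> (\<lambda>x. cnj (f x)) \<in> borel_measurable M"
  by (rule measurable_compose[where g = cnj and N = borel])
     (auto intro!: borel_measurable_continuous_onI continuous_intros)

lemma integrable_pair_lborelI:
  fixes f :: "'a::euclidean_space \<Rightarrow> 'b::euclidean_space \<Rightarrow> complex"
  assumes [measurable]: "case_prod f \<in> borel_measurable (borel \<Otimes>\<^sub>M borel)"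
    and "(\<integral>\<^sup>+x. \<integral>\<^sup>+y. ennreal (cmod (f x y)) \<partial>lborel \<partial>lborel) < \<infinity>"
  shows "integrable (lborel \<Otimes>\<^sub>M lborel) (case_prod f)"
proof (rule integrableI_bounded)
  have "(\<integral>\<^sup>+p. ennreal (norm (case_prod f p)) \<partial>(lborel \<Otimes>\<^sub>M lborel)) =
    (\<integral>\<^sup>+x. \<integral>\<^sup>+y. ennreal (norm (case_prod f (x, y))) \<partial>lborel \<partial>lborel)"
    by (rule lborel.nn_integral_fst[symmetric]) measurable
  then show "(\<integral>\<^sup>+p. ennreal (norm (case_prod f p)) \<partial>(lborel \<Otimes>\<^sub>M lborel)) < \<infinity>" using assms by simp
qed measurable

lemma nn_integral_lborel_translate:
  fixes v :: "'a::euclidean_space"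
  assumes [measurable]: "f \<in> borel_measurable borel"
  shows "(\<integral>\<^sup>+x. f (v + x) \<partial>lborel) = (\<integral>\<^sup>+x. f x \<partial>lborel)"
proof -
  have "(\<integral>\<^sup>+x. f x \<partial>lborel) = (\<integral>\<^sup>+x. f x \<partial>distr lborel borel ((+) v))" by (simp add: lborel_distr_plus)
  also have "\<dots> = (\<integral>\<^sup>+x. f (v + x) \<partial>lborel)" by (rule nn_integral_distr) auto
  finally show ?thesis ..
qed

lemma integral_lborel_translate:
  fixes v :: "'a::euclidean_space" and f :: "'a \<Rightarrow> 'b::{banach, second_countable_topology}"
  assumes [measurable]: "f \<in> borel_measurable borel"
  shows "(LINT x|lborel. f (v + x)) = (LINT x|lborel. f x)"
proof -
  have "(LINT x|lborel. f x) = (LINT x|distr lborel borel ((+) v). f x)" by (simp add: lborel_distr_plus)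
  also have "\<dots> = (LINT x|lborel. f (v + x))" by (rule integral_distr) auto
  finally show ?thesis ..
qed

lemma distr_lborel_uminus: "distr lborel borel uminus = (lborel :: 'a::euclidean_space measure)"
  by (rule distr_lborel_linear_isometry[where S = uminus]) (auto simp: linear_iff)

lemma lborel_smult:
  fixes w :: complex
  assumes w: "w \<noteq> 0"
  shows "(lborel :: (complex ^ 'n::finite) measure) =
    density (distr lborel borel (\<lambda>x. w *s x)) (\<lambda>_. ennreal (cmod w ^ (2 * CARD('n))))"
proof -
  define u where "u = w / of_real (cmod w)"
  have u: "cmod u = 1" "w = of_real (cmod w) * u" using w by (auto simp: u_def norm_divide)
  have un: "u \<noteq> 0" using u by auto
  have iso: "distr lborel borel (\<lambda>x. u *s x) = (lborel :: (complex ^ 'n) measure)"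
  proof (rule distr_lborel_linear_isometry[where S = "\<lambda>x. (1 / u) *s x"])
    show "linear (\<lambda>x::complex ^ 'n. u *s x)"
      by (auto simp: linear_iff vec_eq_iff algebra_simps scaleR_conv_of_real)
  qed (use u un in \<open>auto simp: norm_smult_vec vector_smult_assoc\<close>)
  have "distr lborel borel (\<lambda>x::complex ^ 'n. w *s x) =
     distr (distr lborel borel (\<lambda>x. u *s x)) borel (\<lambda>x. 0 + cmod w *\<^sub>R x)"
    by (subst distr_distr) (auto simp: comp_def scaleR_eq_smult vector_smult_assoc u(2)[symmetric])
  also have "\<dots> = distr lborel borel (\<lambda>x. 0 + cmod w *\<^sub>R x)" by (simp only: iso)
  finally show ?thesis
    using lborel_affine[of "cmod w" "0 :: complex ^ 'n"] w by (simp only: norm_eq_zero abs_norm_cancel DIM_complex_vec not_False_eq_True simp_thms)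
qed

lemma nn_integral_lborel_smult:
  fixes w :: complex and f :: "complex ^ 'n::finite \<Rightarrow> ennreal"
  assumes w: "w \<noteq> 0" and [measurable]: "f \<in> borel_measurable borel"
  shows "(\<integral>\<^sup>+y. f y \<partial>lborel) = ennreal (cmod w ^ (2 * CARD('n))) * (\<integral>\<^sup>+x. f (w *s x) \<partial>lborel)"
  by (subst lborel_smult[OF w]) (simp add: nn_integral_density nn_integral_distr nn_integral_cmult)

lemma integral_lborel_smult:
  fixes w :: complex and f :: "complex ^ 'n::finite \<Rightarrow> complex"
  assumes w: "w \<noteq> 0" and [measurable]: "f \<in> borel_measurable borel"
  shows "(LINT y|lborel. f y) = (cmod w ^ (2 * CARD('n))) *\<^sub>R (LINT x|lborel. f (w *s x))"
  by (subst lborel_smult[OF w]) (simp add: integral_density integral_distr)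

text \<open>
  The component of \<open>y + w x\<close> along the line of \<open>x\<close> bounds its norm from below. Its size depends only on
  the distance of \<open>w\<close> from a point determined by \<open>y\<close>, so line integrals of decaying functions are
  bounded uniformly in \<open>y\<close>.
\<close>

lemma norm_line_lower:
  fixes x y :: "complex ^ 'n::finite"
  assumes x: "x \<noteq> 0"
  shows "(norm x)\<^sup>2 * (cmod (cdot y x / (norm x)\<^sup>2 + w))\<^sup>2 \<le> (norm (y + w *s x))\<^sup>2"
proof -
  define \<eta> where "\<eta> = (1 / norm x) *\<^sub>R x"
  have \<eta>: "norm \<eta> = 1" using x by (simp add: \<eta>_def)
  have nx: "norm x \<noteq> 0" using x by simp
  have "cdot (y + w *s x) \<eta> = of_real (1 / norm x) * (cdot y x + w * (norm x)\<^sup>2)"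
    by (simp add: \<eta>_def scaleR_eq_smult cdot_smult_right cdot_add_left cdot_smult_left cdot_self)
  also have "\<dots> = of_real (norm x) * (cdot y x / (norm x)\<^sup>2 + w)"
    using nx by (simp add: field_simps power2_eq_square)
  finally have "cmod (cdot (y + w *s x) \<eta>) = norm x * cmod (cdot y x / (norm x)\<^sup>2 + w)"
    by (simp add: norm_mult)
  then show ?thesis using cmod_cdot_le[OF \<eta>, of "y + w *s x"] by (simp add: power_mult_distrib)
qed

lemma schwartz_line_bound:
  fixes x :: "complex ^ 'n::finite"
  assumes \<phi>: "schwartz_function \<phi>" and x: "x \<noteq> 0"
  obtains D where "D \<ge> 0" "\<And>y. (\<integral>\<^sup>+w. ennreal (cmod (\<phi> (y + w *s x))) \<partial>lborel) \<le> ennreal D"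
proof -
  obtain C where C: "C > 0" "\<And>z. cmod (\<phi> z) \<le> C / (1 + (norm z)\<^sup>2) ^ 2"
    using schwartz_decay[OF \<phi>] by metis
  let ?b = "(norm x)\<^sup>2"
  let ?I = "\<integral>\<^sup>+w. ennreal (1 / (1 + ?b * (norm (w::complex))\<^sup>2) ^ (1 + 1)) \<partial>lborel"
  have I: "?I < \<infinity>" by (rule nn_integral_decay_finite) (use x in auto)
  show ?thesis
  proof (rule that[of "C * enn2real ?I"])
    fix y
    let ?c = "cdot y x / (norm x)\<^sup>2"
    have "(\<integral>\<^sup>+w. ennreal (cmod (\<phi> (y + w *s x))) \<partial>lborel) \<le>
      (\<integral>\<^sup>+w. ennreal C * ennreal (1 / (1 + ?b * (norm (?c + w))\<^sup>2) ^ (1 + 1)) \<partial>lborel)"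
    proof (rule nn_integral_mono)
      fix w
      have "cmod (\<phi> (y + w *s x)) \<le> C / (1 + (norm (y + w *s x))\<^sup>2) ^ 2" by (rule C)
      also have "\<dots> \<le> C / (1 + ?b * (norm (?c + w))\<^sup>2) ^ 2"
        using norm_line_lower[OF x, of y w] C(1)
        by (intro divide_left_mono power_mono mult_pos_pos zero_less_power add_pos_nonneg) auto
      finally show "ennreal (cmod (\<phi> (y + w *s x))) \<le>
         ennreal C * ennreal (1 / (1 + ?b * (norm (?c + w))\<^sup>2) ^ (1 + 1))"
        using C(1) by (auto simp: ennreal_mult[symmetric] numeral_2_eq_2 intro!: ennreal_leI)
    qed
    also have "\<dots> = ennreal C * (\<integral>\<^sup>+w. ennreal (1 / (1 + ?b * (norm (?c + w))\<^sup>2) ^ (1 + 1)) \<partial>lborel)"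
      by (rule nn_integral_cmult) auto
    also have "(\<integral>\<^sup>+w. ennreal (1 / (1 + ?b * (norm (?c + w))\<^sup>2) ^ (1 + 1)) \<partial>lborel) = ?I"
      by (rule nn_integral_lborel_translate) auto
    also have "ennreal C * ?I = ennreal (C * enn2real ?I)"
      using I C(1) by (simp add: ennreal_mult)
    finally show "(\<integral>\<^sup>+w. ennreal (cmod (\<phi> (y + w *s x))) \<partial>lborel) \<le> ennreal (C * enn2real ?I)" .
  qed (use C in auto)
qed

text \<open>
  Let \<open>A y\<close> be the integral of \<open>\<phi>\<close> over the complex line through \<open>y\<close> in the direction \<open>x\<close>. Fubini turns the
  left-hand side into \<open>\<integral> \<phi> y * cnj (A y)\<close>. As \<open>A\<close> is constant along each such line, averaging over these lines
  with a positive weight \<open>\<rho>\<close> whose line integrals all equal \<open>\<kappa>\<close> replaces \<open>\<kappa> * \<phi> y\<close> by \<open>\<rho> y * A y\<close>, and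
  \<open>\<integral> \<rho> * |A|\<^sup>2\<close> is nonnegative.
\<close>

lemma autocorrelation_line_integral_nonneg:
  fixes \<phi> :: "complex ^ 'n::finite \<Rightarrow> complex"
  assumes \<phi>: "schwartz_function \<phi>" and x: "x \<noteq> 0"
  shows "(LINT w|lborel. convolution \<phi> (\<lambda>z. cnj (\<phi> (- z))) (w *s x)) \<in> \<real>\<^sub>\<ge>\<^sub>0"
proof -
  note [measurable] = schwartz_borel[OF \<phi>]
  obtain D where D: "D \<ge> 0" "\<And>y. (\<integral>\<^sup>+w. ennreal (cmod (\<phi> (y + w *s x))) \<partial>lborel) \<le> ennreal D"
    using schwartz_line_bound[OF \<phi> x] by metis
  have N: "CARD('n) \<ge> 1" by (simp add: Suc_le_eq)
  have phi_fin: "(\<integral>\<^sup>+y. ennreal (cmod (\<phi> y)) \<partial>lborel) < \<infinity>"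
    by (rule schwartz_nn_integral_finite[OF \<phi> _ N]) simp
  have uminus_nn: "(\<integral>\<^sup>+w. f (- w) \<partial>lborel) = (\<integral>\<^sup>+w. f w \<partial>lborel)"
    if [measurable]: "f \<in> borel_measurable borel" for f :: "complex \<Rightarrow> ennreal"
  proof -
    have "(\<integral>\<^sup>+w. f w \<partial>lborel) = (\<integral>\<^sup>+w. f w \<partial>distr lborel borel uminus)" by (simp add: distr_lborel_uminus)
    also have "\<dots> = (\<integral>\<^sup>+w. f (- w) \<partial>lborel)" by (rule nn_integral_distr) auto
    finally show ?thesis ..
  qed
  have uminus_int: "(LINT w|lborel. f (- w)) = (LINT w|lborel. f w)"
    if [measurable]: "f \<in> borel_measurable borel" for f :: "complex \<Rightarrow> complex"
  proof -
    have "(LINT w|lborel. f w) = (LINT w|distr lborel borel uminus. f w)" by (simp add: distr_lborel_uminus)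
    also have "\<dots> = (LINT w|lborel. f (- w))" by (rule integral_distr) auto
    finally show ?thesis ..
  qed
  define A where "A y = (LINT w|lborel. \<phi> (y + w *s x))" for y
  have A_meas[measurable]: "A \<in> borel_measurable borel"
    unfolding A_def by measurable
  have A_bound: "cmod (A y) \<le> D" for y
  proof -
    have "ennreal (cmod (A y)) \<le> (\<integral>\<^sup>+w. ennreal (cmod (\<phi> (y + w *s x))) \<partial>lborel)"
      unfolding A_def
    proof (rule integral_norm_bound_ennreal)
      show "integrable lborel (\<lambda>w. \<phi> (y + w *s x))"
        by (rule integrableI_bounded) (use D(2)[of y] in \<open>auto simp: less_top[symmetric] top_unique\<close>)
    qed
    also have "\<dots> \<le> ennreal D" by (rule D)
    finally show ?thesis using D(1) by (simp add: ennreal_le_iff)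
  qed
  have A_shift: "A (y + v *s x) = A y" for y v
  proof -
    have "A (y + v *s x) = (LINT w|lborel. \<phi> (y + (v + w) *s x))"
      unfolding A_def by (simp add: vector_sadd_rdistrib add.assoc)
    also have "\<dots> = A y" unfolding A_def
      by (rule integral_lborel_translate[where f = "\<lambda>w. \<phi> (y + w *s x)"]) measurable
    finally show ?thesis .
  qed
  have A_minus: "A y = (LINT w|lborel. \<phi> (y - w *s x))" for y
  proof -
    have "(LINT w|lborel. \<phi> (y + (- w) *s x)) = A y" unfolding A_def
      by (rule uminus_int[where f = "\<lambda>w. \<phi> (y + w *s x)"]) measurable
    moreover have "y + (- w) *s x = y - w *s x" for w by (simp add: vec_eq_iff)
    ultimately show ?thesis by simp
  qed
  have D_minus: "(\<integral>\<^sup>+w. ennreal (cmod (\<phi> (y - w *s x))) \<partial>lborel) \<le> ennreal D" for y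
  proof -
    have "(\<integral>\<^sup>+w. ennreal (cmod (\<phi> (y + (- w) *s x))) \<partial>lborel) = (\<integral>\<^sup>+w. ennreal (cmod (\<phi> (y + w *s x))) \<partial>lborel)"
      by (rule uminus_nn[where f = "\<lambda>w. ennreal (cmod (\<phi> (y + w *s x)))"]) measurable
    moreover have "y + (- w) *s x = y - w *s x" for w by (simp add: vec_eq_iff)
    ultimately show ?thesis using D(2)[of y] by simp
  qed
  define B where "B = (LINT y|lborel. \<phi> y * cnj (A y))"
  have eq1: "(LINT w|lborel. convolution \<phi> (\<lambda>z. cnj (\<phi> (- z))) (w *s x)) = B"
  proof -
    have int: "integrable (lborel \<Otimes>\<^sub>M lborel) (\<lambda>(y, w). \<phi> y * cnj (\<phi> (y - w *s x)))"
    proof (rule integrable_pair_lborelI)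
      have "(\<integral>\<^sup>+y. \<integral>\<^sup>+w. ennreal (cmod (\<phi> y * cnj (\<phi> (y - w *s x)))) \<partial>lborel \<partial>lborel) =
        (\<integral>\<^sup>+y. ennreal (cmod (\<phi> y)) * (\<integral>\<^sup>+w. ennreal (cmod (\<phi> (y - w *s x))) \<partial>lborel) \<partial>lborel)"
        by (intro nn_integral_cong) (simp add: norm_mult ennreal_mult nn_integral_cmult)
      also have "\<dots> \<le> (\<integral>\<^sup>+y. ennreal (cmod (\<phi> y)) * ennreal D \<partial>lborel)"
        by (intro nn_integral_mono mult_left_mono D_minus) simp
      also have "\<dots> = (\<integral>\<^sup>+y. ennreal (cmod (\<phi> y)) \<partial>lborel) * ennreal D"
        by (rule nn_integral_multc) measurable
      also have "\<dots> < \<infinity>" using phi_fin by (simp add: ennreal_mult_less_top)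
      finally show "(\<integral>\<^sup>+y. \<integral>\<^sup>+w. ennreal (cmod (\<phi> y * cnj (\<phi> (y - w *s x)))) \<partial>lborel \<partial>lborel) < \<infinity>" .
    qed measurable
    have "(LINT w|lborel. convolution \<phi> (\<lambda>z. cnj (\<phi> (- z))) (w *s x)) =
       (LINT w|lborel. LINT y|lborel. \<phi> y * cnj (\<phi> (y - w *s x)))"
      by (simp add: convolution_def)
    also have "\<dots> = (LINT y|lborel. LINT w|lborel. \<phi> y * cnj (\<phi> (y - w *s x)))"
      by (rule lborel_pair.Fubini_integral[OF int])
    also have "\<dots> = B"
      unfolding B_def by (intro Bochner_Integration.integral_cong refl) (simp add: A_minus)
    finally show ?thesis .
  qed
  \<comment> \<open>A function of \<open>\<langle>y, x\<rangle>\<close> alone, so that its integral is the same on all lines of direction \<open>x\<close>.\<close>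
  define \<rho> where "\<rho> y = 1 / (1 + (cmod (cdot y x))\<^sup>2)\<^sup>2" for y :: "complex ^ 'n"
  have \<rho>_meas[measurable]: "\<rho> \<in> borel_measurable borel" unfolding \<rho>_def by measurable
  have \<rho>_nonneg: "\<rho> y \<ge> 0" for y by (simp add: \<rho>_def)
  define h where "h w = 1 / (1 + ((norm x)\<^sup>2)\<^sup>2 * (cmod w)\<^sup>2)\<^sup>2" for w :: complex
  have [measurable]: "h \<in> borel_measurable borel" unfolding h_def by measurable
  have h_fin: "(\<integral>\<^sup>+w. ennreal (h w) \<partial>lborel) < \<infinity>"
  proof -
    have "(\<integral>\<^sup>+w. ennreal (1 / (1 + ((norm x)\<^sup>2)\<^sup>2 * (norm (w::complex))\<^sup>2) ^ (1 + 1)) \<partial>lborel) < \<infinity>"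
      by (rule nn_integral_decay_finite) (use x in auto)
    then show ?thesis by (simp add: h_def numeral_2_eq_2)
  qed
  have h_int: "integrable lborel h"
    using h_fin by (intro integrableI_bounded) (auto simp: h_def)
  define \<kappa> where "\<kappa> = (LINT w|lborel. h w)"
  have \<rho>h: "\<rho> (y + w *s x) = h (cdot y x / (norm x)\<^sup>2 + w)" for y w
  proof -
    have nx: "norm x \<noteq> 0" using x by simp
    have "cdot (y + w *s x) x = of_real ((norm x)\<^sup>2) * (cdot y x / (norm x)\<^sup>2 + w)"
      using nx by (simp add: cdot_add_left cdot_smult_left cdot_self field_simps)
    then have "cmod (cdot (y + w *s x) x) = (norm x)\<^sup>2 * cmod (cdot y x / (norm x)\<^sup>2 + w)"
      by (simp add: norm_mult norm_power)
    then show ?thesis by (simp add: \<rho>_def h_def power_mult_distrib)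
  qed
  have \<rho>_line: "(LINT w|lborel. \<rho> (y + w *s x)) = \<kappa>" for y
    unfolding \<rho>h \<kappa>_def by (rule integral_lborel_translate) measurable
  have \<rho>_line_nn: "(\<integral>\<^sup>+w. ennreal (\<rho> (y + w *s x)) \<partial>lborel) = (\<integral>\<^sup>+w. ennreal (h w) \<partial>lborel)" for y
    unfolding \<rho>h by (rule nn_integral_lborel_translate[where f = "\<lambda>w. ennreal (h w)"]) measurable
  have \<kappa>: "\<kappa> > 0"
  proof -
    have "\<kappa> \<ge> 0" unfolding \<kappa>_def by (rule integral_nonneg_AE) (auto simp: h_def)
    moreover have "\<kappa> \<noteq> 0"
    proof
      assume "\<kappa> = 0"
      then have "AE w in lborel. h w = 0"
        unfolding \<kappa>_def using integral_nonneg_eq_0_iff_AE[OF h_int] by (auto simp: h_def)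
      moreover have "h w \<noteq> 0" for w
      proof -
        have "0 < 1 + ((norm x)\<^sup>2)\<^sup>2 * (cmod w)\<^sup>2" by (intro add_pos_nonneg) auto
        then show ?thesis by (simp add: h_def)
      qed
      ultimately have "AE w in (lborel :: complex measure). False" by simp
      then show False by (simp add: eventually_False ae_filter_eq_bot_iff)
    qed
    ultimately show ?thesis by simp
  qed
  \<comment> \<open>The translation \<open>y \<mapsto> y - w x\<close> carries the first integrand to the second, because \<open>A\<close> is constant along the line.\<close>
  let ?F = "\<lambda>y w. complex_of_real (\<rho> (y + w *s x)) * (\<phi> y * cnj (A y))"
  let ?G = "\<lambda>y w. complex_of_real (\<rho> y) * (\<phi> (y - w *s x) * cnj (A y))"
  have F_fin: "(\<integral>\<^sup>+y. \<integral>\<^sup>+w. ennreal (cmod (?F y w)) \<partial>lborel \<partial>lborel) < \<infinity>"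
  proof -
    have "(\<integral>\<^sup>+y. \<integral>\<^sup>+w. ennreal (cmod (?F y w)) \<partial>lborel \<partial>lborel) =
       (\<integral>\<^sup>+y. (\<integral>\<^sup>+w. ennreal (\<rho> (y + w *s x)) * ennreal (cmod (\<phi> y) * cmod (A y)) \<partial>lborel) \<partial>lborel)"
      using \<rho>_nonneg by (intro nn_integral_cong) (simp add: norm_mult ennreal_mult)
    also have "\<dots> = (\<integral>\<^sup>+y. (\<integral>\<^sup>+w. ennreal (h w) \<partial>lborel) * ennreal (cmod (\<phi> y) * cmod (A y)) \<partial>lborel)"
      by (intro nn_integral_cong, subst nn_integral_multc) (auto simp: \<rho>_line_nn)
    also have "\<dots> \<le> (\<integral>\<^sup>+y. (\<integral>\<^sup>+w. ennreal (h w) \<partial>lborel) * (ennreal (cmod (\<phi> y)) * ennreal D) \<partial>lborel)"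
      using A_bound D(1)
      by (intro nn_integral_mono mult_left_mono) (auto simp: ennreal_mult[symmetric] intro!: ennreal_leI mult_left_mono)
    also have "\<dots> = (\<integral>\<^sup>+w. ennreal (h w) \<partial>lborel) * ((\<integral>\<^sup>+y. ennreal (cmod (\<phi> y)) \<partial>lborel) * ennreal D)"
      by (simp add: nn_integral_cmult nn_integral_multc)
    also have "\<dots> < \<infinity>" using h_fin phi_fin by (simp add: ennreal_mult_less_top)
    finally show ?thesis .
  qed
  have F_int: "integrable (lborel \<Otimes>\<^sub>M lborel) (\<lambda>(y, w). ?F y w)"
    by (rule integrable_pair_lborelI[OF _ F_fin]) measurable
  have shift: "?F (- (w *s x) + y) w = ?G y w" for y w
    using A_shift[of y "- w"] by (simp add: vector_smult_lneg algebra_simps)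
  have G_int: "integrable (lborel \<Otimes>\<^sub>M lborel) (\<lambda>(w, y). ?G y w)"
  proof (rule integrable_pair_lborelI)
    have "(\<integral>\<^sup>+w. \<integral>\<^sup>+y. ennreal (cmod (?G y w)) \<partial>lborel \<partial>lborel) =
       (\<integral>\<^sup>+w. \<integral>\<^sup>+y. ennreal (cmod (?F y w)) \<partial>lborel \<partial>lborel)"
    proof (rule nn_integral_cong)
      fix w
      have "(\<integral>\<^sup>+y. ennreal (cmod (?F (- (w *s x) + y) w)) \<partial>lborel) = (\<integral>\<^sup>+y. ennreal (cmod (?F y w)) \<partial>lborel)"
        by (rule nn_integral_lborel_translate[where f = "\<lambda>y. ennreal (cmod (?F y w))"]) measurable
      then show "(\<integral>\<^sup>+y. ennreal (cmod (?G y w)) \<partial>lborel) = (\<integral>\<^sup>+y. ennreal (cmod (?F y w)) \<partial>lborel)"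
        by (simp only: shift)
    qed
    also have "\<dots> = (\<integral>\<^sup>+y. \<integral>\<^sup>+w. ennreal (cmod (?F y w)) \<partial>lborel \<partial>lborel)"
      by (rule lborel_pair.Fubini') measurable
    also note F_fin
    finally show "(\<integral>\<^sup>+w. \<integral>\<^sup>+y. ennreal (cmod (?G y w)) \<partial>lborel \<partial>lborel) < \<infinity>" .
  qed measurable
  have "of_real \<kappa> * B = (LINT y|lborel. of_real \<kappa> * (\<phi> y * cnj (A y)))"
    by (simp add: B_def)
  also have "\<dots> = (LINT y|lborel. LINT w|lborel. ?F y w)"
    by (intro Bochner_Integration.integral_cong refl) (simp add: \<rho>_line)
  also have "\<dots> = (LINT w|lborel. LINT y|lborel. ?F y w)"
    by (rule lborel_pair.Fubini_integral[OF F_int, symmetric])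
  also have "\<dots> = (LINT w|lborel. LINT y|lborel. ?G y w)"
  proof (rule Bochner_Integration.integral_cong[OF refl])
    fix w
    have "(LINT y|lborel. ?F (- (w *s x) + y) w) = (LINT y|lborel. ?F y w)"
      by (rule integral_lborel_translate[where f = "\<lambda>y. ?F y w"]) measurable
    then show "(LINT y|lborel. ?F y w) = (LINT y|lborel. ?G y w)" by (simp only: shift)
  qed
  also have "\<dots> = (LINT y|lborel. LINT w|lborel. ?G y w)"
    by (rule lborel_pair.Fubini_integral[OF G_int, symmetric])
  also have "\<dots> = (LINT y|lborel. complex_of_real (\<rho> y * (cmod (A y))\<^sup>2))"
  proof (rule Bochner_Integration.integral_cong[OF refl])
    fix y
    have "(LINT w|lborel. ?G y w) = of_real (\<rho> y) * (A y * cnj (A y))"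
      by (simp add: A_minus)
    then show "(LINT w|lborel. ?G y w) = complex_of_real (\<rho> y * (cmod (A y))\<^sup>2)"
      by (simp add: complex_norm_square[symmetric])
  qed
  also have "\<dots> = of_real (LINT y|lborel. \<rho> y * (cmod (A y))\<^sup>2)"
    by (rule integral_complex_of_real)
  finally have "of_real \<kappa> * B = of_real (LINT y|lborel. \<rho> y * (cmod (A y))\<^sup>2)" .
  then have "B = of_real ((LINT y|lborel. \<rho> y * (cmod (A y))\<^sup>2) / \<kappa>)"
    using \<kappa> by (simp add: field_simps)
  moreover have "(LINT y|lborel. \<rho> y * (cmod (A y))\<^sup>2) \<ge> 0"
    using \<rho>_nonneg by (intro integral_nonneg_AE AE_I2) auto
  ultimately show ?thesis using \<kappa> eq1 by (simp add: nonneg_Reals_of_real_iff)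
qed

section \<open>Positive definiteness in complex dimension two\<close>

lemma borel_measurable_convolution:
  fixes \<phi> :: "'a::euclidean_space \<Rightarrow> complex"
  assumes [measurable]: "\<phi> \<in> borel_measurable borel" "g \<in> borel_measurable borel"
  shows "convolution \<phi> g \<in> borel_measurable borel"
  unfolding convolution_def by measurable

text \<open>
  In the variable \<open>v = |w|\<^sup>2\<close> the integral is \<open>\<pi> \<integral> dv / v\<close> over an interval whose endpoints have the ratio
  \<open>exp 2\<close>. So the value does not depend on \<open>a\<close>.
\<close>

lemma nn_integral_shell_weight:
  assumes a: "a > 0"
  shows "(\<integral>\<^sup>+w. ennreal (inverse ((cmod w)\<^sup>2)) * indicator {a\<^sup>2 / (exp 1)\<^sup>2..a\<^sup>2} ((cmod w)\<^sup>2) \<partial>lborel) = ennreal (2 * pi)"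
proof -
  let ?l = "a\<^sup>2 / (exp 1)\<^sup>2"
  have l: "?l > 0" "?l \<le> a\<^sup>2" using a by (auto simp: divide_le_eq one_le_power)
  have "(\<integral>\<^sup>+w. ennreal (inverse ((cmod w)\<^sup>2)) * indicator {?l..a\<^sup>2} ((cmod w)\<^sup>2) \<partial>lborel) =
    (\<integral>\<^sup>+v. ennreal (radial_density 1 v) * (ennreal (inverse v) * indicator {?l..a\<^sup>2} v) \<partial>lborel)"
    using nn_integral_radial_subspace[of "UNIV :: complex set" 1 "\<lambda>v. ennreal (inverse v) * indicator {?l..a\<^sup>2} v"]
    by (simp add: lborel_subspace_UNIV dim_UNIV)
  also have "\<dots> = (\<integral>\<^sup>+v. ennreal (pi / v) * indicator {?l..a\<^sup>2} v \<partial>lborel)"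
    using l(1) by (intro nn_integral_cong)
      (auto simp: radial_density_def divide_inverse ennreal_mult[symmetric] split: split_indicator)
  also have "\<dots> = ennreal (pi * ln (a\<^sup>2) - pi * ln ?l)"
    by (rule nn_integral_FTC_Icc) (use l in \<open>auto intro!: derivative_eq_intros\<close>)
  also have "pi * ln (a\<^sup>2) - pi * ln ?l = 2 * pi"
    using a by (simp add: ln_div ln_realpow algebra_simps)
  finally show ?thesis .
qed

text \<open>
  For each \<open>y \<noteq> 0\<close> the scalars \<open>w\<close> for which \<open>y / w\<close> lies in the shell \<open>1 \<le> |x| \<le> exp 1\<close> have mass \<open>2 \<pi>\<close> with
  respect to \<open>dw / |w|\<^sup>2\<close>. Insert this into the integral over \<open>y\<close>, exchange the integrals, and
  substitute \<open>y = w x\<close>: in complex dimension two the Jacobian \<open>|w|\<^sup>4\<close>, the homogeneity factor \<open>|w| ^ -2\<close> and the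
  weight \<open>|w| ^ -2\<close> cancel, and an unweighted integral over the complex line of \<open>x\<close> remains.
\<close>

lemma complex_line_averaging:
  fixes f :: "complex ^ 'n::finite \<Rightarrow> real" and \<psi> :: "complex ^ 'n \<Rightarrow> complex"
  assumes N: "CARD('n) = 2"
    and f[measurable]: "f \<in> borel_measurable borel" and \<psi>[measurable]: "\<psi> \<in> borel_measurable borel"
    and hom: "\<And>w x. w \<noteq> 0 \<Longrightarrow> f (w *s x) = f x / (cmod w)\<^sup>2"
    and int: "integrable lborel (\<lambda>y. of_real (f y) * \<psi> y)"
  shows "of_real (2 * pi) * (LINT y|lborel. of_real (f y) * \<psi> y) =
    (LINT x|lborel. of_real (indicator {x. 1 \<le> norm x \<and> norm x \<le> exp 1} x * f x) * (LINT w|lborel. \<psi> (w *s x)))"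
proof -
  let ?S = "{x :: complex ^ 'n. 1 \<le> norm x \<and> norm x \<le> exp 1}"
  define g where "g y = complex_of_real (f y) * \<psi> y" for y
  have [measurable]: "g \<in> borel_measurable borel" unfolding g_def by measurable
  define \<kappa> where "\<kappa> w y = inverse ((cmod w)\<^sup>2) * indicator ?S (inverse w *s y)" for w y
  have S[measurable]: "?S \<in> sets borel" by measurable
  have \<kappa>_meas[measurable]: "(\<lambda>(w, y). \<kappa> w y) \<in> borel_measurable (borel \<Otimes>\<^sub>M borel)"
    unfolding \<kappa>_def by measurable
  have \<kappa>_meas1[measurable]: "(\<lambda>w. \<kappa> w y) \<in> borel_measurable borel" for y
    unfolding \<kappa>_def by measurable
  have \<kappa>_nonneg: "\<kappa> w y \<ge> 0" for w y by (simp add: \<kappa>_def)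
  have \<kappa>_nn: "(\<integral>\<^sup>+w. ennreal (\<kappa> w y) \<partial>lborel) = ennreal (2 * pi)" if y: "y \<noteq> 0" for y
  proof -
    have "(\<integral>\<^sup>+w. ennreal (\<kappa> w y) \<partial>lborel) =
      (\<integral>\<^sup>+w. ennreal (inverse ((cmod w)\<^sup>2)) * indicator {(norm y)\<^sup>2 / (exp 1)\<^sup>2..(norm y)\<^sup>2} ((cmod w)\<^sup>2) \<partial>lborel)"
    proof (rule nn_integral_cong)
      fix w :: complex
      show "ennreal (\<kappa> w y) = ennreal (inverse ((cmod w)\<^sup>2)) * indicator {(norm y)\<^sup>2 / (exp 1)\<^sup>2..(norm y)\<^sup>2} ((cmod w)\<^sup>2)"
      proof (cases "w = 0")
        case False
        then have w: "cmod w > 0" by simp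
        have "norm (inverse w *s y) = norm y / cmod w"
          by (simp add: norm_smult_vec norm_inverse divide_inverse mult.commute)
        then have "inverse w *s y \<in> ?S \<longleftrightarrow> cmod w \<le> norm y \<and> norm y \<le> exp 1 * cmod w"
          using w by (simp add: le_divide_eq divide_le_eq)
        also have "\<dots> \<longleftrightarrow> (cmod w)\<^sup>2 \<in> {(norm y)\<^sup>2 / (exp 1)\<^sup>2..(norm y)\<^sup>2}"
          using w by (auto simp: pos_divide_le_eq power_mult_distrib[symmetric] mult.commute abs_le_square_iff[symmetric])
        finally show ?thesis by (simp add: \<kappa>_def indicator_def)
      qed (use y in \<open>simp add: \<kappa>_def\<close>)
    qed
    also have "\<dots> = ennreal (2 * pi)" by (rule nn_integral_shell_weight) (use y in simp)
    finally show ?thesis .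
  qed
  have \<kappa>_int: "(LINT w|lborel. \<kappa> w y) = 2 * pi" if y: "y \<noteq> 0" for y
    using \<kappa>_nn[OF y] \<kappa>_nonneg by (subst integral_eq_nn_integral) auto
  have AE0: "AE y in lborel. y \<noteq> (0 :: complex ^ 'n)" by (rule AE_lborel_singleton)
  have AE0c: "AE w in lborel. w \<noteq> (0 :: complex)" by (rule AE_lborel_singleton)
  let ?K = "\<lambda>w y. complex_of_real (\<kappa> w y) * g y"
  let ?H = "\<lambda>w x. complex_of_real (indicator ?S x * f x) * \<psi> (w *s x)"
  have scale: "of_real (cmod w ^ (2 * CARD('n))) * ?K w (w *s x) = ?H w x" if w: "w \<noteq> 0" for w x
  proof -
    have "inverse w *s (w *s x) = x" using w by (simp add: vector_smult_assoc)
    moreover have "cmod w ^ (2 * CARD('n)) = (cmod w)\<^sup>2 * (cmod w)\<^sup>2" by (simp add: N power_add[symmetric])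
    ultimately show ?thesis using w by (simp add: \<kappa>_def g_def hom power2_eq_square field_simps)
  qed
  have K_fin: "(\<integral>\<^sup>+y. \<integral>\<^sup>+w. ennreal (cmod (?K w y)) \<partial>lborel \<partial>lborel) < \<infinity>"
  proof -
    have "(\<integral>\<^sup>+y. \<integral>\<^sup>+w. ennreal (cmod (?K w y)) \<partial>lborel \<partial>lborel) =
      (\<integral>\<^sup>+y. ennreal (2 * pi) * ennreal (cmod (g y)) \<partial>lborel)"
    proof (rule nn_integral_cong_AE, use AE0 in eventually_elim)
      fix y :: "complex ^ 'n" assume y: "y \<noteq> 0"
      have "(\<integral>\<^sup>+w. ennreal (cmod (?K w y)) \<partial>lborel) = (\<integral>\<^sup>+w. ennreal (\<kappa> w y) * ennreal (cmod (g y)) \<partial>lborel)"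
        using \<kappa>_nonneg by (intro nn_integral_cong) (simp add: norm_mult ennreal_mult)
      also have "\<dots> = ennreal (2 * pi) * ennreal (cmod (g y))"
        by (subst nn_integral_multc) (auto simp: \<kappa>_nn[OF y])
      finally show "(\<integral>\<^sup>+w. ennreal (cmod (?K w y)) \<partial>lborel) = ennreal (2 * pi) * ennreal (cmod (g y))" .
    qed
    also have "\<dots> = ennreal (2 * pi) * (\<integral>\<^sup>+y. ennreal (cmod (g y)) \<partial>lborel)"
      by (rule nn_integral_cmult) measurable
    also have "\<dots> < \<infinity>"
      using int unfolding integrable_iff_bounded g_def by (simp add: ennreal_mult_less_top)
    finally show ?thesis .
  qed
  have K_int: "integrable (lborel \<Otimes>\<^sub>M lborel) (\<lambda>(y, w). ?K w y)"
    by (rule integrable_pair_lborelI[OF _ K_fin]) measurable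
  have H_int: "integrable (lborel \<Otimes>\<^sub>M lborel) (\<lambda>(w, x). ?H w x)"
  proof (rule integrable_pair_lborelI)
    have "(\<integral>\<^sup>+w. \<integral>\<^sup>+x. ennreal (cmod (?H w x)) \<partial>lborel \<partial>lborel) =
      (\<integral>\<^sup>+w. \<integral>\<^sup>+y. ennreal (cmod (?K w y)) \<partial>lborel \<partial>lborel)"
    proof (rule nn_integral_cong_AE, use AE0c in eventually_elim)
      fix w :: complex assume w: "w \<noteq> 0"
      have "(\<integral>\<^sup>+y. ennreal (cmod (?K w y)) \<partial>lborel) =
        ennreal (cmod w ^ (2 * CARD('n))) * (\<integral>\<^sup>+x. ennreal (cmod (?K w (w *s x))) \<partial>lborel)"
        by (rule nn_integral_lborel_smult[OF w]) measurable
      also have "\<dots> = (\<integral>\<^sup>+x. ennreal (cmod w ^ (2 * CARD('n))) * ennreal (cmod (?K w (w *s x))) \<partial>lborel)"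
        by (rule nn_integral_cmult[symmetric]) measurable
      also have "\<dots> = (\<integral>\<^sup>+x. ennreal (cmod (?H w x)) \<partial>lborel)"
        unfolding scale[OF w, symmetric] by (intro nn_integral_cong) (simp add: norm_mult ennreal_mult norm_power)
      finally show "(\<integral>\<^sup>+x. ennreal (cmod (?H w x)) \<partial>lborel) = (\<integral>\<^sup>+y. ennreal (cmod (?K w y)) \<partial>lborel)" ..
    qed
    also have "\<dots> = (\<integral>\<^sup>+y. \<integral>\<^sup>+w. ennreal (cmod (?K w y)) \<partial>lborel \<partial>lborel)"
      by (rule lborel_pair.Fubini') measurable
    also note K_fin
    finally show "(\<integral>\<^sup>+w. \<integral>\<^sup>+x. ennreal (cmod (?H w x)) \<partial>lborel \<partial>lborel) < \<infinity>" .
  qed measurable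
  have "of_real (2 * pi) * (LINT y|lborel. g y) = (LINT y|lborel. of_real (2 * pi) * g y)"
    by (rule integral_mult_right_zero[symmetric])
  also have "\<dots> = (LINT y|lborel. LINT w|lborel. ?K w y)"
  proof (rule integral_cong_AE)
    show "AE y in lborel. of_real (2 * pi) * g y = (LINT w|lborel. ?K w y)"
      using AE0
    proof eventually_elim
      case (elim y)
      have "(LINT w|lborel. ?K w y) = (LINT w|lborel. complex_of_real (\<kappa> w y)) * g y"
        by (rule integral_mult_left_zero)
      also have "(LINT w|lborel. complex_of_real (\<kappa> w y)) = of_real (2 * pi)"
        using \<kappa>_int[OF elim] by (simp add: integral_complex_of_real)
      finally show ?case by (rule sym)
    qed
  qed measurable
  also have "\<dots> = (LINT w|lborel. LINT y|lborel. ?K w y)"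
    by (rule lborel_pair.Fubini_integral[OF K_int, symmetric])
  also have "\<dots> = (LINT w|lborel. LINT x|lborel. ?H w x)"
  proof (rule integral_cong_AE)
    show "AE w in lborel. (LINT y|lborel. ?K w y) = (LINT x|lborel. ?H w x)"
      using AE0c
    proof eventually_elim
      case (elim w)
      have "(LINT y|lborel. ?K w y) = (cmod w ^ (2 * CARD('n))) *\<^sub>R (LINT x|lborel. ?K w (w *s x))"
        by (rule integral_lborel_smult[OF elim]) measurable
      also have "\<dots> = (LINT x|lborel. of_real (cmod w ^ (2 * CARD('n))) * ?K w (w *s x))"
        unfolding scaleR_conv_of_real by (rule integral_mult_right_zero[symmetric])
      also have "\<dots> = (LINT x|lborel. ?H w x)" by (simp only: scale[OF elim])
      finally show ?case .
    qed
  qed measurable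
  also have "\<dots> = (LINT x|lborel. LINT w|lborel. ?H w x)"
    by (rule lborel_pair.Fubini_integral[OF H_int, symmetric])
  also have "\<dots> = (LINT x|lborel. of_real (indicator ?S x * f x) * (LINT w|lborel. \<psi> (w *s x)))"
    by (intro Bochner_Integration.integral_cong refl integral_mult_right_zero)
  finally show ?thesis by (simp only: g_def)
qed

lemma positive_definite_complex_dimension_two:
  fixes f :: "complex ^ 'n::finite \<Rightarrow> real"
  assumes N: "CARD('n) = 2"
    and f: "f \<in> borel_measurable borel"
    and hom: "\<And>w x. w \<noteq> 0 \<Longrightarrow> f (w *s x) = f x / (cmod w)\<^sup>2"
    and nonneg: "\<And>x. f x \<ge> 0"
  shows "positive_definite_distribution (regular_distribution f)"
  unfolding positive_definite_distribution_def
proof (intro allI impI)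
  fix \<phi> :: "complex ^ 'n \<Rightarrow> complex" assume \<phi>: "schwartz_function \<phi>"
  note [measurable] = schwartz_borel[OF \<phi>]
  define \<psi> where "\<psi> = convolution \<phi> (\<lambda>x. cnj (\<phi> (- x)))"
  have \<psi>m: "\<psi> \<in> borel_measurable borel"
    unfolding \<psi>_def by (rule borel_measurable_convolution) measurable
  show "regular_distribution f \<psi> \<in> \<real>\<^sub>\<ge>\<^sub>0"
  proof (cases "integrable lborel (\<lambda>y. of_real (f y) * \<psi> y)")
    case False
    then show ?thesis by (simp add: regular_distribution_def not_integrable_integral_eq)
  next
    case True
    let ?S = "{x :: complex ^ 'n. 1 \<le> norm x \<and> norm x \<le> exp 1}"
    define r where "r x = indicator ?S x * f x * Re (LINT w|lborel. \<psi> (w *s x))" for x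
    have "of_real (indicator ?S x * f x) * (LINT w|lborel. \<psi> (w *s x)) = of_real (r x) \<and> r x \<ge> 0" for x
    proof (cases "x = 0")
      case True
      then show ?thesis by (simp add: r_def)
    next
      case False
      have "(LINT w|lborel. \<psi> (w *s x)) \<in> \<real>\<^sub>\<ge>\<^sub>0"
        unfolding \<psi>_def by (rule autocorrelation_line_integral_nonneg[OF \<phi> False])
      then obtain t where "t \<ge> 0" "(LINT w|lborel. \<psi> (w *s x)) = of_real t" by (auto elim: nonneg_Reals_cases)
      then show ?thesis using nonneg[of x] by (simp add: r_def)
    qed
    then have r: "\<And>x. of_real (indicator ?S x * f x) * (LINT w|lborel. \<psi> (w *s x)) = of_real (r x)" "\<And>x. r x \<ge> 0"
      by auto
    have "of_real (2 * pi) * regular_distribution f \<psi> =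
      (LINT x|lborel. of_real (indicator ?S x * f x) * (LINT w|lborel. \<psi> (w *s x)))"
      unfolding regular_distribution_def by (rule complex_line_averaging[OF N f \<psi>m hom True])
    also have "\<dots> = of_real (LINT x|lborel. r x)"
      by (simp only: r(1) integral_complex_of_real)
    finally have "regular_distribution f \<psi> = of_real ((LINT x|lborel. r x) / (2 * pi))"
      by (simp add: field_simps)
    moreover have "(LINT x|lborel. r x) \<ge> 0" by (rule integral_nonneg_AE) (simp add: r)
    ultimately show ?thesis by (simp add: nonneg_Reals_of_real_iff)
  qed
qed

text \<open>
  At the origin both sides are \<open>0\<close>, by the conventions for division by zero.
\<close>

lemma minkowski_distribution_eq:
  fixes x :: "'a::euclidean_space"
  assumes K: "convex_body K" "K \<subseteq> ball 0 1"
  shows "minkowski_functional K x powi (-2) / (1 - (norm x / minkowski_functional K x)\<^sup>2) =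
     1 / ((minkowski_functional K x)\<^sup>2 - (norm x)\<^sup>2)"
proof (cases "x = 0")
  case True
  have "minkowski_functional K 0 \<le> 0"
    using minkowski_functional_le_iff[OF K(1), of 0 0] convex_body_0[OF K(1)] by auto
  then have "minkowski_functional K 0 = 0" using minkowski_functional_nonneg[OF K(1), of 0] by simp
  then show ?thesis using True by simp
next
  case False
  define m where "m = minkowski_functional K x"
  have m: "norm x < m" using minkowski_functional_gt_norm[OF K False] by (simp add: m_def)
  then have "m \<noteq> 0" "(norm x)\<^sup>2 < m\<^sup>2" using False by (auto intro: power_strict_mono)
  then show ?thesis unfolding m_def[symmetric]
    by (simp add: power_int_minus power_divide field_simps)
qed

lemma minkowski_positive_definite_complex_dimension_two:
  fixes K :: "(complex ^ 'n::finite) set"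
  assumes N: "CARD('n) = 2"
    and K: "convex_body K" "rotation_invariant K" "K \<subseteq> ball 0 1"
  shows "positive_definite_distribution (regular_distribution
     (\<lambda>x. minkowski_functional K x powi (-2) / (1 - (norm x / minkowski_functional K x)\<^sup>2)))"
  unfolding minkowski_distribution_eq[OF K(1,3)]
proof (rule positive_definite_complex_dimension_two[OF N])
  note [measurable] = borel_measurable_minkowski_functional[OF K(1)]
  show "(\<lambda>x. 1 / ((minkowski_functional K x)\<^sup>2 - (norm x)\<^sup>2)) \<in> borel_measurable borel" by measurable
  fix x :: "complex ^ 'n"
  show "1 / ((minkowski_functional K x)\<^sup>2 - (norm x)\<^sup>2) \<ge> 0"
  proof (cases "x = 0")
    case False
    then show ?thesis using minkowski_functional_gt_norm[OF K(1,3) False]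
      by (auto intro!: power_mono)
  qed simp
  fix w :: complex assume w: "w \<noteq> 0"
  show "1 / ((minkowski_functional K (w *s x))\<^sup>2 - (norm (w *s x))\<^sup>2) =
      1 / ((minkowski_functional K x)\<^sup>2 - (norm x)\<^sup>2) / (cmod w)\<^sup>2"
    using w by (simp add: minkowski_functional_smult[OF K(1,2) w] norm_smult_vec power_mult_distrib
        right_diff_distrib[symmetric] mult.commute)
qed

section \<open>Gaussian test functions\<close>

text \<open>
  Complex-valued polynomial functions. Their products with a Gaussian form a class that is closed
  under directional derivatives, which gives all iterated derivatives at once.
\<close>

inductive poly_fun :: "('a::euclidean_space \<Rightarrow> complex) \<Rightarrow> bool" where
  const: "poly_fun (\<lambda>_. c)"
| linear: "bounded_linear l \<Longrightarrow> poly_fun l"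
| add: "poly_fun p \<Longrightarrow> poly_fun q \<Longrightarrow> poly_fun (\<lambda>x. p x + q x)"
| mult: "poly_fun p \<Longrightarrow> poly_fun q \<Longrightarrow> poly_fun (\<lambda>x. p x * q x)"

lemma poly_fun_has_derivative:
  assumes "poly_fun p"
  shows "\<exists>p'. (\<forall>x. (p has_derivative p' x) (at x)) \<and> (\<forall>b. poly_fun (\<lambda>x. p' x b))"
  using assms
proof induction
  case (const c)
  then show ?case by (intro exI[of _ "\<lambda>_ _. 0"]) (auto intro: poly_fun.const)
next
  case (linear l)
  then show ?case
    by (intro exI[of _ "\<lambda>_. l"]) (auto intro: poly_fun.const bounded_linear.has_derivative[of l] has_derivative_ident
        simp: bounded_linear_imp_has_derivative)
next
  case (add p q)
  then obtain p' q' where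
    p: "\<And>x. (p has_derivative p' x) (at x)" "\<And>b. poly_fun (\<lambda>x. p' x b)" and
    q: "\<And>x. (q has_derivative q' x) (at x)" "\<And>b. poly_fun (\<lambda>x. q' x b)" by blast
  show ?case
    by (intro exI[of _ "\<lambda>x h. p' x h + q' x h"] conjI allI has_derivative_add p q poly_fun.add)
next
  case (mult p q)
  then obtain p' q' where
    p: "\<And>x. (p has_derivative p' x) (at x)" "\<And>b. poly_fun (\<lambda>x. p' x b)" and
    q: "\<And>x. (q has_derivative q' x) (at x)" "\<And>b. poly_fun (\<lambda>x. q' x b)" by blast
  show ?case
    by (intro exI[of _ "\<lambda>x h. p x * q' x h + p' x h * q x"] conjI allI has_derivative_mult p q
        poly_fun.add poly_fun.mult mult)
qed

lemma poly_fun_growth: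
  assumes "poly_fun p"
  shows "\<exists>C m. \<forall>x. cmod (p x) \<le> C * (1 + norm x) ^ m"
  using assms
proof induction
  case (const c)
  then show ?case by (intro exI[of _ "cmod c"] exI[of _ 0]) simp
next
  case (linear l)
  then obtain K where K: "K \<ge> 0" "\<And>x. norm (l x) \<le> norm x * K"
    using bounded_linear.nonneg_bounded by blast
  have "cmod (l x) \<le> K * (1 + norm x) ^ 1" for x
    using K(2)[of x] K(1) by (simp add: algebra_simps)
  then show ?case by blast
next
  case (add p q)
  then obtain C m D n where p: "\<And>x. cmod (p x) \<le> C * (1 + norm x) ^ m"
    and q: "\<And>x. cmod (q x) \<le> D * (1 + norm x) ^ n" by blast
  have "cmod (p x + q x) \<le> (\<bar>C\<bar> + \<bar>D\<bar>) * (1 + norm x) ^ (m + n)" for x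
  proof -
    have "C * (1 + norm x) ^ m \<le> \<bar>C\<bar> * (1 + norm x) ^ (m + n)"
      by (intro mult_mono power_increasing) auto
    moreover have "D * (1 + norm x) ^ n \<le> \<bar>D\<bar> * (1 + norm x) ^ (m + n)"
      by (intro mult_mono power_increasing) auto
    ultimately show ?thesis
      using norm_triangle_ineq[of "p x" "q x"] p[of x] q[of x] by (simp add: distrib_right)
  qed
  then show ?case by blast
next
  case (mult p q)
  then obtain C m D n where p: "\<And>x. cmod (p x) \<le> C * (1 + norm x) ^ m"
    and q: "\<And>x. cmod (q x) \<le> D * (1 + norm x) ^ n" by blast
  have "cmod (p x * q x) \<le> (C * D) * (1 + norm x) ^ (m + n)" for x
  proof -
    have "cmod (p x) * cmod (q x) \<le> (C * (1 + norm x) ^ m) * (D * (1 + norm x) ^ n)"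
      using p[of x] q[of x] by (intro mult_mono) (auto intro: order_trans[OF norm_ge_zero p[of x]])
    then show ?thesis by (simp add: norm_mult power_add mult_ac)
  qed
  then show ?case by blast
qed

text \<open>
  With \<open>M = m + 1\<close> and \<open>\<alpha> = a / M\<close>, the linear function \<open>1 + r\<close> is at most a constant times \<open>1 + \<alpha> r\<^sup>2\<close>, and
  \<open>(1 + a r\<^sup>2 / M) ^ M \<le> exp (a r\<^sup>2)\<close>.
\<close>

lemma power_times_gaussian_bounded:
  fixes a :: real
  assumes a: "a > 0"
  shows "\<exists>K. \<forall>r\<ge>0. (1 + r) ^ m * exp (- a * r\<^sup>2) \<le> K"
proof -
  define M where "M = Suc m"
  define \<alpha> where "\<alpha> = a / real M"
  have \<alpha>: "\<alpha> > 0" using a by (simp add: \<alpha>_def M_def)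
  define K where "K = 2 + 1 / \<alpha>"
  have "(1 + r) ^ m * exp (- a * r\<^sup>2) \<le> K ^ M" if r: "r \<ge> 0" for r
  proof -
    have "(1 + r) ^ m \<le> (1 + r) ^ M" using r by (intro power_increasing) (auto simp: M_def)
    also have "\<dots> \<le> (K * (1 + \<alpha> * r\<^sup>2)) ^ M"
    proof (rule power_mono)
      have "r \<le> 1 + r\<^sup>2" using zero_le_power2[of "r - 1/2"] by (simp add: power2_eq_square algebra_simps)
      moreover have "0 \<le> 2 * \<alpha> * r\<^sup>2 + 1 / \<alpha>" using \<alpha> by simp
      moreover have "K * (1 + \<alpha> * r\<^sup>2) = 2 + 1 / \<alpha> + 2 * \<alpha> * r\<^sup>2 + r\<^sup>2"
        using \<alpha> by (simp add: K_def field_simps)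
      ultimately show "1 + r \<le> K * (1 + \<alpha> * r\<^sup>2)" by linarith
    qed (use r in simp)
    also have "\<dots> = K ^ M * (1 + (a * r\<^sup>2) / real M) ^ M" by (simp add: power_mult_distrib \<alpha>_def)
    also have "\<dots> \<le> K ^ M * exp (a * r\<^sup>2)"
    proof (intro mult_left_mono exp_ge_one_plus_x_over_n_power_n)
      show "- real M \<le> a * r\<^sup>2" using a by (smt (verit) of_nat_0_le_iff mult_nonneg_nonneg zero_le_power2)
    qed (use \<alpha> in \<open>auto simp: M_def K_def\<close>)
    finally have "(1 + r) ^ m * exp (- a * r\<^sup>2) \<le> K ^ M * exp (a * r\<^sup>2) * exp (- a * r\<^sup>2)"
      by (intro mult_right_mono) auto
    also have "\<dots> = K ^ M" by (simp add: mult.assoc flip: exp_add)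
    finally show ?thesis .
  qed
  then show ?thesis by blast
qed

definition gaussian :: "real \<Rightarrow> 'a::euclidean_space \<Rightarrow> complex" where
  "gaussian a x = of_real (exp (- a * (norm x)\<^sup>2))"

lemma gaussian_has_derivative:
  "(gaussian a has_derivative (\<lambda>h. of_real (- 2 * a * (x \<bullet> h)) * gaussian a x)) (at x)"
proof -
  have "((\<lambda>x::'a. exp (- a * (x \<bullet> x))) has_derivative
      (\<lambda>h. (- a * (x \<bullet> h + h \<bullet> x)) * exp (- a * (x \<bullet> x)))) (at x)"
    by (auto intro!: derivative_eq_intros simp: algebra_simps)
  then have "((\<lambda>x::'a. complex_of_real (exp (- a * (x \<bullet> x)))) has_derivative
      (\<lambda>h. of_real ((- a * (x \<bullet> h + h \<bullet> x)) * exp (- a * (x \<bullet> x))))) (at x)"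
    by (rule has_derivative_of_real)
  then show ?thesis unfolding gaussian_def power2_norm_eq_inner
    by (simp add: inner_commute algebra_simps)
qed

lemma poly_gaussian_derivative:
  assumes "poly_fun p"
  shows "\<exists>q. poly_fun q \<and> (\<lambda>x. frechet_derivative (\<lambda>x. p x * gaussian a x) (at x) b) = (\<lambda>x. q x * gaussian a x)"
    and "(\<lambda>x. p x * gaussian a x) differentiable (at x)"
proof -
  obtain p' where p: "\<And>x. (p has_derivative p' x) (at x)" "\<And>b. poly_fun (\<lambda>x. p' x b)"
    using poly_fun_has_derivative[OF assms] by blast
  have d: "((\<lambda>x. p x * gaussian a x) has_derivative
      (\<lambda>h. p x * (of_real (- 2 * a * (x \<bullet> h)) * gaussian a x) + p' x h * gaussian a x)) (at x)" for x
    by (rule has_derivative_mult[OF p(1) gaussian_has_derivative])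
  show "(\<lambda>x. p x * gaussian a x) differentiable (at x)" using d differentiable_def by blast
  have "bounded_linear (\<lambda>x::'a. complex_of_real (x \<bullet> b))"
    by (intro bounded_linear_compose[OF bounded_linear_of_real] bounded_linear_inner_left)
  then have q: "poly_fun (\<lambda>x. p x * (complex_of_real (- 2 * a) * complex_of_real (x \<bullet> b)) + p' x b)"
    by (intro poly_fun.add poly_fun.mult assms p(2) poly_fun.const poly_fun.linear)
  have "frechet_derivative (\<lambda>x. p x * gaussian a x) (at x) b =
      (p x * (complex_of_real (- 2 * a) * complex_of_real (x \<bullet> b)) + p' x b) * gaussian a x" for x
    unfolding frechet_derivative_at[OF d, symmetric] by (simp add: algebra_simps)
  then show "\<exists>q. poly_fun q \<and> (\<lambda>x. frechet_derivative (\<lambda>x. p x * gaussian a x) (at x) b) = (\<lambda>x. q x * gaussian a x)"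
    using q by blast
qed

lemma schwartz_poly_gaussian:
  assumes p: "poly_fun p" and a: "a > 0"
  shows "schwartz_function (\<lambda>x. p x * gaussian a x)"
proof -
  have iter: "\<exists>q. poly_fun q \<and> iterated_deriv bs (\<lambda>x. p x * gaussian a x) = (\<lambda>x. q x * gaussian a x)" for bs
  proof (induction bs)
    case (Cons b bs)
    then obtain q where "poly_fun q" "iterated_deriv bs (\<lambda>x. p x * gaussian a x) = (\<lambda>x. q x * gaussian a x)" by blast
    then show ?case using poly_gaussian_derivative(1)[of q a b] by simp
  qed (use p in auto)
  have bd: "bounded (range (\<lambda>x. norm x ^ m *\<^sub>R (q x * gaussian a x)))" if q: "poly_fun q" for q m
  proof -
    obtain C n where C: "\<And>x. cmod (q x) \<le> C * (1 + norm x) ^ n" using poly_fun_growth[OF q] by blast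
    obtain K where K: "\<And>r. r \<ge> 0 \<Longrightarrow> (1 + r) ^ (m + n) * exp (- a * r\<^sup>2) \<le> K"
      using power_times_gaussian_bounded[OF a] by blast
    have "norm (norm x ^ m *\<^sub>R (q x * gaussian a x)) \<le> \<bar>C\<bar> * K" for x
    proof -
      have "norm (norm x ^ m *\<^sub>R (q x * gaussian a x)) = norm x ^ m * (cmod (q x) * exp (- a * (norm x)\<^sup>2))"
        by (simp add: norm_mult gaussian_def)
      also have "\<dots> \<le> (1 + norm x) ^ m * ((\<bar>C\<bar> * (1 + norm x) ^ n) * exp (- a * (norm x)\<^sup>2))"
      proof (intro mult_mono power_mono)
        have "C * (1 + norm x) ^ n \<le> \<bar>C\<bar> * (1 + norm x) ^ n" by (intro mult_right_mono) auto
        then show "cmod (q x) \<le> \<bar>C\<bar> * (1 + norm x) ^ n" using C[of x] by simp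
      qed auto
      also have "\<dots> = \<bar>C\<bar> * ((1 + norm x) ^ (m + n) * exp (- a * (norm x)\<^sup>2))"
        by (simp add: power_add mult_ac)
      also have "\<dots> \<le> \<bar>C\<bar> * K" by (intro mult_left_mono K) auto
      finally show ?thesis .
    qed
    then show ?thesis by (auto simp: bounded_iff)
  qed
  show ?thesis unfolding schwartz_function_def
  proof (intro ballI conjI allI)
    fix bs :: "'a list" and x m
    obtain q where q: "poly_fun q" "iterated_deriv bs (\<lambda>x. p x * gaussian a x) = (\<lambda>x. q x * gaussian a x)"
      using iter by blast
    show "iterated_deriv bs (\<lambda>x. p x * gaussian a x) differentiable at x"
      unfolding q(2) by (rule poly_gaussian_derivative(2)[OF q(1)])
    show "bounded (range (\<lambda>x. norm x ^ m *\<^sub>R iterated_deriv bs (\<lambda>x. p x * gaussian a x) x))"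
      unfolding q(2) by (rule bd[OF q(1)])
  qed
qed

lemma poly_gaussian_integrable:
  fixes p :: "complex ^ 'n::finite \<Rightarrow> complex"
  assumes "poly_fun p" "a > 0"
  shows "integrable lborel (\<lambda>x. p x * gaussian a x)"
proof -
  note s = schwartz_poly_gaussian[OF assms]
  have "CARD('n) \<ge> 1" by (simp add: Suc_le_eq)
  then show ?thesis
    using schwartz_nn_integral_finite[OF s, of "CARD('n)"] schwartz_borel[OF s]
    by (intro integrableI_bounded) auto
qed

text \<open>
  The Gamma integral, rescaled.
\<close>

lemma nn_integral_power_exp:
  fixes s :: real
  assumes s: "s > 0"
  shows "(\<integral>\<^sup>+u. ennreal (u ^ k * exp (- s * u)) * indicator {0..} u \<partial>lborel) = ennreal (fact k / s ^ (k + 1))"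
proof -
  have 1: "(\<integral>\<^sup>+u. ennreal (u ^ k * exp (- u)) * indicator {0..} u \<partial>lborel) = ennreal (fact k)"
  proof -
    have "((\<lambda>t. t powr (real (k + 1) - 1) / exp t) has_integral Gamma (real (k + 1))) {0..}"
      by (rule Gamma_integral_real) simp
    moreover have "Gamma (real (k + 1)) = fact k"
      using Gamma_fact[of k, where 'a = real] by (simp add: add.commute)
    ultimately have "((\<lambda>t. t powr (real (k + 1) - 1) / exp t) has_integral fact k) {0..}" by simp
    then have "((\<lambda>t::real. t ^ k * exp (- t)) has_integral fact k) {0..}"
      by (rule has_integral_spike[of "{0}", rotated 2])
         (auto simp: powr_realpow exp_minus divide_inverse)
    from nn_integral_has_integral_lebesgue[OF _ this]
    have "(\<integral>\<^sup>+u. ennreal (indicator {0..} u * (u ^ k * exp (- u))) \<partial>lborel) = ennreal (fact k)"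
      by simp
    moreover have "(\<integral>\<^sup>+u. ennreal (u ^ k * exp (- u)) * indicator {0..} u \<partial>lborel) =
      (\<integral>\<^sup>+u. ennreal (indicator {0..} u * (u ^ k * exp (- u))) \<partial>lborel)"
      by (intro nn_integral_cong) (auto split: split_indicator)
    ultimately show ?thesis by simp
  qed
  have "(\<integral>\<^sup>+u. ennreal (u ^ k * exp (- u)) * indicator {0..} u \<partial>lborel) =
     ennreal \<bar>s\<bar> * (\<integral>\<^sup>+u. ennreal ((0 + s * u) ^ k * exp (- (0 + s * u))) * indicator {0..} (0 + s * u) \<partial>lborel)"
    by (rule nn_integral_real_affine) (use s in auto)
  also have "\<dots> = ennreal \<bar>s\<bar> * (\<integral>\<^sup>+u. ennreal (s ^ k) * (ennreal (u ^ k * exp (- s * u)) * indicator {0..} u) \<partial>lborel)"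
  proof -
    have "ennreal ((0 + s * u) ^ k * exp (- (0 + s * u))) * indicator {0..} (0 + s * u) =
        ennreal (s ^ k) * (ennreal (u ^ k * exp (- s * u)) * indicator {0..} u)" for u
    proof (cases "u \<ge> 0")
      case True
      then show ?thesis using s by (simp add: power_mult_distrib ennreal_mult[symmetric] mult_ac)
    next
      case False
      then show ?thesis using s by (simp add: zero_le_mult_iff)
    qed
    then show ?thesis by simp
  qed
  also have "\<dots> = ennreal (s ^ (k + 1)) * (\<integral>\<^sup>+u. ennreal (u ^ k * exp (- s * u)) * indicator {0..} u \<partial>lborel)"
    using s by (subst nn_integral_cmult) (auto simp: ennreal_mult mult.assoc)
  finally have eq: "ennreal (s ^ (k + 1)) * (\<integral>\<^sup>+u. ennreal (u ^ k * exp (- s * u)) * indicator {0..} u \<partial>lborel) = ennreal (fact k)"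
    using 1 by simp
  have "(\<integral>\<^sup>+u. ennreal (u ^ k * exp (- s * u)) * indicator {0..} u \<partial>lborel) =
     ennreal (1 / s ^ (k + 1)) * (ennreal (s ^ (k + 1)) * (\<integral>\<^sup>+u. ennreal (u ^ k * exp (- s * u)) * indicator {0..} u \<partial>lborel))"
    using s by (subst mult.assoc[symmetric], subst ennreal_mult[symmetric]) auto
  also have "\<dots> = ennreal (1 / s ^ (k + 1)) * ennreal (fact k)" by (simp only: eq)
  finally show ?thesis using s by (simp add: ennreal_mult[symmetric])
qed

lemma integral_odd_zero:
  fixes g :: "'a::euclidean_space \<Rightarrow> complex"
  assumes [measurable]: "g \<in> borel_measurable borel" and odd: "\<And>x. g (- x) = - g x"
  shows "(LINT x|lborel. g x) = 0"
proof -
  have "(LINT x|lborel. g x) = (LINT x|distr lborel borel uminus. g x)" by (simp add: distr_lborel_uminus)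
  also have "\<dots> = (LINT x|lborel. g (- x))" by (rule integral_distr) auto
  also have "\<dots> = - (LINT x|lborel. g x)" by (simp add: odd)
  finally show ?thesis by simp
qed

lemma bounded_linear_cdot: "bounded_linear (\<lambda>z. cdot z \<eta>)"
  by (intro linear_conv_bounded_linear[THEN iffD1] linearI)
     (auto simp: cdot_add_left cdot_scaleR_left scaleR_conv_of_real[where 'a = complex])

text \<open>
  The two integrals differ in the first radial variable only, where \<open>u\<close> has mean \<open>1/4\<close> under the
  density proportional to \<open>exp (- 4 u)\<close>.
\<close>

lemma gaussian_moments:
  fixes \<eta> :: "complex ^ 'n::finite"
  assumes \<eta>: "norm \<eta> = 1" and N: "CARD('n) \<ge> 2"
  obtains B where "B > 0" "(LINT w::complex ^ 'n|lborel. gaussian 4 w) = of_real B"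
    "(LINT w|lborel. cdot w \<eta> * cnj (cdot w \<eta>) * gaussian 4 w) = of_real (B / 4)"
proof -
  define k where "k = CARD('n) - 1"
  have k: "k \<ge> 1" "CARD('n) = k + 1" using N by (auto simp: k_def)
  let ?I = "\<integral>\<^sup>+v. ennreal (radial_density k v) * ennreal (exp (- 4 * v)) \<partial>lborel"
  have I: "?I = ennreal ((pi / 4) ^ k)"
  proof -
    have "?I = (\<integral>\<^sup>+v. ennreal (pi ^ k / fact (k - 1)) * (ennreal (v ^ (k - 1) * exp (- 4 * v)) * indicator {0..} v) \<partial>lborel)"
      by (intro nn_integral_cong) (auto simp: radial_density_def ennreal_mult[symmetric] split: split_indicator)
    also have "\<dots> = ennreal (pi ^ k / fact (k - 1)) * ennreal (fact (k - 1) / 4 ^ (k - 1 + 1))"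
      by (subst nn_integral_cmult) (auto simp only: nn_integral_power_exp, measurable)
    finally show ?thesis using k by (simp add: ennreal_mult[symmetric] power_divide)
  qed
  have mom: "(\<integral>\<^sup>+w. ennreal (((cmod (cdot w \<eta>))\<^sup>2) ^ j * exp (- 4 * (norm w)\<^sup>2)) \<partial>lborel) =
      ennreal (pi * (fact j / 4 ^ (j + 1)) * (pi / 4) ^ k)" for j
  proof -
    let ?F = "\<lambda>u v::real. ennreal (\<bar>u\<bar> ^ j * exp (- 4 * u)) * ennreal (exp (- 4 * v))"
    have "(\<integral>\<^sup>+w. ennreal (((cmod (cdot w \<eta>))\<^sup>2) ^ j * exp (- 4 * (norm w)\<^sup>2)) \<partial>lborel) =
      (\<integral>\<^sup>+w. ?F ((cmod (cdot w \<eta>))\<^sup>2) ((norm w)\<^sup>2 - (cmod (cdot w \<eta>))\<^sup>2) \<partial>lborel)"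
      by (intro nn_integral_cong) (simp add: ennreal_mult[symmetric] mult.assoc flip: exp_add)
    also have "\<dots> = (\<integral>\<^sup>+u. ennreal (radial_density 1 u) * (\<integral>\<^sup>+v. ennreal (radial_density k v) * ?F u v \<partial>lborel) \<partial>lborel)"
      by (rule nn_integral_complex_line_split_lborel[OF \<eta> k(2,1)]) measurable
    also have "\<dots> = (\<integral>\<^sup>+u. ennreal (radial_density 1 u) * (ennreal (\<bar>u\<bar> ^ j * exp (- 4 * u)) * ?I) \<partial>lborel)"
      by (intro nn_integral_cong) (simp add: nn_integral_cmult[symmetric] mult_ac)
    also have "\<dots> = (\<integral>\<^sup>+u. (ennreal pi * ?I) * (ennreal (u ^ j * exp (- 4 * u)) * indicator {0..} u) \<partial>lborel)"
      by (intro nn_integral_cong) (auto simp: radial_density_def mult_ac split: split_indicator)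
    also have "\<dots> = (ennreal pi * ?I) * ennreal (fact j / 4 ^ (j + 1))"
      by (subst nn_integral_cmult) (auto simp only: nn_integral_power_exp, measurable)
    also have "\<dots> = ennreal (pi * (fact j / 4 ^ (j + 1)) * (pi / 4) ^ k)"
      unfolding I by (simp add: ennreal_mult[symmetric] mult_ac)
    finally show ?thesis .
  qed
  define B where "B = pi * (1 / 4) * (pi / 4) ^ k"
  have real_mom: "(LINT w|lborel. ((cmod (cdot w \<eta>))\<^sup>2) ^ j * exp (- 4 * (norm w)\<^sup>2)) = pi * (fact j / 4 ^ (j + 1)) * (pi / 4) ^ k" for j
  proof -
    have "(LINT w|lborel. ((cmod (cdot w \<eta>))\<^sup>2) ^ j * exp (- 4 * (norm w)\<^sup>2)) =
      enn2real (\<integral>\<^sup>+w. ennreal (((cmod (cdot w \<eta>))\<^sup>2) ^ j * exp (- 4 * (norm w)\<^sup>2)) \<partial>lborel)"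
      by (rule integral_eq_nn_integral) auto
    then show ?thesis unfolding mom by simp
  qed
  show ?thesis
  proof (rule that)
    show "B > 0" by (simp add: B_def)
    show "(LINT w::complex ^ 'n|lborel. gaussian 4 w) = of_real B"
    proof -
      have "(LINT w::complex ^ 'n|lborel. gaussian 4 w) = of_real (LINT w::complex ^ 'n|lborel. exp (- 4 * (norm w)\<^sup>2))"
        unfolding gaussian_def by (rule integral_complex_of_real)
      also have "(LINT w::complex ^ 'n|lborel. exp (- 4 * (norm w)\<^sup>2)) = B"
        using real_mom[of 0] by (simp add: B_def)
      finally show ?thesis .
    qed
    have "(LINT w|lborel. cdot w \<eta> * cnj (cdot w \<eta>) * gaussian 4 w) =
       (LINT w|lborel. complex_of_real (((cmod (cdot w \<eta>))\<^sup>2) ^ 1 * exp (- 4 * (norm w)\<^sup>2)))"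
      by (intro Bochner_Integration.integral_cong refl) (simp add: gaussian_def complex_norm_square[symmetric] del: of_real_power)
    also have "\<dots> = of_real (LINT w|lborel. ((cmod (cdot w \<eta>))\<^sup>2) ^ 1 * exp (- 4 * (norm w)\<^sup>2))"
      by (rule integral_complex_of_real)
    also have "\<dots> = of_real (B / 4)" unfolding real_mom by (simp add: B_def)
    finally show "(LINT w|lborel. cdot w \<eta> * cnj (cdot w \<eta>) * gaussian 4 w) = of_real (B / 4)" .
  qed
qed

text \<open>
  Substitute \<open>y = x / 2 + w\<close>. By the parallelogram law the two Gaussians multiply to
  \<open>exp (- |x|\<^sup>2) exp (- 4 |w|\<^sup>2)\<close>, and with \<open>a = \<langle>x, \<eta>\<rangle>\<close>, \<open>b = \<langle>w, \<eta>\<rangle>\<close> the linear factors become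
  \<open>(a / 2 + b) cnj (b - a / 2)\<close>. The mixed terms are odd in \<open>w\<close> and vanish; the rest is evaluated by the
  Gaussian moments.
\<close>

lemma autocorrelation_linear_gaussian:
  fixes \<eta> :: "complex ^ 'n::finite"
  assumes \<eta>: "norm \<eta> = 1" and N: "CARD('n) \<ge> 2"
  defines "\<phi> \<equiv> \<lambda>z. cdot z \<eta> * gaussian 2 z"
  obtains C where "C > 0"
    "\<And>x. convolution \<phi> (\<lambda>x. cnj (\<phi> (- x))) x = of_real (C * (1 - (cmod (cdot x \<eta>))\<^sup>2) * exp (- (norm x)\<^sup>2))"
proof -
  obtain B where B: "B > 0" "(LINT w::complex ^ 'n|lborel. gaussian 4 w) = of_real B"
    "(LINT w|lborel. cdot w \<eta> * cnj (cdot w \<eta>) * gaussian 4 w) = of_real (B / 4)"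
    using gaussian_moments[OF \<eta> N] .
  have lin: "poly_fun (\<lambda>z. cdot z \<eta>)" by (rule poly_fun.linear[OF bounded_linear_cdot])
  have clin: "poly_fun (\<lambda>z. cnj (cdot z \<eta>))"
    by (rule poly_fun.linear[OF bounded_linear_compose[OF bounded_linear_cnj bounded_linear_cdot]])
  have int0: "integrable lborel (\<lambda>w::complex ^ 'n. gaussian 4 w)"
    using poly_gaussian_integrable[OF poly_fun.const[of 1], of 4] by simp
  have int1: "integrable lborel (\<lambda>w. cdot w \<eta> * gaussian 4 w)" "integrable lborel (\<lambda>w. cnj (cdot w \<eta>) * gaussian 4 w)"
    by (intro poly_gaussian_integrable lin clin; simp)+
  have int2: "integrable lborel (\<lambda>w. cdot w \<eta> * cnj (cdot w \<eta>) * gaussian 4 w)"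
    by (intro poly_gaussian_integrable poly_fun.mult lin clin) simp
  have odd: "(LINT w|lborel. cdot w \<eta> * gaussian 4 w) = 0" "(LINT w|lborel. cnj (cdot w \<eta>) * gaussian 4 w) = 0"
    by (rule integral_odd_zero; use int1 in \<open>auto simp: gaussian_def cdot_def sum_negf dest: borel_measurable_integrable\<close>)+
  have "convolution \<phi> (\<lambda>x. cnj (\<phi> (- x))) x = of_real (B / 4 * (1 - (cmod (cdot x \<eta>))\<^sup>2) * exp (- (norm x)\<^sup>2))" for x
  proof -
    let ?a = "cdot x \<eta>" and ?e = "complex_of_real (exp (- (norm x)\<^sup>2))"
    let ?g = "\<lambda>y. \<phi> y * cnj (\<phi> (y - x))"
    have [measurable]: "\<phi> \<in> borel_measurable borel"
      unfolding \<phi>_def by (rule schwartz_borel[OF schwartz_poly_gaussian[OF lin]]) simp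
    have "convolution \<phi> (\<lambda>x. cnj (\<phi> (- x))) x = (LINT y|lborel. ?g y)"
      by (simp add: convolution_def)
    also have "\<dots> = (LINT w|lborel. ?g ((1/2) *\<^sub>R x + w))"
      by (rule integral_lborel_translate[symmetric]) measurable
    also have "\<dots> = (LINT w|lborel. ?e * (cdot w \<eta> * cnj (cdot w \<eta>) * gaussian 4 w)
        - ?e * (?a * cnj ?a / 4) * gaussian 4 w
        + ?e * (?a / 2) * (cnj (cdot w \<eta>) * gaussian 4 w) - ?e * (cnj ?a / 2) * (cdot w \<eta> * gaussian 4 w))"
    proof (rule Bochner_Integration.integral_cong[OF refl])
      fix w
      have "(norm ((1/2) *\<^sub>R x + w))\<^sup>2 + (norm (w - (1/2) *\<^sub>R x))\<^sup>2 = 2 * (norm w)\<^sup>2 + (norm x)\<^sup>2 / 2"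
        by (simp add: power2_norm_eq_inner inner_add_left inner_add_right inner_diff_left inner_diff_right
              inner_commute algebra_simps)
      then have ex: "exp (- 2 * (norm ((1/2) *\<^sub>R x + w))\<^sup>2) * exp (- 2 * (norm (w - (1/2) *\<^sub>R x))\<^sup>2) =
          exp (- (norm x)\<^sup>2) * exp (- 4 * (norm w)\<^sup>2)"
        unfolding exp_add[symmetric] by (simp add: algebra_simps)
      have g: "gaussian 2 ((1/2) *\<^sub>R x + w) * cnj (gaussian 2 (w - (1/2) *\<^sub>R x)) = ?e * gaussian 4 w"
        unfolding gaussian_def complex_cnj_complex_of_real of_real_mult[symmetric] ex ..
      have s: "(1/2) *\<^sub>R x + w - x = w - (1/2) *\<^sub>R x"
        by (simp add: vec_eq_iff complex_eq_iff)
      have c: "cdot ((1/2) *\<^sub>R x + w) \<eta> = ?a / 2 + cdot w \<eta>" "cdot (w - (1/2) *\<^sub>R x) \<eta> = cdot w \<eta> - ?a / 2"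
        by (simp_all add: cdot_add_left cdot_diff_left cdot_scaleR_left)
      have "?g ((1/2) *\<^sub>R x + w) = (?a / 2 + cdot w \<eta>) * cnj (cdot w \<eta> - ?a / 2) * (?e * gaussian 4 w)"
        unfolding \<phi>_def s c complex_cnj_mult g[symmetric] by (simp only: mult_ac)
      also have "\<dots> = ?e * (cdot w \<eta> * cnj (cdot w \<eta>) * gaussian 4 w)
        - ?e * (?a * cnj ?a / 4) * gaussian 4 w
        + ?e * (?a / 2) * (cnj (cdot w \<eta>) * gaussian 4 w) - ?e * (cnj ?a / 2) * (cdot w \<eta> * gaussian 4 w)"
        by (simp add: algebra_simps)
      finally show "?g ((1/2) *\<^sub>R x + w) = \<dots>" .
    qed
    also have "\<dots> = ?e * of_real (B / 4) - ?e * (?a * cnj ?a / 4) * of_real B"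
      using int0 int1 int2 by (simp add: B odd)
    also have "\<dots> = of_real (B / 4 * (1 - (cmod (cdot x \<eta>))\<^sup>2) * exp (- (norm x)\<^sup>2))"
      by (simp add: complex_norm_square[symmetric] algebra_simps)
    finally show ?thesis .
  qed
  then show ?thesis using that[of "B / 4"] B(1) by simp
qed

section \<open>A cylinder whose kernel is not positive definite\<close>

text \<open>
  The bounds \<open>2 c\<close> and \<open>c\<close> place the edge of the cylinder at squared distance \<open>3 c\<close> from the origin, on the
  cone \<open>|z'|\<^sup>2 = |z\<^sub>1|\<^sup>2 / 2\<close>. With equal bounds the edge would lie on the cone \<open>|z'| = |z\<^sub>1|\<close>, where the decisive
  factor \<open>2 + |z'|\<^sup>2 / |z\<^sub>1|\<^sup>2 - n\<close> vanishes for \<open>n = 3\<close>.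
\<close>

definition cylinder :: "complex ^ 'n::finite \<Rightarrow> real \<Rightarrow> (complex ^ 'n) set" where
  "cylinder \<eta> c = {z. (cmod (cdot z \<eta>))\<^sup>2 \<le> 2 * c \<and> (norm z)\<^sup>2 - (cmod (cdot z \<eta>))\<^sup>2 \<le> c}"

lemma rotation_invariantI:
  fixes K :: "(complex ^ 'n::finite) set"
  assumes "\<And>\<theta> x. x \<in> K \<Longrightarrow> cis \<theta> *s x \<in> K"
  shows "rotation_invariant K"
proof -
  have 1: "cis \<theta> *s x \<in> (*\<^sub>R) a ` K" if "x \<in> (*\<^sub>R) a ` K" for \<theta> and a :: real and x :: "complex ^ 'n"
  proof -
    from that obtain y where y: "y \<in> K" "x = a *\<^sub>R y" by auto
    have "cis \<theta> *s x = a *\<^sub>R (cis \<theta> *s y)" by (simp add: y scaleR_eq_smult mult.commute)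
    then show ?thesis using assms[OF y(1)] by blast
  qed
  have "cis \<theta> *s x \<in> (*\<^sub>R) a ` K \<longleftrightarrow> x \<in> (*\<^sub>R) a ` K" for \<theta> and a :: real and x :: "complex ^ 'n"
  proof
    assume "cis \<theta> *s x \<in> (*\<^sub>R) a ` K"
    from 1[OF this, of "- \<theta>"] show "x \<in> (*\<^sub>R) a ` K" by (simp add: cis_mult)
  qed (rule 1)
  then show ?thesis
    by (simp add: rotation_invariant_def minkowski_functional_def rotate_coords_smult)
qed

lemma cylinder_rotation_invariant: "rotation_invariant (cylinder \<eta> c)"
  by (rule rotation_invariantI) (simp add: cylinder_def cdot_smult_left norm_smult_vec norm_mult)

lemma power2_norm_le_iff:
  fixes x :: "'a::real_normed_vector"
  assumes "0 \<le> c"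
  shows "(norm x)\<^sup>2 \<le> c \<longleftrightarrow> norm x \<le> sqrt c"
  by (metis abs_norm_cancel real_sqrt_abs real_sqrt_le_iff)

lemma cylinder_norm_le: "z \<in> cylinder \<eta> c \<Longrightarrow> (norm z)\<^sup>2 \<le> 3 * c"
  by (auto simp: cylinder_def)

lemma cylinder_subset_ball: "3 * c < 1 \<Longrightarrow> cylinder \<eta> c \<subseteq> ball 0 1"
proof
  fix z assume c: "3 * c < 1" and "z \<in> cylinder \<eta> c"
  then have "(norm z)\<^sup>2 < 1" using cylinder_norm_le[of z \<eta> c] by simp
  then show "z \<in> ball 0 1" by (simp add: abs_square_less_1)
qed

lemma cylinder_convex_body:
  fixes \<eta> :: "complex ^ 'n::finite"
  assumes \<eta>: "norm \<eta> = 1" and c: "c > 0"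
  shows "convex_body (cylinder \<eta> c)"
proof -
  let ?T = "\<lambda>z. z - cdot z \<eta> *s \<eta>"
  have eq: "cylinder \<eta> c = (\<lambda>z. cdot z \<eta>) -` cball 0 (sqrt (2 * c)) \<inter> ?T -` cball 0 (sqrt c)"
    using c by (auto simp: cylinder_def norm_diff_projection[OF \<eta>, symmetric] power2_norm_le_iff)
  have l1: "linear (\<lambda>z. cdot z \<eta>)" using bounded_linear_cdot bounded_linear.linear by blast
  have l2: "linear ?T"
    by (rule linearI) (simp_all add: cdot_add_left cdot_scaleR_left vector_sadd_rdistrib scaleR_eq_smult
      vector_ssub_ldistrib cdot_smult_left algebra_simps)
  have c1: "continuous_on UNIV (\<lambda>z. cdot z \<eta>)" by (intro continuous_intros)
  have c2: "continuous_on UNIV ?T" using l2 linear_continuous_on linear_conv_bounded_linear by blast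
  have "convex (cylinder \<eta> c)" unfolding eq
    by (intro convex_Int convex_linear_vimage l1 l2 convex_cball)
  moreover have "closed (cylinder \<eta> c)" unfolding eq
    by (intro closed_Int closed_vimage c1 c2 closed_cball)
  moreover have "bounded (cylinder \<eta> c)"
    unfolding bounded_iff using cylinder_norm_le[of _ \<eta> c] c
    by (intro exI[of _ "sqrt (3 * c)"]) (auto simp: power2_norm_le_iff[symmetric])
  moreover have "0 \<in> interior (cylinder \<eta> c)"
  proof (rule interiorI[of "ball 0 (sqrt c)"])
    show "ball 0 (sqrt c) \<subseteq> cylinder \<eta> c"
    proof
      fix z :: "complex ^ 'n" assume "z \<in> ball 0 (sqrt c)"
      then have "(norm z)\<^sup>2 \<le> c" using c by (simp add: power2_norm_le_iff)
      moreover have "(cmod (cdot z \<eta>))\<^sup>2 \<le> (norm z)\<^sup>2" by (rule cmod_cdot_le[OF \<eta>])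
      ultimately show "z \<in> cylinder \<eta> c" using c zero_le_power2[of "cmod (cdot z \<eta>)"]
        unfolding cylinder_def mem_Collect_eq by linarith
    qed
  qed (use c in auto)
  ultimately show ?thesis by (simp add: convex_body_def compact_eq_bounded_closed)
qed

lemma minkowski_functional_cylinder:
  assumes \<eta>: "norm \<eta> = 1" and c: "c > 0"
  shows "(minkowski_functional (cylinder \<eta> c) z)\<^sup>2 =
    max ((cmod (cdot z \<eta>))\<^sup>2 / (2 * c)) (((norm z)\<^sup>2 - (cmod (cdot z \<eta>))\<^sup>2) / c)" (is "_ = ?M")
proof -
  note K = cylinder_convex_body[OF \<eta> c]
  have M0: "?M \<ge> 0" using c by (simp add: le_max_iff_disj)
  have iff: "minkowski_functional (cylinder \<eta> c) z \<le> a \<longleftrightarrow> sqrt ?M \<le> a" if a: "a \<ge> 0" for a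
  proof -
    have "z \<in> (*\<^sub>R) a ` cylinder \<eta> c \<longleftrightarrow> ?M \<le> a\<^sup>2"
    proof (cases "a = 0")
      case True
      have "z = 0 \<longleftrightarrow> ?M \<le> 0"
      proof
        assume "?M \<le> 0"
        then have "(cmod (cdot z \<eta>))\<^sup>2 \<le> 0" "(norm z)\<^sup>2 - (cmod (cdot z \<eta>))\<^sup>2 \<le> 0"
          using c by (auto simp: divide_le_0_iff)
        then have "(norm z)\<^sup>2 \<le> 0" by linarith
        then show "z = 0" by simp
      qed simp
      then show ?thesis using True convex_body_0[OF K] by auto
    next
      case False
      then have ap: "a > 0" "a\<^sup>2 > 0" using a by auto
      have "z \<in> (*\<^sub>R) a ` cylinder \<eta> c \<longleftrightarrow> (1 / a) *\<^sub>R z \<in> cylinder \<eta> c"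
        using ap by (auto simp: image_iff intro!: bexI[of _ "(1 / a) *\<^sub>R z"])
      also have "\<dots> \<longleftrightarrow> (cmod (cdot z \<eta>))\<^sup>2 / a\<^sup>2 \<le> 2 * c \<and> (norm z)\<^sup>2 / a\<^sup>2 - (cmod (cdot z \<eta>))\<^sup>2 / a\<^sup>2 \<le> c"
        using ap by (simp add: cylinder_def cdot_scaleR_left norm_mult power_divide norm_divide)
      also have "\<dots> \<longleftrightarrow> ?M \<le> a\<^sup>2"
        using ap c by (simp add: diff_divide_distrib[symmetric] pos_divide_le_eq mult.commute mult.left_commute)
      finally show ?thesis .
    qed
    also have "\<dots> \<longleftrightarrow> sqrt ?M \<le> a"
      using a M0 by (metis real_sqrt_le_iff real_sqrt_abs abs_of_nonneg)
    finally show ?thesis using minkowski_functional_le_iff[OF K a] by simp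
  qed
  have "minkowski_functional (cylinder \<eta> c) z = sqrt ?M"
    using iff[of "sqrt ?M"] iff[of "minkowski_functional (cylinder \<eta> c) z"]
      minkowski_functional_nonneg[OF K, of z] M0 by (intro antisym) auto
  then show ?thesis using M0 by simp
qed

text \<open>
  The function \<open>1 / (N\<^sup>2 - |x|\<^sup>2)\<close> of the cylinder in the variables \<open>u = |z\<^sub>1|\<^sup>2\<close> and \<open>v = |z'|\<^sup>2\<close>.
\<close>

definition cylinder_kernel :: "real \<Rightarrow> real \<Rightarrow> real \<Rightarrow> real" where
  "cylinder_kernel c u v = 1 / (max (u / (2 * c)) (v / c) - (u + v))"

lemma cylinder_kernel_measurable [measurable (raw)]:
  assumes [measurable]: "f \<in> borel_measurable M" "g \<in> borel_measurable M"
  shows "(\<lambda>x. cylinder_kernel c (f x) (g x)) \<in> borel_measurable M"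
  unfolding cylinder_kernel_def by measurable

text \<open>
  The maximum dominates the average of the two terms with the weights \<open>2/3\<close> and \<open>1/3\<close>.
\<close>

lemma cylinder_gauge_lower:
  fixes c u v :: real
  assumes c: "c > 0"
  shows "(u + v) / (3 * c) \<le> max (u / (2 * c)) (v / c)"
proof -
  have "u \<le> 2 * c * max (u / (2 * c)) (v / c)" using c by (simp add: max_def field_simps)
  moreover have "v \<le> c * max (u / (2 * c)) (v / c)" using c by (simp add: max_def field_simps)
  ultimately have "u + v \<le> 3 * c * max (u / (2 * c)) (v / c)" by (simp add: algebra_simps)
  then show ?thesis using c by (simp add: pos_divide_le_eq mult.commute)
qed

lemma cylinder_kernel_nonneg:
  assumes c: "c > 0" "3 * c < 1" and "u \<ge> 0" "v \<ge> 0"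
  shows "cylinder_kernel c u v \<ge> 0"
proof -
  have "u + v \<le> (u + v) / (3 * c)" using c assms by (simp add: le_divide_eq mult_left_le)
  also have "\<dots> \<le> max (u / (2 * c)) (v / c)" by (rule cylinder_gauge_lower[OF c(1)])
  finally show ?thesis by (simp add: cylinder_kernel_def)
qed

lemma cylinder_kernel_bound:
  assumes c: "c > 0" "3 * c < 1" and t: "t \<ge> 0"
  shows "cylinder_kernel c 1 t \<le> (3 * c / (1 - 3 * c)) / (1 + t)"
proof -
  have "(1 / (3 * c) - 1) * (1 + t) = (1 + t) / (3 * c) - (1 + t)" by (simp add: left_diff_distrib)
  also have "\<dots> \<le> max (1 / (2 * c)) (t / c) - (1 + t)"
    using cylinder_gauge_lower[OF c(1), of 1 t] by linarith
  finally have le: "(1 / (3 * c) - 1) * (1 + t) \<le> max (1 / (2 * c)) (t / c) - (1 + t)" .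
  have pos: "(1 / (3 * c) - 1) * (1 + t) > 0" using c t by (intro mult_pos_pos) (auto simp: less_divide_eq)
  have "cylinder_kernel c 1 t \<le> 1 / ((1 / (3 * c) - 1) * (1 + t))"
    unfolding cylinder_kernel_def using le pos by (intro frac_le) simp_all
  also have "\<dots> = (3 * c / (1 - 3 * c)) / (1 + t)" using c by (simp add: divide_simps)
  finally show ?thesis .
qed

lemma cylinder_kernel_scale:
  assumes "u > 0"
  shows "cylinder_kernel c u (u * t) = cylinder_kernel c 1 t / u"
proof -
  have "max (u / (2 * c)) (u * t / c) = u * max (1 / (2 * c)) (t / c)"
    using assms by (simp add: max_mult_distrib_left)
  then have "max (u / (2 * c)) (u * t / c) - (u + u * t) = u * (max (1 / (2 * c)) (t / c) - (1 + t))"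
    by (simp add: algebra_simps)
  then show ?thesis using assms by (simp add: cylinder_kernel_def)
qed

text \<open>
  What remains of the \<open>j\<close>-th moment of the kernel, as a function of the ratio \<open>t = v / u\<close>, after the
  integration over \<open>u\<close>.
\<close>

definition slope_weight :: "nat \<Rightarrow> nat \<Rightarrow> real \<Rightarrow> real \<Rightarrow> real" where
  "slope_weight k j c t = cylinder_kernel c 1 t * t ^ (k - 1) * (fact (k - 1 + j) / (1 + t) ^ (k + j))"

lemma slope_weight_measurable [measurable]: "slope_weight k j c \<in> borel_measurable borel"
  unfolding slope_weight_def by measurable

text \<open>
  Substitute \<open>v = u t\<close>. The kernel is homogeneous of degree \<open>-1\<close> in \<open>(u, v)\<close>, so for fixed \<open>t\<close> the integral
  over \<open>u\<close> is a Gamma integral with rate \<open>1 + t\<close>.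
\<close>

lemma nn_integral_cylinder_moment:
  fixes \<eta> :: "complex ^ 'n::finite"
  assumes \<eta>: "norm \<eta> = 1" and N: "CARD('n) = k + 1" "k \<ge> 1" and c: "c > 0" "3 * c < 1"
  defines "u \<equiv> \<lambda>z. (cmod (cdot z \<eta>))\<^sup>2"
  shows "(\<integral>\<^sup>+z. ennreal (cylinder_kernel c (u z) ((norm z)\<^sup>2 - u z) * u z ^ j * exp (- (norm z)\<^sup>2)) \<partial>lborel) =
    ennreal (pi ^ (k + 1) / fact (k - 1)) * (\<integral>\<^sup>+t. ennreal (slope_weight k j c t) * indicator {0..} t \<partial>lborel)"
proof -
  let ?F = "\<lambda>u v. ennreal (cylinder_kernel c u v * u ^ j * exp (- (u + v)))"
  let ?C = "pi ^ (k + 1) / fact (k - 1)"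
  let ?G = "\<lambda>u t. ennreal (?C * (cylinder_kernel c 1 t * t ^ (k - 1))) * indicator {0..} t *
      (ennreal (u ^ (k - 1 + j) * exp (- (1 + t) * u)) * indicator {0..} u)"
  have [measurable]: "case_prod ?G \<in> borel_measurable (borel \<Otimes>\<^sub>M borel)" by measurable
  have "(\<integral>\<^sup>+z. ennreal (cylinder_kernel c (u z) ((norm z)\<^sup>2 - u z) * u z ^ j * exp (- (norm z)\<^sup>2)) \<partial>lborel) =
     (\<integral>\<^sup>+z. ?F ((cmod (cdot z \<eta>))\<^sup>2) ((norm z)\<^sup>2 - (cmod (cdot z \<eta>))\<^sup>2) \<partial>lborel)"
    by (simp add: u_def)
  also have "\<dots> = (\<integral>\<^sup>+u. ennreal (radial_density 1 u) * (\<integral>\<^sup>+v. ennreal (radial_density k v) * ?F u v \<partial>lborel) \<partial>lborel)"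
    by (rule nn_integral_complex_line_split_lborel[OF \<eta> N]) measurable
  also have "\<dots> = (\<integral>\<^sup>+u. \<integral>\<^sup>+t. ?G u t \<partial>lborel \<partial>lborel)"
  proof (rule nn_integral_cong_AE, use AE_lborel_singleton[of "0::real"] in eventually_elim)
    fix u :: real assume u0: "u \<noteq> 0"
    show "ennreal (radial_density 1 u) * (\<integral>\<^sup>+v. ennreal (radial_density k v) * ?F u v \<partial>lborel) = (\<integral>\<^sup>+t. ?G u t \<partial>lborel)"
    proof (cases "u > 0")
      case True
      have "(\<integral>\<^sup>+v. ennreal (radial_density k v) * ?F u v \<partial>lborel) =
        ennreal \<bar>u\<bar> * (\<integral>\<^sup>+t. ennreal (radial_density k (0 + u * t)) * ?F u (0 + u * t) \<partial>lborel)"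
        by (rule nn_integral_real_affine) (use u0 in auto)
      then have "ennreal (radial_density 1 u) * (\<integral>\<^sup>+v. ennreal (radial_density k v) * ?F u v \<partial>lborel) =
        ennreal (pi * u) * (\<integral>\<^sup>+t. ennreal (radial_density k (0 + u * t)) * ?F u (0 + u * t) \<partial>lborel)"
        using True by (simp add: radial_density_def ennreal_mult mult.assoc)
      also have "\<dots> = (\<integral>\<^sup>+t. ennreal (pi * u) * (ennreal (radial_density k (0 + u * t)) * ?F u (0 + u * t)) \<partial>lborel)"
        by (rule nn_integral_cmult[symmetric]) measurable
      also have "\<dots> = (\<integral>\<^sup>+t. ?G u t \<partial>lborel)"
      proof (rule nn_integral_cong)
        fix t :: real
        show "ennreal (pi * u) * (ennreal (radial_density k (0 + u * t)) * ?F u (0 + u * t)) = ?G u t"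
        proof (cases "t \<ge> 0")
          case t: True
          have g: "cylinder_kernel c 1 t \<ge> 0" by (rule cylinder_kernel_nonneg[OF c]) (use t in auto)
          have e: "exp (- (u + u * t)) = exp (- (1 + t) * u)" by (simp add: algebra_simps)
          have "pi * u * (pi ^ k / fact (k - 1) * (u * t) ^ (k - 1) * (cylinder_kernel c 1 t / u * u ^ j * exp (- (u + u * t)))) =
             ?C * (cylinder_kernel c 1 t * t ^ (k - 1)) * (u ^ (k - 1 + j) * exp (- (1 + t) * u))"
            unfolding e using True by (simp add: power_mult_distrib power_add field_simps)
          moreover have "?F u (0 + u * t) = ennreal (cylinder_kernel c 1 t / u * u ^ j * exp (- (u + u * t)))"
            using cylinder_kernel_scale[OF True, of c t] by simp
          ultimately show ?thesis
            using True t g by (simp add: radial_density_def ennreal_mult[symmetric])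
        next
          case False
          then show ?thesis using True by (simp add: radial_density_def zero_le_mult_iff)
        qed
      qed
      finally show ?thesis .
    next
      case False
      then show ?thesis using u0 by (simp add: radial_density_def)
    qed
  qed
  also have "\<dots> = (\<integral>\<^sup>+t. \<integral>\<^sup>+u. ?G u t \<partial>lborel \<partial>lborel)"
    by (rule lborel_pair.Fubini'[symmetric]) measurable
  also have "\<dots> = (\<integral>\<^sup>+t. ennreal ?C * (ennreal (slope_weight k j c t) * indicator {0..} t) \<partial>lborel)"
  proof (rule nn_integral_cong)
    fix t :: real
    show "(\<integral>\<^sup>+u. ?G u t \<partial>lborel) = ennreal ?C * (ennreal (slope_weight k j c t) * indicator {0..} t)"
    proof (cases "t \<ge> 0")
      case True
      have g: "cylinder_kernel c 1 t \<ge> 0" by (rule cylinder_kernel_nonneg[OF c]) (use True in auto)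
      have "(\<integral>\<^sup>+u. ?G u t \<partial>lborel) = ennreal (?C * (cylinder_kernel c 1 t * t ^ (k - 1))) * indicator {0..} t *
          ennreal (fact (k - 1 + j) / (1 + t) ^ (k - 1 + j + 1))"
        by (subst nn_integral_cmult, measurable, subst nn_integral_power_exp) (use True in auto)
      also have "k - 1 + j + 1 = k + j" using N by simp
      finally show ?thesis using True g
        by (simp add: slope_weight_def ennreal_mult[symmetric] mult.assoc)
    qed simp
  qed
  also have "\<dots> = ennreal ?C * (\<integral>\<^sup>+t. ennreal (slope_weight k j c t) * indicator {0..} t \<partial>lborel)"
    by (rule nn_integral_cmult) measurable
  finally show ?thesis .
qed

lemma slope_weight_nonneg:
  assumes "c > 0" "3 * c < 1" "t \<ge> 0"
  shows "slope_weight k j c t \<ge> 0"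
  unfolding slope_weight_def using cylinder_kernel_nonneg[OF assms(1,2), of 1 t] assms(3) by simp

lemma slope_weight_integral_finite:
  assumes k: "k \<ge> 1" and c: "c > 0" "3 * c < 1"
  shows "(\<integral>\<^sup>+t. ennreal (slope_weight k j c t) * indicator {0..} t \<partial>lborel) < \<infinity>"
proof -
  let ?C = "3 * c / (1 - 3 * c) * fact (k - 1 + j)"
  have C: "?C \<ge> 0" using c by simp
  have "(\<integral>\<^sup>+t. ennreal (slope_weight k j c t) * indicator {0..} t \<partial>lborel) \<le>
    (\<integral>\<^sup>+t. ennreal ?C * (ennreal (1 / (1 + 1 * t)\<^sup>2) * indicator {0..} t) \<partial>lborel)"
  proof (rule nn_integral_mono)
    fix t :: real
    show "ennreal (slope_weight k j c t) * indicator {0..} t \<le> ennreal ?C * (ennreal (1 / (1 + 1 * t)\<^sup>2) * indicator {0..} t)"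
    proof (cases "t \<ge> 0")
      case True
      have "t ^ (k - 1) \<le> (1 + t) ^ (k - 1)" using True by (intro power_mono) auto
      also have "\<dots> \<le> (1 + t) ^ (k + j - 1)" using True by (intro power_increasing) auto
      finally have tp: "t ^ (k - 1) \<le> (1 + t) ^ (k + j - 1)" .
      have "slope_weight k j c t \<le> (3 * c / (1 - 3 * c)) / (1 + t) * (1 + t) ^ (k + j - 1) * (fact (k - 1 + j) / (1 + t) ^ (k + j))"
        unfolding slope_weight_def using True c tp cylinder_kernel_bound[OF c True] cylinder_kernel_nonneg[OF c, of 1 t]
        by (intro mult_mono mult_nonneg_nonneg) auto
      also have "(1 + t) ^ (k + j) = (1 + t) ^ (k + j - 1) * (1 + t)" using k by (simp flip: power_Suc2)
      also have "(3 * c / (1 - 3 * c)) / (1 + t) * (1 + t) ^ (k + j - 1) * (fact (k - 1 + j) / ((1 + t) ^ (k + j - 1) * (1 + t))) =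
          ?C * (1 / (1 + t)\<^sup>2)"
        using True by (simp add: power2_eq_square)
      finally show ?thesis using True C by (simp add: ennreal_mult[symmetric] ennreal_leI del: times_divide_eq_right)
    qed simp
  qed
  also have "\<dots> = ennreal ?C * ennreal (1 / 1)"
    by (subst nn_integral_cmult) (auto simp only: nn_integral_inverse_square[OF zero_less_one], measurable)
  also have "\<dots> < \<infinity>" by (simp add: ennreal_mult_less_top)
  finally show ?thesis .
qed

text \<open>
  The difference of the weights for \<open>j = 0\<close> and \<open>j = 1\<close> has the sign of \<open>1 + t - k\<close>. It is positive only for
  \<open>t > k - 1 \<ge> 1\<close>, away from the edge at \<open>t = 1/2\<close>, where it is bounded independently of \<open>c\<close>. On
  \<open>[1/4, 1/2]\<close> it is at most \<open>- \<sigma> / (\<kappa> - t)\<close> up to the common factorial, which integrates to a logarithm that diverges as \<open>\<kappa>\<close>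
  tends to \<open>1/2\<close>, that is, as \<open>c\<close> tends to \<open>1/3\<close>.
\<close>

lemma slope_weight_inequality:
  assumes k: "k \<ge> 2" and c: "c > 0" "3 * c < 1"
    and le: "(\<integral>\<^sup>+t. ennreal (slope_weight k 1 c t) * indicator {0..} t \<partial>lborel) \<le>
      (\<integral>\<^sup>+t. ennreal (slope_weight k 0 c t) * indicator {0..} t \<partial>lborel)"
  defines "\<kappa> \<equiv> 1 / (2 * c) - 1"
  defines "\<sigma> \<equiv> (1/4) ^ (k - 1) * (1/2) / (3/2) ^ (k + 1)"
  shows "\<sigma> * (ln (\<kappa> - 1/4) - ln (\<kappa> - 1/2)) \<le> 1"
proof -
  let ?W = "\<lambda>j t. ennreal (slope_weight k j c t) * indicator {0..} t"
  let ?f = "fact (k - 1) :: real"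
  let ?s = "\<lambda>t. ennreal (?f * \<sigma>) * (ennreal (1 / (\<kappa> - t)) * indicator {1/4..1/2} t)"
  let ?r = "\<lambda>t. ennreal ?f * (ennreal (1 / (1 + 1 * t)\<^sup>2) * indicator {0..} t)"
  have \<sigma>: "\<sigma> \<ge> 0" by (simp add: \<sigma>_def)
  have \<kappa>: "\<kappa> > 1/2" using c by (simp add: \<kappa>_def field_simps)
  have k1: "k \<ge> 1" using k by simp
  have fk: "fact k = real k * ?f" using fact_reduce[of k, where 'a = real] k by simp
  have diff: "slope_weight k 0 c t - slope_weight k 1 c t =
     ?f * (cylinder_kernel c 1 t * t ^ (k - 1) * (1 + t - real k) / (1 + t) ^ (k + 1))" if "t \<ge> 0" for t
  proof -
    have t: "1 + t > 0" using that by simp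
    have "fact (k - 1 + 1) = real k * ?f" using fk k by simp
    moreover have "?f / (1 + t) ^ k = ?f * (1 + t) / (1 + t) ^ (k + 1)" using t by simp
    ultimately show ?thesis using t unfolding slope_weight_def
      by (simp add: algebra_simps diff_divide_distrib add_divide_distrib)
  qed
  \<comment> \<open>The gain \<open>?s\<close> lives near the edge, the loss \<open>?r\<close> where \<open>t > k - 1\<close>.\<close>
  have pw: "?W 0 t + ?s t \<le> ?W 1 t + ?r t" for t
  proof (cases "t \<ge> 0")
    case True
    have w: "slope_weight k 0 c t \<ge> 0" "slope_weight k 1 c t \<ge> 0" using slope_weight_nonneg[OF c True] by auto
    have g: "cylinder_kernel c 1 t \<ge> 0" by (rule cylinder_kernel_nonneg[OF c]) (use True in auto)
    consider "t \<in> {1/4..1/2}" | "t \<notin> {1/4..1/2}" "t \<le> real k - 1" | "t > real k - 1" by linarith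
    then show ?thesis
    proof cases
      case 1
      have "t / c \<le> 1 / (2 * c)" using 1 c by (simp add: field_simps)
      then have gt: "cylinder_kernel c 1 t = 1 / (\<kappa> - t)"
        by (simp add: cylinder_kernel_def \<kappa>_def max_def algebra_simps)
      have "\<sigma> \<le> t ^ (k - 1) * (real k - 1 - t) / (1 + t) ^ (k + 1)"
        unfolding \<sigma>_def using 1 k True
        by (intro frac_le mult_mono power_mono mult_nonneg_nonneg) auto
      then have "?f * cylinder_kernel c 1 t * \<sigma> \<le>
          ?f * cylinder_kernel c 1 t * (t ^ (k - 1) * (real k - 1 - t) / (1 + t) ^ (k + 1))"
        using g by (intro mult_left_mono) auto
      also have "\<dots> = - (?f * (cylinder_kernel c 1 t * t ^ (k - 1) * (1 + t - real k) / (1 + t) ^ (k + 1)))"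
      proof -
        have "real k - 1 - t = - (1 + t - real k)" by simp
        then show ?thesis by (simp only: mult_minus_right minus_divide_left[symmetric] mult.assoc times_divide_eq_right)
      qed
      also have "\<dots> = slope_weight k 1 c t - slope_weight k 0 c t"
        unfolding diff[OF True, symmetric] by simp
      finally have "slope_weight k 0 c t + ?f * \<sigma> * (1 / (\<kappa> - t)) \<le> slope_weight k 1 c t"
        by (simp add: gt mult_ac)
      then have "ennreal (slope_weight k 0 c t) + ennreal (?f * \<sigma>) * ennreal (1 / (\<kappa> - t)) \<le> ennreal (slope_weight k 1 c t)"
        using w \<sigma> 1 \<kappa> by (simp add: ennreal_mult[symmetric] ennreal_plus[symmetric] ennreal_leI del: ennreal_plus times_divide_eq_right)
      then show ?thesis using 1 True by (simp add: add_increasing2)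
    next
      case 2
      have "slope_weight k 0 c t - slope_weight k 1 c t \<le> 0"
        unfolding diff[OF True] using 2 g True by (intro mult_nonneg_nonpos divide_nonpos_nonneg) (auto intro!: mult_nonneg_nonpos)
      then have "ennreal (slope_weight k 0 c t) \<le> ennreal (slope_weight k 1 c t)" by (intro ennreal_leI) simp
      then show ?thesis using 2 True by (simp add: add_increasing2)
    next
      case 3
      then have t1: "t > 1" using k by simp
      have mx: "t \<le> max (1 / (2 * c)) (t / c) - (1 + t)"
      proof -
        have "3 * t \<le> t / c" using c t1 by (simp add: le_divide_eq)
        also have "\<dots> \<le> max (1 / (2 * c)) (t / c)" by simp
        finally show ?thesis using t1 by linarith
      qed
      have gt: "cylinder_kernel c 1 t \<le> 1 / t"
        unfolding cylinder_kernel_def using mx t1 by (intro divide_left_mono mult_pos_pos) auto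
      have "cylinder_kernel c 1 t * t ^ (k - 1) * (1 + t - real k) / (1 + t) ^ (k + 1) \<le>
         1 / t * (1 + t) ^ (k - 1) * t / (1 + t) ^ (k + 1)"
        using gt g t1 3 k by (intro divide_right_mono mult_mono power_mono mult_nonneg_nonneg) auto
      also have "1 / t * (1 + t) ^ (k - 1) * t / (1 + t) ^ (k + 1) = 1 / (1 + t)\<^sup>2"
      proof -
        have "(1 + t) ^ (k + 1) = (1 + t) ^ (k - 1) * (1 + t)\<^sup>2" using k by (simp flip: power_add)
        then show ?thesis using t1 by simp
      qed
      finally have "slope_weight k 0 c t - slope_weight k 1 c t \<le> ?f * (1 / (1 + t)\<^sup>2)"
        unfolding diff[OF True] by (intro mult_left_mono) auto
      then have "ennreal (slope_weight k 0 c t) \<le> ennreal (slope_weight k 1 c t + ?f * (1 / (1 + t)\<^sup>2))"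
        by (intro ennreal_leI) simp
      also have "\<dots> = ennreal (slope_weight k 1 c t) + ennreal ?f * ennreal (1 / (1 + t)\<^sup>2)"
        using w by (simp add: ennreal_mult[symmetric] del: times_divide_eq_right)
      finally show ?thesis using 3 t1 k by (simp del: times_divide_eq_right)
    qed
  qed (simp add: indicator_def)
  let ?I = "\<lambda>f. \<integral>\<^sup>+t. f t \<partial>lborel"
  have "?I (?W 1) + ?I ?s \<le> ?I (?W 0) + ?I ?s" using le by (rule add_right_mono)
  also have "\<dots> = ?I (\<lambda>t. ?W 0 t + ?s t)" by (rule nn_integral_add[symmetric]) measurable
  also have "\<dots> \<le> ?I (\<lambda>t. ?W 1 t + ?r t)" by (rule nn_integral_mono) (rule pw)
  also have "\<dots> = ?I (?W 1) + ?I ?r" by (rule nn_integral_add) measurable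
  finally have "?I ?s \<le> ?I ?r"
    using slope_weight_integral_finite[OF k1 c, of 1] by (auto simp: ennreal_add_left_cancel_le)
  also have "?I ?r = ennreal ?f * ennreal (1 / 1)"
    by (subst nn_integral_cmult) (auto simp only: nn_integral_inverse_square[OF zero_less_one], measurable)
  also have "?I ?s = ennreal (?f * \<sigma>) * ennreal ((- ln (\<kappa> - 1/2)) - (- ln (\<kappa> - 1/4)))"
  proof (subst nn_integral_cmult, measurable, subst nn_integral_FTC_Icc)
    show "DERIV (\<lambda>t. - ln (\<kappa> - t)) t :> 1 / (\<kappa> - t)" if "t \<in> {1/4..1/2}" for t
      using that \<kappa> by (auto intro!: derivative_eq_intros)
  qed (use \<kappa> in auto)
  finally have "ennreal (?f * \<sigma> * (ln (\<kappa> - 1/4) - ln (\<kappa> - 1/2))) \<le> ennreal ?f"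
    using \<sigma> by (simp add: ennreal_mult')
  then have "?f * (\<sigma> * (ln (\<kappa> - 1/4) - ln (\<kappa> - 1/2))) \<le> ?f * 1"
    by (simp add: ennreal_le_iff mult.assoc)
  then show ?thesis by (simp only: mult_le_cancel_left_pos[OF fact_gt_zero])
qed

text \<open>
  Positive definiteness tested on the autocorrelation of \<open>\<langle>z, \<eta>\<rangle> exp (- 2 |z|\<^sup>2)\<close>, which is a positive
  multiple of \<open>(1 - u) exp (- |z|\<^sup>2)\<close>: the first moment in \<open>u\<close> is at most the zeroth.
\<close>

lemma cylinder_positive_definite_imp:
  fixes \<eta> :: "complex ^ 'n::finite"
  assumes \<eta>: "norm \<eta> = 1" and N: "CARD('n) = k + 1" "k \<ge> 1" and c: "c > 0" "3 * c < 1"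
    and pd: "positive_definite_distribution (regular_distribution
      (\<lambda>x. cylinder_kernel c ((cmod (cdot x \<eta>))\<^sup>2) ((norm x)\<^sup>2 - (cmod (cdot x \<eta>))\<^sup>2)))"
  shows "(\<integral>\<^sup>+t. ennreal (slope_weight k 1 c t) * indicator {0..} t \<partial>lborel) \<le>
      (\<integral>\<^sup>+t. ennreal (slope_weight k 0 c t) * indicator {0..} t \<partial>lborel)"
proof -
  define u where "u = (\<lambda>z. (cmod (cdot z \<eta>))\<^sup>2)"
  define f where "f = (\<lambda>z. cylinder_kernel c (u z) ((norm z)\<^sup>2 - u z))"
  have [measurable]: "u \<in> borel_measurable borel" unfolding u_def by measurable
  have [measurable]: "f \<in> borel_measurable borel" unfolding f_def by measurable
  have f0: "f z \<ge> 0" for z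
    unfolding f_def by (rule cylinder_kernel_nonneg[OF c]) (use cmod_cdot_le[OF \<eta>, of z] in \<open>auto simp: u_def\<close>)
  let ?\<phi> = "\<lambda>z. cdot z \<eta> * gaussian 2 z"
  obtain C where C: "C > 0" "\<And>x. convolution ?\<phi> (\<lambda>x. cnj (?\<phi> (- x))) x = of_real (C * (1 - u x) * exp (- (norm x)\<^sup>2))"
    using autocorrelation_linear_gaussian[OF \<eta>] N unfolding u_def by auto
  have "schwartz_function ?\<phi>"
    by (rule schwartz_poly_gaussian[OF poly_fun.linear[OF bounded_linear_cdot]]) simp
  then have nn: "regular_distribution f (convolution ?\<phi> (\<lambda>x. cnj (?\<phi> (- x)))) \<in> \<real>\<^sub>\<ge>\<^sub>0"
    using pd unfolding positive_definite_distribution_def f_def u_def by blast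
  define W where "W j = (\<integral>\<^sup>+t. ennreal (slope_weight k j c t) * indicator {0..} t \<partial>lborel)" for j
  define A where "A = pi ^ (k + 1) / (fact (k - 1) :: real)"
  have A: "A > 0" by (simp add: A_def)
  have Wfin: "W j < \<infinity>" for j unfolding W_def by (rule slope_weight_integral_finite[OF N(2) c])
  have mom: "(\<integral>\<^sup>+z. ennreal (f z * u z ^ j * exp (- (norm z)\<^sup>2)) \<partial>lborel) = ennreal A * W j" for j
    unfolding f_def u_def W_def A_def by (rule nn_integral_cylinder_moment[OF \<eta> N c])
  have bnn: "0 \<le> f z * u z ^ j * exp (- (norm z)\<^sup>2)" for z j using f0 by (simp add: u_def)
  have int: "integrable lborel (\<lambda>z. f z * u z ^ j * exp (- (norm z)\<^sup>2))" for j
  proof (rule integrableI_nonneg)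
    show "(\<integral>\<^sup>+z. ennreal (f z * u z ^ j * exp (- (norm z)\<^sup>2)) \<partial>lborel) < \<infinity>"
      unfolding mom using Wfin by (simp add: ennreal_mult_less_top)
  qed (use bnn in auto)
  have val: "(LINT z|lborel. f z * u z ^ j * exp (- (norm z)\<^sup>2)) = A * enn2real (W j)" for j
    using A by (subst integral_eq_nn_integral) (auto simp: bnn mom enn2real_mult)
  have "regular_distribution f (convolution ?\<phi> (\<lambda>x. cnj (?\<phi> (- x)))) =
     (LINT z|lborel. complex_of_real (C * (f z * u z ^ 0 * exp (- (norm z)\<^sup>2) - f z * u z ^ 1 * exp (- (norm z)\<^sup>2))))"
    unfolding regular_distribution_def C(2)
    by (intro Bochner_Integration.integral_cong refl) (simp add: algebra_simps)
  also have "\<dots> = of_real (C * (A * enn2real (W 0) - A * enn2real (W 1)))"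
    unfolding integral_complex_of_real integral_mult_right_zero Bochner_Integration.integral_diff[OF int int] val ..
  finally have "0 \<le> C * (A * enn2real (W 0) - A * enn2real (W 1))"
    using nn by (simp add: nonneg_Reals_of_real_iff del: of_real_mult of_real_diff)
  then have "A * enn2real (W 1) \<le> A * enn2real (W 0)" using C(1) by (simp add: zero_le_mult_iff)
  then have "enn2real (W 1) \<le> enn2real (W 0)" using A by simp
  then have "W 1 \<le> W 0" using Wfin[of 0] Wfin[of 1]
    by (metis ennreal_enn2real ennreal_leI infinity_ennreal_def)
  then show ?thesis by (simp add: W_def)
qed

lemma cylinder_not_positive_definite:
  fixes \<eta> :: "complex ^ 'n::finite"
  assumes \<eta>: "norm \<eta> = 1" and N: "CARD('n) = k + 1" and k: "k \<ge> 2"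
  obtains c where "c > 0" "3 * c < 1"
    "\<not> positive_definite_distribution (regular_distribution
        (\<lambda>x. minkowski_functional (cylinder \<eta> c) x powi (-2) /
             (1 - (norm x / minkowski_functional (cylinder \<eta> c) x)\<^sup>2)))"
proof -
  define \<sigma> :: real where "\<sigma> = (1/4) ^ (k - 1) * (1/2) / (3/2) ^ (k + 1)"
  have \<sigma>: "\<sigma> > 0" by (simp add: \<sigma>_def)
  \<comment> \<open>Chosen so that \<open>ln (1 / (4 * \<epsilon>))\<close> exceeds \<open>1 / \<sigma>\<close>.\<close>
  define \<epsilon> where "\<epsilon> = exp (- (2 / \<sigma>)) / 4"
  have \<epsilon>: "\<epsilon> > 0" by (simp add: \<epsilon>_def)
  define c where "c = 1 / (3 + 2 * \<epsilon>)"
  have c: "c > 0" "3 * c < 1" using \<epsilon> by (auto simp: c_def field_simps)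
  have \<kappa>: "1 / (2 * c) - 1 = 1/2 + \<epsilon>" using \<epsilon> by (simp add: c_def field_simps)
  have "ln \<epsilon> = - (2 / \<sigma>) - ln 4" by (simp add: \<epsilon>_def ln_div)
  moreover have "ln (1/4 + \<epsilon>) \<ge> ln (1/4)" using \<epsilon> by simp
  moreover have "ln (1/4) = - ln (4::real)" by (simp add: ln_div)
  ultimately have "2 / \<sigma> \<le> ln (1/4 + \<epsilon>) - ln \<epsilon>" by linarith
  then have "\<sigma> * (2 / \<sigma>) \<le> \<sigma> * (ln (1/4 + \<epsilon>) - ln \<epsilon>)" using \<sigma> by (intro mult_left_mono) auto
  then have gt: "\<sigma> * (ln (1/4 + \<epsilon>) - ln \<epsilon>) > 1" using \<sigma> by simp
  show ?thesis
  proof (rule that[OF c])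
    have ker: "(\<lambda>x. minkowski_functional (cylinder \<eta> c) x powi (-2) /
             (1 - (norm x / minkowski_functional (cylinder \<eta> c) x)\<^sup>2)) =
        (\<lambda>x. cylinder_kernel c ((cmod (cdot x \<eta>))\<^sup>2) ((norm x)\<^sup>2 - (cmod (cdot x \<eta>))\<^sup>2))"
      unfolding minkowski_distribution_eq[OF cylinder_convex_body[OF \<eta> c(1)] cylinder_subset_ball[OF c(2)]]
        minkowski_functional_cylinder[OF \<eta> c(1)] cylinder_kernel_def by simp
    show "\<not> positive_definite_distribution (regular_distribution
        (\<lambda>x. minkowski_functional (cylinder \<eta> c) x powi (-2) /
             (1 - (norm x / minkowski_functional (cylinder \<eta> c) x)\<^sup>2)))"
      unfolding ker
    proof
      assume pd: "positive_definite_distribution (regular_distribution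
        (\<lambda>x. cylinder_kernel c ((cmod (cdot x \<eta>))\<^sup>2) ((norm x)\<^sup>2 - (cmod (cdot x \<eta>))\<^sup>2)))"
      have "\<sigma> * (ln (1 / (2 * c) - 1 - 1/4) - ln (1 / (2 * c) - 1 - 1/2)) \<le> 1"
        unfolding \<sigma>_def
        by (rule slope_weight_inequality[OF k c cylinder_positive_definite_imp[OF \<eta> N _ c pd]]) (use k in simp)
      then show False using gt by (simp add: \<kappa>)
    qed
  qed
qed

section \<open>A cylinder and a ball that violate the volume comparison\<close>

text \<open>
  On the hyperplane, \<open>\<langle>z, \<eta>\<rangle>\<close> equals \<open>\<langle>z, p\<rangle>\<close> for the projection \<open>p\<close> of \<open>\<eta>\<close>; take \<open>\<tau> = |p|\<^sup>2\<close> and \<open>\<zeta> = p / |p|\<close>.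
  If \<open>p = 0\<close>, any unit vector of the hyperplane serves, with \<open>\<tau> = 0\<close>.
\<close>

lemma hyperplane_direction:
  fixes \<xi> \<eta> :: "complex ^ 'n::finite"
  assumes \<xi>: "norm \<xi> = 1" and \<eta>: "norm \<eta> = 1" and N: "CARD('n) \<ge> 2"
  obtains \<zeta> \<tau> where "\<zeta> \<in> complex_hyperplane \<xi>" "norm \<zeta> = 1" "0 \<le> \<tau>" "\<tau> \<le> 1"
    "\<And>z. z \<in> complex_hyperplane \<xi> \<Longrightarrow> (cmod (cdot z \<eta>))\<^sup>2 = \<tau> * (cmod (cdot z \<zeta>))\<^sup>2"
proof -
  define p where "p = \<eta> - cdot \<eta> \<xi> *s \<xi>"
  have pH: "p \<in> complex_hyperplane \<xi>"
    by (simp add: complex_hyperplane_cdot p_def cdot_diff_left cdot_smult_left cdot_self \<xi>)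
  have np: "(norm p)\<^sup>2 \<le> 1"
    unfolding p_def norm_diff_projection[OF \<xi>] by (simp add: \<eta>)
  have cp: "cdot z \<eta> = cdot z p" if "z \<in> complex_hyperplane \<xi>" for z
  proof -
    have "cdot z \<xi> = 0" using that by (simp add: complex_hyperplane_cdot)
    then have "cdot \<xi> z = 0" by (subst cdot_commute) simp
    then have "cdot p z = cdot \<eta> z" by (simp add: p_def cdot_diff_left cdot_smult_left)
    then show ?thesis by (metis cdot_commute)
  qed
  show ?thesis
  proof (cases "p = 0")
    case False
    define \<zeta> where "\<zeta> = (1 / norm p) *\<^sub>R p"
    have "norm \<zeta> = 1" using False by (simp add: \<zeta>_def)
    moreover have "\<zeta> \<in> complex_hyperplane \<xi>"
      unfolding \<zeta>_def by (rule subspace_scale[OF subspace_complex_hyperplane pH])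
    moreover have "(cmod (cdot z \<eta>))\<^sup>2 = (norm p)\<^sup>2 * (cmod (cdot z \<zeta>))\<^sup>2" if "z \<in> complex_hyperplane \<xi>" for z
      unfolding cp[OF that] using False
      by (simp add: \<zeta>_def scaleR_eq_smult cdot_smult_right norm_mult norm_divide power_mult_distrib power_divide)
    ultimately show ?thesis using that[of \<zeta> "(norm p)\<^sup>2"] np by simp
  next
    case True
    have "\<xi> \<noteq> 0" using \<xi> by auto
    then have "dim (complex_hyperplane \<xi>) > 0" using dim_complex_hyperplane[of \<xi>] N by simp
    then obtain y where y: "y \<in> complex_hyperplane \<xi>" "y \<noteq> 0"
      by (metis dim_eq_0 less_irrefl subsetI insertI1 singletonI)
    have "(1 / norm y) *\<^sub>R y \<in> complex_hyperplane \<xi>"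
      by (rule subspace_scale[OF subspace_complex_hyperplane y(1)])
    moreover have "cdot z p = 0" for z by (subst cdot_commute) (simp add: True)
    ultimately show ?thesis using that[of "(1 / norm y) *\<^sub>R y" 0] y cp by simp
  qed
qed

text \<open>
  Here \<open>A\<close> and \<open>v\<close> are the squared lengths of the components of a point of the section along and across
  \<open>\<zeta>\<close>. The cylinder allows \<open>v\<close> up to \<open>c - (1 - \<tau>) A\<close>, where \<open>1 - A - v\<close> equals \<open>1 - c - \<tau> A\<close>; integrating
  over \<open>v\<close> lowers the exponent of the singularity by one.
\<close>

lemma section_inner_bound:
  fixes A c \<tau> :: real
  assumes k: "k \<ge> 2" and c: "c > 0" "3 * c < 1" and A: "A \<ge> 0"
    and A1: "\<tau> * A \<le> 2 * c" and A2: "(1 - \<tau>) * A \<le> c"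
  shows "(\<integral>\<^sup>+v. ennreal (radial_density (k - 1) v) *
      (if (1 - \<tau>) * A + v \<le> c then ennreal (1 / (1 - A - v) ^ (k + 1)) else 0) \<partial>lborel) \<le>
    ennreal (pi ^ (k - 1) / (1 - c - \<tau> * A) ^ k)"
proof -
  define b where "b = c - (1 - \<tau>) * A"
  have b: "b \<ge> 0" using A2 by (simp add: b_def)
  have Ab: "1 - A - b = 1 - c - \<tau> * A" by (simp add: b_def algebra_simps)
  have pos: "1 - A - b > 0" using A1 c by (simp add: Ab)
  have b1: "b \<le> 1" using A pos by linarith
  have "(\<integral>\<^sup>+v. ennreal (radial_density (k - 1) v) *
      (if (1 - \<tau>) * A + v \<le> c then ennreal (1 / (1 - A - v) ^ (k + 1)) else 0) \<partial>lborel) \<le>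
    (\<integral>\<^sup>+v. ennreal (pi ^ (k - 1) * (real k / (1 - A - v) ^ (k + 1))) * indicator {0..b} v \<partial>lborel)"
  proof (rule nn_integral_mono)
    fix v :: real
    show "ennreal (radial_density (k - 1) v) *
      (if (1 - \<tau>) * A + v \<le> c then ennreal (1 / (1 - A - v) ^ (k + 1)) else 0) \<le>
      ennreal (pi ^ (k - 1) * (real k / (1 - A - v) ^ (k + 1))) * indicator {0..b} v"
    proof (cases "v \<in> {0..b}")
      case True
      have p: "1 - A - v > 0" using True pos by auto
      have "v ^ (k - 1 - 1) \<le> 1" using True b1 by (intro power_le_one) auto
      then have "v ^ (k - 1 - 1) / fact (k - 1 - 1) \<le> 1 / 1" using True by (intro frac_le) auto
      then have "pi ^ (k - 1) * (v ^ (k - 1 - 1) / fact (k - 1 - 1)) * (1 / (1 - A - v) ^ (k + 1)) \<le>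
         pi ^ (k - 1) * 1 * (real k / (1 - A - v) ^ (k + 1))"
        using p k True by (intro mult_mono mult_left_mono divide_right_mono) auto
      then show ?thesis using True p by (auto simp: radial_density_def ennreal_mult[symmetric] intro!: ennreal_leI)
    next
      case False
      then have "v < 0 \<or> \<not> (1 - \<tau>) * A + v \<le> c" by (auto simp: b_def)
      then show ?thesis by (auto simp: radial_density_def)
    qed
  qed
  also have "\<dots> = ennreal (pi ^ (k - 1) * (1 / (1 - A - b) ^ k) - pi ^ (k - 1) * (1 / (1 - A - 0) ^ k))"
  proof (rule nn_integral_FTC_Icc)
    fix v assume v: "v \<in> {0..b}"
    have p: "1 - A - v > 0" using v pos by auto
    show "0 \<le> pi ^ (k - 1) * (real k / (1 - A - v) ^ (k + 1))" using p by simp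
    obtain j where j: "k = Suc j" using k by (cases k) auto
    have "((\<lambda>v. inverse (1 - A - v)) has_real_derivative inverse (1 - A - v) * inverse (1 - A - v)) (at v)"
      using p by (auto intro!: derivative_eq_intros)
    from DERIV_cmult[OF DERIV_power[OF this, of k], of "pi ^ (k - 1)"]
    show "((\<lambda>v. pi ^ (k - 1) * (1 / (1 - A - v) ^ k)) has_real_derivative
       pi ^ (k - 1) * (real k / (1 - A - v) ^ (k + 1))) (at v)"
      by (simp add: j divide_inverse power_inverse mult_ac)
  qed (use b in auto)
  also have "\<dots> \<le> ennreal (pi ^ (k - 1) / (1 - c - \<tau> * A) ^ k)"
    unfolding Ab using b pos by (intro ennreal_leI) simp
  finally show ?thesis .
qed

text \<open>
  If \<open>\<tau> \<ge> 1/3\<close>, integrating over \<open>A\<close> lowers the exponent by one more, at the cost of a factor \<open>1 / \<tau>\<close>. If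
  \<open>\<tau> < 1/3\<close>, then \<open>\<tau> A \<le> 1/3\<close>, because \<open>A \<le> 1\<close> in the unit ball, and the integrand is bounded.
\<close>

lemma section_outer_bound:
  fixes c \<tau> :: real
  assumes k: "k \<ge> 2" and c: "c > 0" "3 * c < 1" and \<tau>: "0 \<le> \<tau>" "\<tau> \<le> 1"
  shows "(\<integral>\<^sup>+A. ennreal (radial_density 1 A) *
      (if \<tau> * A \<le> 2 * c \<and> (1 - \<tau>) * A \<le> c then ennreal (pi ^ (k - 1) / (1 - c - \<tau> * A) ^ k) else 0) \<partial>lborel) \<le>
    ennreal ((3 * pi) ^ k / (1 - 3 * c) ^ (k - 1))" (is "?I \<le> _")
proof -
  have pik: "pi * pi ^ (k - Suc 0) = pi ^ k" using k by (simp flip: power_Suc)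
  have e: "0 < 1 - 3 * c" "1 - 3 * c \<le> 1" using c by auto
  show ?thesis
  proof (cases "\<tau> \<ge> 1/3")
    case True
    have \<tau>p: "\<tau> > 0" using True by simp
    have "?I \<le> (\<integral>\<^sup>+A. ennreal (pi ^ k / (1 - c - \<tau> * A) ^ k) * indicator {0..2 * c / \<tau>} A \<partial>lborel)"
    proof (rule nn_integral_mono)
      fix A :: real
      show "ennreal (radial_density 1 A) *
        (if \<tau> * A \<le> 2 * c \<and> (1 - \<tau>) * A \<le> c then ennreal (pi ^ (k - 1) / (1 - c - \<tau> * A) ^ k) else 0) \<le>
        ennreal (pi ^ k / (1 - c - \<tau> * A) ^ k) * indicator {0..2 * c / \<tau>} A"
      proof (cases "A \<ge> 0 \<and> \<tau> * A \<le> 2 * c \<and> (1 - \<tau>) * A \<le> c")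
        case A: True
        then have "0 < 1 - c - \<tau> * A" using c by linarith
        moreover have "A \<le> 2 * c / \<tau>" using A \<tau>p by (simp add: le_divide_eq mult.commute)
        ultimately show ?thesis using A
          by (simp add: radial_density_def ennreal_mult[symmetric] pik)
      qed (auto simp: radial_density_def)
    qed
    also have "\<dots> = ennreal (pi ^ k / (\<tau> * real (k - 1)) * (1 / (1 - c - \<tau> * (2 * c / \<tau>)) ^ (k - 1)) -
        pi ^ k / (\<tau> * real (k - 1)) * (1 / (1 - c - \<tau> * 0) ^ (k - 1)))"
    proof (rule nn_integral_FTC_Icc)
      fix A assume A: "A \<in> {0..2 * c / \<tau>}"
      then have "\<tau> * A \<le> 2 * c" using \<tau>p by (simp add: le_divide_eq mult.commute)
      then have p: "1 - c - \<tau> * A > 0" using c by linarith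
      show "0 \<le> pi ^ k / (1 - c - \<tau> * A) ^ k" using p by simp
      obtain j where j: "k = Suc (Suc j)" using k by (metis One_nat_def Suc_1 Suc_le_D le_Suc_eq)
      have "((\<lambda>A. inverse (1 - c - \<tau> * A)) has_real_derivative inverse (1 - c - \<tau> * A) * \<tau> * inverse (1 - c - \<tau> * A)) (at A)"
        using p by (auto intro!: derivative_eq_intros)
      then have d: "((\<lambda>A. pi ^ k / (\<tau> * real (k - 1)) * inverse (1 - c - \<tau> * A) ^ (k - 1)) has_real_derivative
          pi ^ k / (\<tau> * real (k - 1)) * (real (k - 1) * (inverse (1 - c - \<tau> * A) * \<tau> * inverse (1 - c - \<tau> * A) *
          inverse (1 - c - \<tau> * A) ^ (k - 1 - Suc 0)))) (at A)"
        by (rule DERIV_cmult[OF DERIV_power])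
      have 1: "inverse (1 - c - \<tau> * A) * \<tau> * inverse (1 - c - \<tau> * A) * inverse (1 - c - \<tau> * A) ^ (k - 1 - Suc 0) =
          \<tau> * inverse ((1 - c - \<tau> * A) ^ k)" by (simp add: j power_inverse mult_ac)
      have "a / (\<tau> * r) * (r * (\<tau> * inverse X)) = a / X" if "r \<noteq> 0" for a r X :: real
        using \<tau>p that by (simp add: divide_simps)
      moreover have "real (k - 1) \<noteq> 0" using k by simp
      ultimately have 2: "pi ^ k / (\<tau> * real (k - 1)) * (real (k - 1) * (\<tau> * inverse X)) = pi ^ k / X" for X
        by blast
      from d show "((\<lambda>A. pi ^ k / (\<tau> * real (k - 1)) * (1 / (1 - c - \<tau> * A) ^ (k - 1))) has_real_derivative
         pi ^ k / (1 - c - \<tau> * A) ^ k) (at A)"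
        unfolding 1 2 by (simp only: inverse_eq_divide power_one_over)
    qed (use \<tau>p c in auto)
    also have "\<dots> \<le> ennreal ((3 * pi) ^ k / (1 - 3 * c) ^ (k - 1))"
    proof (rule ennreal_leI)
      have "pi ^ k / (\<tau> * real (k - 1)) \<le> pi ^ k / (1/3 * 1)"
        using True k by (intro divide_left_mono mult_mono mult_pos_pos) auto
      also have "\<dots> = 3 ^ 1 * pi ^ k" by simp
      also have "\<dots> \<le> 3 ^ k * pi ^ k" using k by (intro mult_right_mono power_increasing) auto
      finally have 1: "pi ^ k / (\<tau> * real (k - 1)) \<le> (3 * pi) ^ k" by (simp add: power_mult_distrib)
      have 2: "1 - c - \<tau> * (2 * c / \<tau>) = 1 - 3 * c" using \<tau>p by simp
      have "0 \<le> pi ^ k / (\<tau> * real (k - 1)) * (1 / (1 - c - \<tau> * 0) ^ (k - 1))" using \<tau>p c by simp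
      then have "pi ^ k / (\<tau> * real (k - 1)) * (1 / (1 - c - \<tau> * (2 * c / \<tau>)) ^ (k - 1)) -
          pi ^ k / (\<tau> * real (k - 1)) * (1 / (1 - c - \<tau> * 0) ^ (k - 1)) \<le>
          pi ^ k / (\<tau> * real (k - 1)) * (1 / (1 - 3 * c) ^ (k - 1))" unfolding 2 by simp
      also have "\<dots> \<le> (3 * pi) ^ k * (1 / (1 - 3 * c) ^ (k - 1))"
        using 1 e by (intro mult_right_mono) auto
      finally show "pi ^ k / (\<tau> * real (k - 1)) * (1 / (1 - c - \<tau> * (2 * c / \<tau>)) ^ (k - 1)) -
          pi ^ k / (\<tau> * real (k - 1)) * (1 / (1 - c - \<tau> * 0) ^ (k - 1)) \<le> (3 * pi) ^ k / (1 - 3 * c) ^ (k - 1)" by simp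
    qed
    finally show ?thesis .
  next
    case False
    have "?I \<le> (\<integral>\<^sup>+A. ennreal ((3 * pi) ^ k) * indicator {0..1} (A :: real) \<partial>lborel)"
    proof (rule nn_integral_mono)
      fix A :: real
      show "ennreal (radial_density 1 A) *
        (if \<tau> * A \<le> 2 * c \<and> (1 - \<tau>) * A \<le> c then ennreal (pi ^ (k - 1) / (1 - c - \<tau> * A) ^ k) else 0) \<le>
        ennreal ((3 * pi) ^ k) * indicator {0..1} A"
      proof (cases "A \<ge> 0 \<and> \<tau> * A \<le> 2 * c \<and> (1 - \<tau>) * A \<le> c")
        case A: True
        have "A = \<tau> * A + (1 - \<tau>) * A" by (simp add: algebra_simps)
        then have A1: "A \<le> 1" using A c by linarith
        have "\<tau> * A \<le> 1/3 * 1" using False A A1 \<tau> by (intro mult_mono) auto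
        then have p: "1/3 \<le> 1 - c - \<tau> * A" using c by linarith
        have "(1/3) ^ k \<le> (1 - c - \<tau> * A) ^ k" using p by (intro power_mono) auto
        then have "pi ^ k / (1 - c - \<tau> * A) ^ k \<le> pi ^ k / (1/3) ^ k"
          using p by (intro divide_left_mono mult_pos_pos) auto
        also have "\<dots> = (3 * pi) ^ k" by (simp add: power_mult_distrib power_divide)
        finally show ?thesis using A A1 p
          by (simp add: radial_density_def ennreal_mult[symmetric] pik ennreal_leI)
      qed (auto simp: radial_density_def)
    qed
    also have "\<dots> = ennreal ((3 * pi) ^ k)" by (simp add: nn_integral_cmult_indicator)
    also have "\<dots> \<le> ennreal ((3 * pi) ^ k / (1 - 3 * c) ^ (k - 1))"
    proof (rule ennreal_leI)
      have "(1 - 3 * c) ^ (k - 1) \<le> 1" using e by (intro power_le_one) auto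
      then have "(3 * pi) ^ k / 1 \<le> (3 * pi) ^ k / (1 - 3 * c) ^ (k - 1)"
        using e by (intro divide_left_mono) auto
      then show "(3 * pi) ^ k \<le> (3 * pi) ^ k / (1 - 3 * c) ^ (k - 1)" by simp
    qed
    finally show ?thesis .
  qed
qed

lemma cylinder_section_bound:
  fixes \<xi> \<eta> :: "complex ^ 'n::finite"
  assumes \<xi>: "norm \<xi> = 1" and \<eta>: "norm \<eta> = 1" and N: "CARD('n) = k + 1" and k: "k \<ge> 2"
    and c: "c > 0" "3 * c < 1"
  shows "HVol_section (cylinder \<eta> c) \<xi> \<le> 8 ^ k * ((3 * pi) ^ k / (1 - 3 * c) ^ (k - 1))"
proof -
  let ?H = "complex_hyperplane \<xi>" and ?K = "cylinder \<eta> c"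
  obtain \<zeta> \<tau> where \<zeta>: "\<zeta> \<in> ?H" "norm \<zeta> = 1" and \<tau>: "0 \<le> \<tau>" "\<tau> \<le> 1"
    and z\<tau>: "\<And>z. z \<in> ?H \<Longrightarrow> (cmod (cdot z \<eta>))\<^sup>2 = \<tau> * (cmod (cdot z \<zeta>))\<^sup>2"
    using hyperplane_direction[OF \<xi> \<eta>] N k by auto
  have \<xi>0: "\<xi> \<noteq> 0" using \<xi> by auto
  have dim: "dim ?H = 2 * (k - 1) + 2" using dim_complex_hyperplane[OF \<xi>0] N k by simp
  have k1: "k - 1 \<ge> 1" using k by simp
  let ?F = "\<lambda>A v. if \<tau> * A \<le> 2 * c \<and> (1 - \<tau>) * A + v \<le> c then ennreal (1 / (1 - A - v) ^ (k + 1)) else 0"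
  have "(\<integral>\<^sup>+x\<in>?K. ennreal (1 / (1 - (norm x)\<^sup>2) ^ CARD('n)) \<partial>lborel_subspace ?H) =
    (\<integral>\<^sup>+z. ?F ((cmod (cdot z \<zeta>))\<^sup>2) ((norm z)\<^sup>2 - (cmod (cdot z \<zeta>))\<^sup>2) \<partial>lborel_subspace ?H)"
  proof (rule nn_integral_cong_AE, use AE_lborel_subspace[OF subspace_complex_hyperplane] in eventually_elim)
    fix z assume z: "z \<in> ?H"
    have eq: "(1 - \<tau>) * (cmod (cdot z \<zeta>))\<^sup>2 + ((norm z)\<^sup>2 - (cmod (cdot z \<zeta>))\<^sup>2) = (norm z)\<^sup>2 - \<tau> * (cmod (cdot z \<zeta>))\<^sup>2"
      by (simp add: algebra_simps)
    show "ennreal (1 / (1 - (norm z)\<^sup>2) ^ CARD('n)) * indicator ?K z =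
       ?F ((cmod (cdot z \<zeta>))\<^sup>2) ((norm z)\<^sup>2 - (cmod (cdot z \<zeta>))\<^sup>2)"
      unfolding eq by (simp add: cylinder_def z\<tau>[OF z] N indicator_def)
  qed
  also have "\<dots> = (\<integral>\<^sup>+A. ennreal (radial_density 1 A) * (\<integral>\<^sup>+v. ennreal (radial_density (k - 1) v) * ?F A v \<partial>lborel) \<partial>lborel)"
    by (rule nn_integral_complex_line_split[OF subspace_complex_hyperplane smult_complex_hyperplane \<zeta> dim k1]) measurable
  also have "\<dots> \<le> (\<integral>\<^sup>+A. ennreal (radial_density 1 A) *
      (if \<tau> * A \<le> 2 * c \<and> (1 - \<tau>) * A \<le> c then ennreal (pi ^ (k - 1) / (1 - c - \<tau> * A) ^ k) else 0) \<partial>lborel)"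
  proof (rule nn_integral_mono)
    fix A :: real
    show "ennreal (radial_density 1 A) * (\<integral>\<^sup>+v. ennreal (radial_density (k - 1) v) * ?F A v \<partial>lborel) \<le>
      ennreal (radial_density 1 A) *
      (if \<tau> * A \<le> 2 * c \<and> (1 - \<tau>) * A \<le> c then ennreal (pi ^ (k - 1) / (1 - c - \<tau> * A) ^ k) else 0)"
    proof (cases "A \<ge> 0")
      case A: True
      consider "\<tau> * A \<le> 2 * c" "(1 - \<tau>) * A \<le> c" | "\<not> \<tau> * A \<le> 2 * c" | "\<not> (1 - \<tau>) * A \<le> c" by blast
      then show ?thesis
      proof cases
        case 1
        then show ?thesis using section_inner_bound[OF k c A 1] by (intro mult_left_mono) auto
      next
        case 2
        then show ?thesis by simp
      next
        case 3
        have z: "ennreal (radial_density (k - 1) v) * ?F A v = 0" for v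
        proof (cases "v \<ge> 0")
          case True
          then have "\<not> (1 - \<tau>) * A + v \<le> c" using 3 by linarith
          then show ?thesis by simp
        qed (simp add: radial_density_def)
        show ?thesis unfolding z by simp
      qed
    qed (simp add: radial_density_def)
  qed
  also have "\<dots> \<le> ennreal ((3 * pi) ^ k / (1 - 3 * c) ^ (k - 1))"
    by (rule section_outer_bound[OF k c \<tau>])
  finally have le: "enn2real (\<integral>\<^sup>+x\<in>?K. ennreal (1 / (1 - (norm x)\<^sup>2) ^ CARD('n)) \<partial>lborel_subspace ?H) \<le>
     (3 * pi) ^ k / (1 - 3 * c) ^ (k - 1)"
    using c by (intro enn2real_leI) auto
  have "CARD('n) - 1 = k" by (simp add: N)
  then show ?thesis
    unfolding HVol_section_nn[OF convex_body_borel[OF cylinder_convex_body[OF \<eta> c(1)]] cylinder_subset_ball[OF c(2)]]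
    by (simp only:) (rule mult_left_mono[OF le], simp)
qed

text \<open>
  On the part \<open>2 c - e \<le> u \<le> 2 c\<close>, \<open>c - e \<le> v \<le> c\<close> near the edge, the weight is at least \<open>(3 e) ^ -(k + 2)\<close>, and
  this part has volume of order \<open>e\<^sup>2\<close>.
\<close>

lemma cylinder_volume_bound:
  fixes \<eta> :: "complex ^ 'n::finite"
  assumes \<eta>: "norm \<eta> = 1" and N: "CARD('n) = k + 1" and k: "k \<ge> 1"
    and e: "0 < e" "e \<le> 1/10" and c: "c = (1 - e) / 3"
  shows "8 ^ (k + 1) * (pi ^ (k + 1) / fact (k - 1) * (1/5) ^ (k - 1) / 3 ^ (k + 2) / e ^ k) \<le> HVol (cylinder \<eta> c)"
proof -
  let ?K = "cylinder \<eta> c"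
  have c0: "c > 0" "3 * c < 1" "c - e \<ge> 1/5" "2 * c - e \<ge> 0" 
  proof -
    show "c > 0" "3 * c < 1" using e by (auto simp: c)
    have c3: "c = 1/3 - e/3" by (simp add: c diff_divide_distrib)
    show "c - e \<ge> 1/5" "2 * c - e \<ge> 0" using e by (simp_all add: c3)
  qed
  let ?F = "\<lambda>u v. if u \<le> 2 * c \<and> v \<le> c then ennreal (1 / (1 - u - v) ^ (k + 2)) else 0"
  let ?b = "pi ^ k / fact (k - 1) * (1/5) ^ (k - 1) * (1 / (3 * e) ^ (k + 2))"
  let ?X = "\<integral>\<^sup>+x\<in>?K. ennreal (1 / (1 - (norm x)\<^sup>2) ^ (CARD('n) + 1)) \<partial>lborel"
  have bnn: "?b \<ge> 0" using e by simp
  have "ennreal (pi * e * (?b * e)) = (\<integral>\<^sup>+u. ennreal (pi * (?b * e)) * indicator {2 * c - e..2 * c} u \<partial>lborel)"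
    using e bnn by (subst nn_integral_cmult_indicator) (auto simp: ennreal_mult[symmetric] mult_ac)
  also have "\<dots> \<le> (\<integral>\<^sup>+u. ennreal (radial_density 1 u) * (\<integral>\<^sup>+v. ennreal (radial_density k v) * ?F u v \<partial>lborel) \<partial>lborel)"
  proof (rule nn_integral_mono)
    fix u :: real
    show "ennreal (pi * (?b * e)) * indicator {2 * c - e..2 * c} u \<le>
      ennreal (radial_density 1 u) * (\<integral>\<^sup>+v. ennreal (radial_density k v) * ?F u v \<partial>lborel)"
    proof (cases "u \<in> {2 * c - e..2 * c}")
      case u: True
      have "ennreal (?b * e) = (\<integral>\<^sup>+v. ennreal ?b * indicator {c - e..c} v \<partial>lborel)"
        using e bnn by (subst nn_integral_cmult_indicator) (auto simp: ennreal_mult[symmetric])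
      also have "\<dots> \<le> (\<integral>\<^sup>+v. ennreal (radial_density k v) * ?F u v \<partial>lborel)"
      proof (rule nn_integral_mono)
        fix v :: real
        show "ennreal ?b * indicator {c - e..c} v \<le> ennreal (radial_density k v) * ?F u v"
        proof (cases "v \<in> {c - e..c}")
          case v: True
          have p: "0 < 1 - u - v" "1 - u - v \<le> 3 * e" using u v e by (auto simp: c diff_divide_distrib)
          have "pi ^ k / fact (k - 1) * (1/5) ^ (k - 1) \<le> pi ^ k / fact (k - 1) * v ^ (k - 1)"
            using v c0 by (intro mult_left_mono power_mono) auto
          moreover have "1 / (3 * e) ^ (k + 2) \<le> 1 / (1 - u - v) ^ (k + 2)"
            using p e by (intro frac_le power_mono) auto
          ultimately have "?b \<le> pi ^ k / fact (k - 1) * v ^ (k - 1) * (1 / (1 - u - v) ^ (k + 2))"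
            by (rule mult_mono) (use v c0 e in auto)
          moreover have "ennreal (radial_density k v) * ?F u v =
              ennreal (pi ^ k / fact (k - 1) * v ^ (k - 1) * (1 / (1 - u - v) ^ (k + 2)))"
            using v c0 u p by (simp add: radial_density_def ennreal_mult[symmetric])
          ultimately show ?thesis using v by (simp add: ennreal_leI del: times_divide_eq_right times_divide_eq_left)
        qed simp
      qed
      finally have "ennreal pi * ennreal (?b * e) \<le> ennreal pi * (\<integral>\<^sup>+v. ennreal (radial_density k v) * ?F u v \<partial>lborel)"
        by (rule mult_left_mono) simp
      moreover have "ennreal (pi * (?b * e)) = ennreal pi * ennreal (?b * e)"
        using e bnn by (intro ennreal_mult mult_nonneg_nonneg) auto
      moreover have "radial_density 1 u = pi" using u c0 by (simp add: radial_density_def)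
      ultimately show ?thesis using u by (simp only: indicator_simps mult_1_right)
    qed simp
  qed
  also have "\<dots> = (\<integral>\<^sup>+z. ?F ((cmod (cdot z \<eta>))\<^sup>2) ((norm z)\<^sup>2 - (cmod (cdot z \<eta>))\<^sup>2) \<partial>lborel)"
    by (rule nn_integral_complex_line_split_lborel[OF \<eta> N k, symmetric]) measurable
  also have "\<dots> = ?X"
    by (intro nn_integral_cong) (simp add: cylinder_def N indicator_def)
  finally have le: "ennreal (pi * e * (?b * e)) \<le> ?X" .
  have fin: "?X < \<infinity>"
  proof -
    obtain R where R: "0 \<le> R" "R < 1" "?K \<subseteq> cball 0 R"
      using compact_subset_ball[OF convex_body_compact[OF cylinder_convex_body[OF \<eta> c0(1)]] cylinder_subset_ball[OF c0(2)]] .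
    show ?thesis using nn_integral_weight_finite[OF subspace_UNIV R(3,2), where p = "CARD('n) + 1"]
      by (simp add: lborel_subspace_UNIV)
  qed
  have "enn2real (ennreal (pi * e * (?b * e))) \<le> enn2real ?X" using le fin by (intro enn2real_mono) auto
  then have "pi * e * (?b * e) \<le> enn2real ?X" using e bnn by (simp del: times_divide_eq_right times_divide_eq_left)
  moreover have "pi * e * (?b * e) = pi ^ (k + 1) / fact (k - 1) * (1/5) ^ (k - 1) / 3 ^ (k + 2) / e ^ k"
    using e by (simp add: power_mult_distrib power_add power2_eq_square field_simps)
  ultimately show ?thesis
    using HVol_nn[OF convex_body_borel[OF cylinder_convex_body[OF \<eta> c0(1)]] cylinder_subset_ball[OF c0(2)]]
    by (simp add: N del: times_divide_eq_right times_divide_eq_left)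
qed

text \<open>
  With \<open>e = \<delta> ^ k\<close> the ball parameter \<open>t\<close> is a power of \<open>\<delta>\<close>: \<open>t = 3 k / \<delta> ^ (k - 1)\<close> makes the sections of the ball
  at least as large as the bound \<open>(3 \<pi>) ^ k / e ^ (k - 1)\<close> for those of the cylinder. The volumes are then of
  order \<open>\<delta> ^ -(k\<^sup>2 - 1)\<close> for the ball and \<open>\<delta> ^ -k\<^sup>2\<close> for the cylinder.
\<close>

lemma Busemann_Petty_counterexample:
  assumes N: "CARD('n::finite) = k + 1" and k: "k \<ge> 2"
  obtains K L :: "(complex ^ 'n) set" where
    "convex_body K" "rotation_invariant K" "K \<subseteq> ball 0 1"
    "convex_body L" "rotation_invariant L" "L \<subseteq> ball 0 1"
    "\<forall>\<xi>\<in>sphere 0 1. HVol_section K \<xi> \<le> HVol_section L \<xi>" "HVol L < HVol K"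
proof -
  define \<eta> :: "complex ^ 'n" where "\<eta> = axis undefined 1"
  have \<eta>: "norm \<eta> = 1" by (simp add: \<eta>_def)
  have N2: "CARD('n) \<ge> 2" using N k by simp
  define C2 :: real where "C2 = pi ^ (k + 1) / fact (k - 1) * (1/5) ^ (k - 1) / 3 ^ (k + 2)"
  define C4 :: real where "C4 = pi ^ (k + 1) / fact (k + 1) * (3 * real k) ^ (k + 1)"
  have C: "C2 > 0" "C4 > 0" using k by (auto simp: C2_def C4_def)
  \<comment> \<open>The bound \<open>1/10\<close> is the range of the volume estimate; the other one makes \<open>C4 * \<delta> < C2\<close>.\<close>
  define \<delta> where "\<delta> = min (1/10) (C2 / (2 * C4))"
  have \<delta>: "0 < \<delta>" "\<delta> \<le> 1/10" "\<delta> \<le> C2 / (2 * C4)" using C by (auto simp: \<delta>_def)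
  have C\<delta>: "C4 * \<delta> < C2"
  proof -
    have "C4 * \<delta> \<le> C4 * (C2 / (2 * C4))" using \<delta> C by (intro mult_left_mono) auto
    also have "\<dots> = C2 / 2" using C by simp
    finally show ?thesis using C by linarith
  qed
  define e where "e = \<delta> ^ k"
  have e: "0 < e" "e \<le> 1/10"
  proof -
    show "0 < e" using \<delta> by (simp add: e_def)
    have "\<delta> ^ k \<le> \<delta> ^ 1" using \<delta> k by (intro power_decreasing) auto
    then show "e \<le> 1/10" using \<delta> by (simp add: e_def)
  qed
  define c where "c = (1 - e) / 3"
  have c: "c > 0" "3 * c < 1" "1 - 3 * c = e" 
  proof -
    show "c > 0" "3 * c < 1" using e by (auto simp: c_def)
    show "1 - 3 * c = e" by (simp add: c_def diff_divide_distrib)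
  qed
  define t where "t = 3 * real k / \<delta> ^ (k - 1)"
  have t: "t > 0" using \<delta> k by (simp add: t_def)
  \<comment> \<open>The radius with \<open>R\<^sup>2 / (1 - R\<^sup>2) = t\<close>.\<close>
  define R where "R = sqrt (t / (1 + t))"
  have R: "0 < R" "R < 1" "R\<^sup>2 / (1 - R\<^sup>2) = t"
  proof -
    have R2: "R\<^sup>2 = t / (1 + t)" using t by (simp add: R_def)
    show "0 < R" "R < 1" using t by (auto simp: R_def)
    show "R\<^sup>2 / (1 - R\<^sup>2) = t" unfolding R2 using t by (simp add: field_simps)
  qed
  let ?K = "cylinder \<eta> c" and ?L = "cball 0 R :: (complex ^ 'n) set"
  show ?thesis
  proof (rule that)
    show "convex_body ?K" by (rule cylinder_convex_body[OF \<eta> c(1)])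
    show "rotation_invariant ?K" by (rule cylinder_rotation_invariant)
    show "?K \<subseteq> ball 0 1" by (rule cylinder_subset_ball[OF c(2)])
    show "convex_body ?L" using R by (simp add: convex_body_def)
    show "rotation_invariant ?L" by (rule rotation_invariantI) (simp add: norm_smult_vec)
    show "?L \<subseteq> ball 0 1" using R by auto
    show "\<forall>\<xi>\<in>sphere 0 1. HVol_section ?K \<xi> \<le> HVol_section ?L \<xi>"
    proof
      fix \<xi> :: "complex ^ 'n" assume "\<xi> \<in> sphere 0 1"
      then have \<xi>: "norm \<xi> = 1" "\<xi> \<noteq> 0" by auto
      have "HVol_section ?K \<xi> \<le> 8 ^ k * ((3 * pi) ^ k / e ^ (k - 1))"
        using cylinder_section_bound[OF \<xi>(1) \<eta> N k c(1,2)] by (simp add: c(3))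
      also have "\<dots> \<le> 8 ^ k * (pi ^ k / fact k * t ^ k)"
      proof (rule mult_left_mono)
        have "(\<delta> ^ (k - 1)) ^ k = e ^ (k - 1)" by (simp add: e_def mult.commute flip: power_mult)
        then have tk: "t ^ k = 3 ^ k * real k ^ k / e ^ (k - 1)"
          by (simp add: t_def power_divide power_mult_distrib)
        have "fact k \<le> real k ^ k" using fact_le_power[of k, where 'a = real] by simp
        then have "1 \<le> real k ^ k / fact k" by (simp add: le_divide_eq)
        then have "(3 * pi) ^ k / e ^ (k - 1) * 1 \<le> (3 * pi) ^ k / e ^ (k - 1) * (real k ^ k / fact k)"
          using e by (intro mult_left_mono) auto
        also have "\<dots> = pi ^ k / fact k * t ^ k" by (simp add: tk power_mult_distrib mult_ac)
        finally show "(3 * pi) ^ k / e ^ (k - 1) \<le> pi ^ k / fact k * t ^ k" by simp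
      qed simp
      also have "\<dots> = HVol_section ?L \<xi>"
        using HVol_section_cball[of R \<xi>] R N2 \<xi>(2) N by simp
      finally show "HVol_section ?K \<xi> \<le> HVol_section ?L \<xi>" .
    qed
    show "HVol ?L < HVol ?K"
    proof -
      have "HVol ?L = 8 ^ (k + 1) * (pi ^ (k + 1) / fact (k + 1) * t ^ (k + 1))"
        using HVol_cball[of R, where 'n = 'n] R N by simp
      also have "t ^ (k + 1) = (3 * real k) ^ (k + 1) / \<delta> ^ ((k - 1) * (k + 1))"
        by (simp only: t_def power_divide power_mult)
      also have "pi ^ (k + 1) / fact (k + 1) * ((3 * real k) ^ (k + 1) / \<delta> ^ ((k - 1) * (k + 1))) = C4 / \<delta> ^ ((k - 1) * (k + 1))"
        by (simp add: C4_def)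
      also have "\<dots> = C4 * \<delta> / e ^ k"
      proof -
        obtain j where j: "k = Suc j" using k by (cases k) auto
        have "k * k = (k - 1) * (k + 1) + 1" by (simp add: j algebra_simps)
        then have "e ^ k = \<delta> ^ ((k - 1) * (k + 1)) * \<delta>" by (simp add: e_def flip: power_mult)
        then show ?thesis using \<delta> by simp
      qed
      also have "8 ^ (k + 1) * (C4 * \<delta> / e ^ k) < 8 ^ (k + 1) * (C2 / e ^ k)"
        using C\<delta> e by (intro mult_strict_left_mono divide_strict_right_mono) auto
      also have "\<dots> \<le> HVol ?K"
        using cylinder_volume_bound[OF \<eta> N _ e c_def] k by (simp add: C2_def)
      finally show ?thesis .
    qed
  qed
qed

section \<open>The equivalence\<close>

theorem theorem3:
  assumes "CARD('n::finite) \<ge> 2"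
  shows
    "(\<forall>K L :: (complex ^ 'n) set.
        convex_body K \<and> rotation_invariant K \<and> K \<subseteq> ball 0 1 \<and>
        convex_body L \<and> rotation_invariant L \<and> L \<subseteq> ball 0 1 \<and>
        (\<forall>\<xi>\<in>sphere 0 1. HVol_section K \<xi> \<le> HVol_section L \<xi>)
        \<longrightarrow> HVol K \<le> HVol L)
     \<longleftrightarrow>
     (\<forall>K :: (complex ^ 'n) set.
        convex_body K \<and> rotation_invariant K \<and> K \<subseteq> ball 0 1
        \<longrightarrow> positive_definite_distribution
              (regular_distribution
                (\<lambda>x. minkowski_functional K x powi (-2) /
                      (1 - (norm x / minkowski_functional K x)\<^sup>2))))"
    (is "?affirmative \<longleftrightarrow> ?positive_definite")
proof (cases "CARD('n) = 2")
  case True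
  have ?affirmative
  proof (intro allI impI)
    fix K L :: "(complex ^ 'n) set"
    assume "convex_body K \<and> rotation_invariant K \<and> K \<subseteq> ball 0 1 \<and>
        convex_body L \<and> rotation_invariant L \<and> L \<subseteq> ball 0 1 \<and>
        (\<forall>\<xi>\<in>sphere 0 1. HVol_section K \<xi> \<le> HVol_section L \<xi>)"
    then show "HVol K \<le> HVol L"
      by (intro Busemann_Petty_complex_dimension_two[OF True]) simp_all
  qed
  moreover have ?positive_definite
    using minkowski_positive_definite_complex_dimension_two[OF True] by simp
  ultimately show ?thesis by simp
next
  case False
  define k where "k = CARD('n) - 1"
  have k: "k \<ge> 2" "CARD('n) = k + 1" using False assms by (auto simp: k_def)
  have not_affirmative: "\<not> ?affirmative"
  proof -
    obtain K L :: "(complex ^ 'n) set" where KL: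
      "convex_body K" "rotation_invariant K" "K \<subseteq> ball 0 1"
      "convex_body L" "rotation_invariant L" "L \<subseteq> ball 0 1"
      "\<forall>\<xi>\<in>sphere 0 1. HVol_section K \<xi> \<le> HVol_section L \<xi>" "HVol L < HVol K"
      using Busemann_Petty_counterexample[OF k(2,1)] .
    show ?thesis
    proof
      assume ?affirmative
      have "HVol K \<le> HVol L"
        by (rule mp[OF spec[OF spec[OF \<open>?affirmative\<close>, of K], of L]]) (intro conjI KL)
      then show False using KL(8) by linarith
    qed
  qed
  have not_positive_definite: "\<not> ?positive_definite"
  proof -
    define \<eta> :: "complex ^ 'n" where "\<eta> = axis undefined 1"
    have \<eta>: "norm \<eta> = 1" by (simp add: \<eta>_def)
    obtain c where c: "c > 0" "3 * c < 1"
      "\<not> positive_definite_distribution (regular_distribution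
        (\<lambda>x. minkowski_functional (cylinder \<eta> c) x powi (-2) /
             (1 - (norm x / minkowski_functional (cylinder \<eta> c) x)\<^sup>2)))"
      using cylinder_not_positive_definite[OF \<eta> k(2,1)] .
    show ?thesis
    proof
      assume ?positive_definite
      from mp[OF spec[OF this, of "cylinder \<eta> c"]]
        cylinder_convex_body[OF \<eta> c(1)] cylinder_rotation_invariant[of \<eta> c]
        cylinder_subset_ball[OF c(2), of \<eta>]
      show False using c(3) by blast
    qed
  qed
  show ?thesis
    by (rule iffI, erule notE[OF not_affirmative], erule notE[OF not_positive_definite])
qed

end
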